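(* Let $\mathfrak L=\inf\{m(f(t))>0: f(t)\in\mathbb Z[t]\text{ primitive}\}$. The following conditions are equivalent: (a) $\mathfrak L>0$; (b) $h(\phi)$ realizes for every abelian group $G$ and every $\phi\in\mathrm{End}(G)$ with $h(\phi)<\infty$.
   Context: Algebraic entropy: for an abelian group $G$, $[G]^{<\omega}$ denotes the family of all non-empty finite subsets of $G$. For $\phi\in\mathrm{End}(G)$, $F\in[G]^{<\omega}$ and a positive integer $n$ let $T_n(\phi,F)=F+\phi(F)+\ldots+\phi^{n-1}(F)$ and $H(\phi,F)=\lim_{n\to\infty}\frac{\log|T_n(\phi,F)|}{n}$ (this limit always exists). The algebraic entropy is $h(\phi)=\sup\{H(\phi,F):F\in[G]^{<\omega}\}\in[0,\infty]$. If $h(\phi)<\infty$, one says that $h(\phi)$ realizes if there exists $F\in[G]^{<\omega}$ such that $h(\phi)=H(\phi,F)$. Mahler measure: for a primitive polynomial $f(t)=a_0+a_1t+\ldots+a_kt^k\in\mathbb Z[t]$ of degree $k$ with complex roots $\alpha_1,\ldots,\alpha_k$ (with multiplicity), $m(f(t))=\log|a_k|+\sum_{|\alpha_i|>1}\log|\alpha_i|$. The infimum defining $\mathfrak L$ is over the strictly positive values of $m$ on primitive polynomials. *)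

theory Defs
  imports "HOL-Library.Extended_Real" "HOL-Algebra.Coset" "HOL-Computational_Algebra.Polynomial_Factorial"
begin

text \<open>
  Abelian groups are the locale-based ones of HOL-Algebra, written multiplicatively: the sum
  of sets \<open>A + B\<close> is \<open>A <#>\<^bsub>G\<^esub> B\<close>, and an endomorphism of \<open>G\<close> is an
  element of \<open>hom G G\<close>.
\<close>

definition nonempty_finite_subsets :: "('a, 'm) monoid_scheme \<Rightarrow> 'a set set" where
  "nonempty_finite_subsets G = {F. F \<subseteq> carrier G \<and> finite F \<and> F \<noteq> {}}"

text \<open>
  \<open>trajectory G \<phi> F n\<close> is \<open>F + \<phi>(F) + \<dots> + \<phi>\<^bsup>n-1\<^esup>(F)\<close>; the empty sum
  at \<open>n = 0\<close> is the trivial subgroup and plays no role in the limit below.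
\<close>

primrec trajectory ::
  "('a, 'm) monoid_scheme \<Rightarrow> ('a \<Rightarrow> 'a) \<Rightarrow> 'a set \<Rightarrow> nat \<Rightarrow> 'a set" where
  "trajectory G \<phi> F 0 = {\<one>\<^bsub>G\<^esub>}"
| "trajectory G \<phi> F (Suc n) = trajectory G \<phi> F n <#>\<^bsub>G\<^esub> (\<phi> ^^ n) ` F"

definition entropy_on ::
  "('a, 'm) monoid_scheme \<Rightarrow> ('a \<Rightarrow> 'a) \<Rightarrow> 'a set \<Rightarrow> real" where
  "entropy_on G \<phi> F = lim (\<lambda>n. ln (real (card (trajectory G \<phi> F n))) / real n)"

definition algebraic_entropy ::
  "('a, 'm) monoid_scheme \<Rightarrow> ('a \<Rightarrow> 'a) \<Rightarrow> ereal" where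
  "algebraic_entropy G \<phi> = (SUP F \<in> nonempty_finite_subsets G. ereal (entropy_on G \<phi> F))"

text \<open>
  Below, "every abelian group" is rendered by quantifying over all \<open>G :: 'a monoid\<close>
  for an arbitrary infinite type \<open>'a\<close>. Every abelian group has an isomorphic copy of this
  kind for a suitable \<open>'a\<close>. Infinity of \<open>'a\<close> cannot be dropped: over a finite type
  all groups are finite, so every entropy is \<open>0\<close> and is trivially realized.
\<close>

definition entropy_realizes ::
  "('a, 'm) monoid_scheme \<Rightarrow> ('a \<Rightarrow> 'a) \<Rightarrow> bool" where
  "entropy_realizes G \<phi> \<longleftrightarrow>
     (\<exists>F \<in> nonempty_finite_subsets G. algebraic_entropy G \<phi> = ereal (entropy_on G \<phi> F))"

definition primitive_poly :: "int poly \<Rightarrow> bool" where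
  "primitive_poly f \<longleftrightarrow> content f = 1"

text \<open>The logarithmic Mahler measure; \<open>proots\<close> is the multiset of roots.\<close>

definition log_mahler_measure :: "int poly \<Rightarrow> real" where
  "log_mahler_measure f =
     ln \<bar>real_of_int (lead_coeff f)\<bar> +
     (\<Sum>\<alpha> \<in># filter_mset (\<lambda>\<alpha>. norm \<alpha> > 1) (proots (map_poly complex_of_int f)). ln (norm \<alpha>))"

text \<open>
  The set below is nonempty (it contains the measure of \<open>X - 2\<close>) and bounded below by
  \<open>0\<close>, so the infimum in the reals is the genuine one.
\<close>

definition lehmer_infimum :: real where
  "lehmer_infimum =
     Inf {log_mahler_measure f | f. primitive_poly f \<and> log_mahler_measure f > 0}"

end

theory Submission
  imports Defs
    "HOL-Computational_Algebra.Fundamental_Theorem_Algebra"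
    "HOL-Library.FuncSet"
    "HOL-Library.Poly_Mapping"
    "HOL-Library.Countable"
    "Jordan_Normal_Form.Determinant"
begin

text \<open>
  An abelian group with an endomorphism is a module over \<open>\<int>[t]\<close>, and finite entropy forces it to be a
  torsion module. Two facts drive the proof. First, in a finitely generated torsion module, killed by
  \<open>f\<close> say, division by \<open>f\<close> with rounding of the quotient shows that polynomial combinations of the
  generators with arbitrarily large coefficients are, up to a polynomial factor, no more numerous than
  those with coefficients below a constant depending on \<open>f\<close>; hence the entropy is attained by a finite
  set. Second, if \<open>N\<close> arises from \<open>M\<close> by adjoining one generator, then after refining the extension
  \<open>N/M\<close> is \<open>\<int>[t]/(g)\<close>, with \<open>g\<close> a prime number or a primitive polynomial, or it is finite. The
  entropy grows by at least \<open>log p\<close> or \<open>m(g)\<close> if these are positive, and not at all otherwise. The lower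
  bound comes from the ring \<open>\<int>[t]/(g, t\<^sup>n - 2)\<close>: it has \<open>\<bar>a\<bar>\<^sup>n \<Prod> \<bar>\<alpha>\<^sup>n - 2\<bar>\<close> elements, each represented by a
  polynomial with bounded coefficients. So if Mahler measures have a gap at \<open>0\<close>, entropies
  of finitely generated submodules have one too, and the supremum is reached.

  Conversely, if primitive polynomials \<open>f\<^sub>i\<close> satisfy \<open>0 < m(f\<^sub>i) < 2\<^sup>-\<^sup>i\<close>, then the direct sum of the
  modules \<open>\<int>[t]/(f\<^sub>i)\<close> has entropy at most \<open>2 \<Sum> m(f\<^sub>i)\<close>, but every finite set lies in a partial sum
  and can be enlarged to one of larger entropy.
\<close>

section \<open>Growth rates\<close>

text \<open>The modulus \<open>t^n - 2\<close> is preferred to \<open>t^n - 1\<close> because a root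
  of unity \<open>\<alpha>\<close> makes \<open>\<alpha>^n - 1\<close> vanish for infinitely many
  \<open>n\<close>, and other points of the unit circle bring it close to 0. With 2, each factor has
  norm at least 1 if \<open>norm \<alpha> \<le> 1\<close> and is comparable to
  \<open>norm \<alpha> ^ n\<close> otherwise, so the determinant grows at least like
  \<open>mahler g ^ n\<close>. All counting is done with cosets of one fixed submodule
  \<open>K\<close> of a free module, so a chain of extensions consists of submodules of a single
  type and their entropies are directly comparable. Gains along such a chain compose because each
  finitely generated stage attains its maximum. The converse needs an upper bound for a direct sum.
  Residues modulo \<open>f\<close> are separated by their values at the roots; these determine a
  remainder if the roots are simple, and remainders stay integral if the leading coefficient is
  \<open>1\<close> or \<open>- 1\<close>. Minimal degree secures simple roots. Real and imaginary
  parts of the values are counted independently, which squares the Mahler measure and is the origin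
  of the factor 2.\<close>

lemma fekete:
  fixes a :: "nat \<Rightarrow> real"
  assumes sub: "\<And>m n. a (m + n) \<le> a m + a n" and nonneg: "\<And>n. 0 \<le> a n" and zero: "a 0 = 0"
  shows "convergent (\<lambda>n. a n / real n)"
proof -
  define S where "S = (\<lambda>n. a n / real n) ` {1..}"
  define L where "L = Inf S"
  have bdd: "bdd_below S"
    unfolding S_def by (rule bdd_belowI2[of _ 0]) (simp add: nonneg)
  have L_le: "L \<le> a n / real n" if "n \<ge> 1" for n
    unfolding L_def by (rule cInf_lower[OF _ bdd]) (use that in \<open>auto simp: S_def\<close>)
  have mult: "a (q * N) \<le> real q * a N" for q N
  proof (induction q)
    case 0
    then show ?case by (simp add: zero)
  next
    case (Suc q)
    have "a (Suc q * N) \<le> a N + a (q * N)" using sub[of N "q * N"] by simp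
    then show ?case using Suc by (simp add: algebra_simps)
  qed
  have "(\<lambda>n. a n / real n) \<longlonglongrightarrow> L"
  proof (rule LIMSEQ_I)
    fix e :: real assume e: "e > 0"
    have "\<exists>x\<in>S. x < L + e / 2"
      using e bdd cInf_less_iff[of S "L + e/2"] unfolding L_def S_def by fastforce
    then obtain N where N: "N \<ge> 1" "a N / real N < L + e / 2" unfolding S_def by auto
    \<comment> \<open>Bounds \<open>a\<close> at every possible remainder \<open>n mod N\<close>, so
      that its share of \<open>a n / n\<close> tends to 0.\<close>
    define B where "B = (\<Sum>r<N. a r)"
    obtain n0 where n0: "real n0 > 2 * B / e" using reals_Archimedean2 by blast
    show "\<exists>no. \<forall>n\<ge>no. norm (a n / real n - L) < e"
    proof (intro exI allI impI)
      fix n assume n: "n \<ge> max n0 1"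
      have B0: "B \<ge> 0" unfolding B_def by (simp add: nonneg sum_nonneg)
      have "a n \<le> a (n div N * N) + a (n mod N)" using sub[of "n div N * N" "n mod N"] by simp
      also have "a (n mod N) \<le> B" unfolding B_def
        by (rule member_le_sum) (use N nonneg in auto)
      also have "a (n div N * N) \<le> real (n div N) * a N" by (rule mult)
      also have "real (n div N) * a N = real (n div N * N) * (a N / real N)" using N by simp
      also have "\<dots> \<le> real n * (a N / real N)"
        by (intro mult_right_mono of_nat_mono) (simp_all add: nonneg)
      finally have "a n \<le> real n * (a N / real N) + B" by simp
      then have "a n / real n \<le> a N / real N + B / real n" using n by (simp add: field_simps)
      moreover have "B / real n < e / 2"
      proof -
        have "2 * B / e < real n" using n n0 by simp
        then show ?thesis using e n by (simp add: field_simps)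
      qed
      moreover have "L \<le> a n / real n" using L_le n by simp
      ultimately have "a n / real n - L < e" "0 \<le> a n / real n - L" using N(2) by linarith+
      then show "norm (a n / real n - L) < e" by (simp only: real_norm_def abs_of_nonneg)
    qed
  qed
  then show ?thesis by (rule convergentI)
qed

text \<open>Taking logarithms and dividing by \<open>n\<close> makes the constant, the power of
  \<open>n\<close> and the shift \<open>m\<close> negligible, while the exponential factors survive
  as \<open>ln M\<close> and \<open>ln M'\<close>; a gain of entropy enters through
  \<open>M\<close>.\<close>

lemma growth_le:
  fixes a b :: "nat \<Rightarrow> nat" and M M' C :: real
  assumes A: "(\<lambda>n. ln (a n) / n) \<longlonglongrightarrow> A" and B: "(\<lambda>n. ln (b n) / n) \<longlonglongrightarrow> B"
    and pos: "\<And>n. a n > 0" "\<And>n. b n > 0" "M > 0" "M' > 0"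
    and le: "\<And>n. n \<ge> n0 \<Longrightarrow> a n * M ^ n \<le> C * real n ^ d * b (n + m) * M' ^ n"
  shows "A + ln M \<le> B + ln M'"
proof -
  \<comment> \<open>\<open>C\<close> carries no sign condition; a positive constant is needed to
    split its logarithm off.\<close>
  define C' where "C' = max C 1"
  then have "C' > 0" by simp
  have le': "ln (a n) / n + ln M \<le> ln C' / n + d * (ln n / n) + ln (b (n + m)) / (n + m) * ((n + m) / n) + ln M'"
    if n: "n \<ge> max n0 1" for n
  proof -
    have "a n * M ^ n \<le> C * (real n ^ d * b (n + m) * M' ^ n)" using le[of n] n by (simp add: mult.assoc)
    also have "\<dots> \<le> C' * (real n ^ d * b (n + m) * M' ^ n)"
      by (rule mult_right_mono) (use pos in \<open>auto simp: C'_def\<close>)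
    finally have "ln (a n * M ^ n) \<le> ln (C' * (real n ^ d * b (n + m) * M' ^ n))"
      using pos by (intro ln_mono) (auto intro!: mult_pos_pos)
    then have "ln (a n) + n * ln M \<le> ln C' + d * ln n + ln (b (n + m)) + n * ln M'"
      using pos n \<open>C' > 0\<close> by (simp add: ln_mult ln_realpow)
    then have "(ln (a n) + n * ln M) / n \<le> (ln C' + d * ln n + ln (b (n + m)) + n * ln M') / n"
      by (rule divide_right_mono) simp
    moreover have "ln (real (b (n + m))) / (n + m) * ((n + m) / n) = ln (real (b (n + m))) / n"
      using n by (simp del: of_nat_add)
    ultimately show ?thesis using n by (simp add: add_divide_distrib)
  qed
  have "(\<lambda>n. ln (a n) / n + ln M) \<longlonglongrightarrow> A + ln M" by (intro tendsto_intros A)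
  moreover have "(\<lambda>n. ln C' / n + d * (ln n / n) + ln (b (n + m)) / (n + m) * ((n + m) / n) + ln M')
      \<longlonglongrightarrow> (0::real) + real d * 0 + B * (1 + 0) + ln M'"
  proof -
    have 1: "(\<lambda>n. ln (b (n + m)) / (n + m)) \<longlonglongrightarrow> B" using B by (rule LIMSEQ_ignore_initial_segment)
    have "(\<lambda>n. 1 + real m / real n) \<longlonglongrightarrow> 1 + 0" by (intro tendsto_add tendsto_const lim_const_over_n)
    then have 2: "(\<lambda>n. (n + m) / n) \<longlonglongrightarrow> 1 + 0"
      by (rule Lim_transform_eventually)
        (auto simp: eventually_sequentially field_simps intro!: exI[of _ 1])
    show ?thesis
      by (rule tendsto_add[OF tendsto_add[OF tendsto_add[OF lim_const_over_n 
            tendsto_mult[OF tendsto_const filterlim_compose[OF ln_x_over_x_tendsto_0 filterlim_real_sequentially]]] tendsto_mult[OF 1 2]] tendsto_const])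
  qed
  ultimately have "A + ln M \<le> 0 + real d * 0 + B * (1 + 0) + ln M'"
    by (rule LIMSEQ_le) (use le' in blast)
  then show ?thesis by simp
qed

section \<open>Counting modulo a subgroup\<close>

text \<open>The coset \<open>v + K\<close>. Cosets are kept as plain sets, so that quotients by
  different \<open>K\<close> live in the same type.\<close>

definition residue_class :: "'v::ab_group_add set \<Rightarrow> 'v \<Rightarrow> 'v set" where
  "residue_class K v = {w. w - v \<in> K}"

definition residue_count :: "'v::ab_group_add set \<Rightarrow> 'v set \<Rightarrow> nat" where
  "residue_count K S = card (residue_class K ` S)"

definition add_subgroup :: "'v::ab_group_add set \<Rightarrow> bool" where
  "add_subgroup K \<longleftrightarrow> 0 \<in> K \<and> (\<forall>x\<in>K. \<forall>y\<in>K. x - y \<in> K)"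

lemma add_subgroupD:
  assumes "add_subgroup K"
  shows "0 \<in> K" "x \<in> K \<Longrightarrow> y \<in> K \<Longrightarrow> x - y \<in> K" "x \<in> K \<Longrightarrow> - x \<in> K" "x \<in> K \<Longrightarrow> y \<in> K \<Longrightarrow> x + y \<in> K"
proof -
  have D: "0 \<in> K" "x \<in> K \<Longrightarrow> y \<in> K \<Longrightarrow> x - y \<in> K" for x y using assms by (auto simp: add_subgroup_def)
  have N: "x \<in> K \<Longrightarrow> - x \<in> K" for x using D(2)[of 0 x] D(1) by simp
  show "0 \<in> K" "x \<in> K \<Longrightarrow> y \<in> K \<Longrightarrow> x - y \<in> K" "x \<in> K \<Longrightarrow> - x \<in> K" using D N by auto
  show "x \<in> K \<Longrightarrow> y \<in> K \<Longrightarrow> x + y \<in> K" using D(2)[of x "- y"] N by simp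
qed

lemma residue_class_eq_iff:
  assumes K: "add_subgroup K"
  shows "residue_class K u = residue_class K v \<longleftrightarrow> u - v \<in> K"
proof
  assume "residue_class K u = residue_class K v"
  moreover have "u \<in> residue_class K u" using add_subgroupD(1)[OF K] by (simp add: residue_class_def)
  ultimately show "u - v \<in> K" by (simp add: residue_class_def)
next
  assume uv: "u - v \<in> K"
  show "residue_class K u = residue_class K v"
  proof (intro Set.set_eqI)
    fix w
    have "w - u \<in> K \<Longrightarrow> w - v \<in> K" using add_subgroupD(4)[OF K _ uv, of "w - u"] by simp
    moreover have "w - v \<in> K \<Longrightarrow> w - u \<in> K" using add_subgroupD(2)[OF K _ uv, of "w - v"] by simp
    ultimately show "w \<in> residue_class K u \<longleftrightarrow> w \<in> residue_class K v" unfolding residue_class_def by blast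
  qed
qed

lemma residue_count_pos: "finite S \<Longrightarrow> S \<noteq> {} \<Longrightarrow> residue_count K S > 0"
  by (simp add: residue_count_def card_gt_0_iff)

lemma residue_count_le_card: "finite S \<Longrightarrow> residue_count K S \<le> card S"
  by (simp add: residue_count_def card_image_le)

lemma residue_count_mono:
  assumes "add_subgroup K" "finite S'" "\<And>s. s \<in> S \<Longrightarrow> \<exists>s'\<in>S'. s - s' \<in> K"
  shows "residue_count K S \<le> residue_count K S'"
  unfolding residue_count_def
proof (rule card_mono)
  show "residue_class K ` S \<subseteq> residue_class K ` S'" using assms residue_class_eq_iff by fastforce
qed (use assms in auto)

lemma residue_count_subset: "finite S' \<Longrightarrow> S \<subseteq> S' \<Longrightarrow> residue_count K S \<le> residue_count K S'"
  unfolding residue_count_def by (intro card_mono finite_imageI image_mono)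

text \<open>The coset of a sum depends only on the cosets of the summands, so each coset met by
  \<open>S\<close> is the value of \<open>g\<close> at a pair of cosets. This gives subadditivity
  for trajectories, and later splits off factors that are negligible in the limit.\<close>

lemma residue_count_add_le:
  assumes K: "add_subgroup K" and fin: "finite A" "finite B"
    and cov: "\<And>s. s \<in> S \<Longrightarrow> \<exists>a\<in>A. \<exists>b\<in>B. s - (a + b) \<in> K"
  shows "residue_count K S \<le> residue_count K A * residue_count K B"
proof -
  define g where "g = (\<lambda>(X, Y). {x + y |x y. x \<in> X \<and> y \<in> Y} :: 'a set)"
  have g: "g (residue_class K a, residue_class K b) = residue_class K (a + b)" for a b
  proof (intro Set.set_eqI iffI)
    fix w assume "w \<in> g (residue_class K a, residue_class K b)"
    then obtain x y where "w = x + y" "x - a \<in> K" "y - b \<in> K" by (auto simp: g_def residue_class_def)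
    then show "w \<in> residue_class K (a + b)"
      using add_subgroupD(4)[OF K, of "x - a" "y - b"] by (simp add: residue_class_def algebra_simps)
  next
    fix w assume "w \<in> residue_class K (a + b)"
    then have "w = a + (w - a)" "a \<in> residue_class K a" "w - a \<in> residue_class K b"
      using add_subgroupD(1)[OF K] by (auto simp: residue_class_def algebra_simps)
    then show "w \<in> g (residue_class K a, residue_class K b)" unfolding g_def by blast
  qed
  have "residue_class K ` S \<subseteq> g ` (residue_class K ` A \<times> residue_class K ` B)"
  proof
    fix X assume "X \<in> residue_class K ` S"
    then obtain s where s: "s \<in> S" "X = residue_class K s" by auto
    from cov[OF s(1)] obtain a b where ab: "a \<in> A" "b \<in> B" "s - (a + b) \<in> K" by blast
    then have "X = g (residue_class K a, residue_class K b)" using s residue_class_eq_iff[OF K, of s "a + b"] g by simp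
    then show "X \<in> g ` (residue_class K ` A \<times> residue_class K ` B)" using ab by blast
  qed
  then have "residue_count K S \<le> card (residue_class K ` A \<times> residue_class K ` B)" unfolding residue_count_def
    using fin by (meson card_image_le card_mono finite_SigmaI finite_imageI le_trans)
  then show ?thesis by (simp add: residue_count_def card_cartesian_product)
qed

text \<open>Representatives of \<open>A\<close> modulo \<open>M\<close> and of \<open>B\<close>
  modulo \<open>K\<close> have sums that are distinct modulo \<open>K\<close>: modulo
  \<open>M\<close> the sum determines the first summand, and then the second follows. This is the
  counting behind every entropy gain.\<close>

lemma residue_count_mult_le:
  assumes K: "add_subgroup K" and M: "add_subgroup M" "K \<subseteq> M" "B \<subseteq> M"
    and S: "finite S" "\<And>a b. a \<in> A \<Longrightarrow> b \<in> B \<Longrightarrow> a + b \<in> S"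
  shows "residue_count M A * residue_count K B \<le> residue_count K S"
proof -
  obtain A' where A': "A' \<subseteq> A" "inj_on (residue_class M) A'" "residue_class M ` A = residue_class M ` A'"
    by (meson subset_image_inj order_refl)
  obtain B' where B': "B' \<subseteq> B" "inj_on (residue_class K) B'" "residue_class K ` B = residue_class K ` B'"
    by (meson subset_image_inj order_refl)
  have inj: "inj_on (\<lambda>(a, b). residue_class K (a + b)) (A' \<times> B')"
  proof (rule inj_onI, clarify)
    fix a b a' b' assume *: "a \<in> A'" "b \<in> B'" "a' \<in> A'" "b' \<in> B'" "residue_class K (a + b) = residue_class K (a' + b')"
    have d: "(a + b) - (a' + b') \<in> K" using * residue_class_eq_iff[OF K] by blast
    have "b \<in> M" "b' \<in> M" using * B' M by auto
    then have "b' - b \<in> M" using add_subgroupD(2)[OF M(1)] by blast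
    then have "((a + b) - (a' + b')) + (b' - b) \<in> M" using d M add_subgroupD(4)[OF M(1)] by blast
    then have "a - a' \<in> M" by (simp add: algebra_simps)
    then have "a = a'" using * A' residue_class_eq_iff[OF M(1)] by (meson inj_onD)
    moreover from this have "b - b' \<in> K" using d by simp
    then have "b = b'" using * B' residue_class_eq_iff[OF K] by (meson inj_onD)
    ultimately show "a = a' \<and> b = b'" by simp
  qed
  have "residue_count M A * residue_count K B = card A' * card B'" unfolding residue_count_def A'(3) B'(3)
    using A' B' by (simp add: card_image)
  also have "\<dots> = card ((\<lambda>(a, b). residue_class K (a + b)) ` (A' \<times> B'))"
    using inj by (simp add: card_image card_cartesian_product)
  also have "\<dots> \<le> card (residue_class K ` S)"
    using S A'(1) B'(1) by (intro card_mono) fastforce+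
  finally show ?thesis by (simp add: residue_count_def)
qed

section \<open>Boxes of integer polynomials\<close>

definition int_box :: "nat \<Rightarrow> nat \<Rightarrow> int poly set" where
  "int_box n c = {p. (\<forall>i\<ge>n. coeff p i = 0) \<and> (\<forall>i. \<bar>coeff p i\<bar> \<le> int c)}"

lemma int_box_I: "(\<And>i. i \<ge> n \<Longrightarrow> coeff p i = 0) \<Longrightarrow> (\<And>i. i < n \<Longrightarrow> \<bar>coeff p i\<bar> \<le> int c) \<Longrightarrow> p \<in> int_box n c"
  unfolding int_box_def by (auto, metis abs_zero linorder_not_le of_nat_0_le_iff)

lemma zero_in_int_box [simp]: "0 \<in> int_box n c"
  by (simp add: int_box_def)

lemma int_box_mono: "m \<le> n \<Longrightarrow> a \<le> b \<Longrightarrow> int_box m a \<subseteq> int_box n b"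
  unfolding int_box_def by (auto intro: order_trans)

lemma int_box_add: "p \<in> int_box n a \<Longrightarrow> q \<in> int_box n b \<Longrightarrow> p + q \<in> int_box n (a + b)"
  unfolding int_box_def by (auto intro!: order_trans[OF abs_triangle_ineq] add_mono)

lemma int_box_monom_mult: "p \<in> int_box n a \<Longrightarrow> monom 1 j * p \<in> int_box (n + j) a"
  by (auto simp: int_box_def coeff_monom_mult)

text \<open>Each coefficient of the product is a sum of at most \<open>m\<close> terms bounded by
  \<open>a * b\<close>.\<close>

lemma int_box_mult:
  assumes "p \<in> int_box m a" "q \<in> int_box n b"
  shows "p * q \<in> int_box (m + n) (m * a * b)"
proof (rule int_box_I)
  fix i assume i: "i \<ge> m + n"
  have "coeff p j * coeff q (i - j) = 0" if "j \<le> i" for j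
  proof (cases "j < m")
    case True
    then have "i - j \<ge> n" using i by simp
    then show ?thesis using assms by (simp add: int_box_def)
  qed (use assms in \<open>simp add: int_box_def\<close>)
  then show "coeff (p * q) i = 0" unfolding coeff_mult by (intro sum.neutral) simp
next
  fix i
  have "\<bar>coeff (p * q) i\<bar> \<le> (\<Sum>j\<le>i. \<bar>coeff p j * coeff q (i - j)\<bar>)"
    unfolding coeff_mult by (rule sum_abs)
  also have "\<dots> = (\<Sum>j\<in>{..i} \<inter> {..<m}. \<bar>coeff p j * coeff q (i - j)\<bar>)"
    by (rule sum.mono_neutral_right) (use assms in \<open>auto simp: int_box_def, meson linorder_not_le\<close>)
  also have "\<dots> \<le> (\<Sum>j\<in>{..i} \<inter> {..<m}. int a * int b)"
    by (rule sum_mono) (use assms in \<open>auto simp: int_box_def abs_mult intro!: mult_mono\<close>)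
  also have "\<dots> = int (card ({..i} \<inter> {..<m})) * (int a * int b)" by simp
  also have "\<dots> \<le> int m * (int a * int b)"
    by (intro mult_right_mono of_nat_mono) (use card_mono[of "{..<m}" "{..i} \<inter> {..<m}"] in auto)
  finally show "\<bar>coeff (p * q) i\<bar> \<le> int (m * a * b)" by (simp add: mult.assoc)
qed

lemma finite_int_box: "finite (int_box n c)"
proof (rule finite_subset)
  show "int_box n c \<subseteq> Poly ` {xs. set xs \<subseteq> {- int c..int c} \<and> length xs = n}"
  proof
    fix p assume p: "p \<in> int_box n c"
    have "p = Poly (map (coeff p) [0..<n])"
      by (rule poly_eqI) (use p in \<open>auto simp: int_box_def nth_default_def\<close>)
    moreover have "set (map (coeff p) [0..<n]) \<subseteq> {- int c..int c}"
      using p by (auto simp: int_box_def abs_le_iff minus_le_iff)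
    ultimately show "p \<in> Poly ` {xs. set xs \<subseteq> {- int c..int c} \<and> length xs = n}"
      by (intro image_eqI) auto
  qed
  show "finite (Poly ` {xs. set xs \<subseteq> {- int c..int c} \<and> length xs = n})"
    by (intro finite_imageI finite_lists_length_eq) simp
qed

lemma int_box_exists: "\<exists>n c. p \<in> int_box n c"
proof (intro exI)
  show "p \<in> int_box (Suc (degree p)) (\<Sum>i\<le>degree p. nat \<bar>coeff p i\<bar>)"
  proof (rule int_box_I)
    fix i assume "i < Suc (degree p)"
    then have "nat \<bar>coeff p i\<bar> \<le> (\<Sum>i\<le>degree p. nat \<bar>coeff p i\<bar>)"
      by (intro member_le_sum) auto
    then show "\<bar>coeff p i\<bar> \<le> int (\<Sum>i\<le>degree p. nat \<bar>coeff p i\<bar>)" by linarith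
  qed (simp add: coeff_eq_0)
qed

section \<open>Trajectories in modules over the integer polynomials\<close>

locale int_poly_module = Modules.module scale
  for scale :: "int poly \<Rightarrow> 'v::ab_group_add \<Rightarrow> 'v" (infixr "*s" 75)
begin

text \<open>Multiplication by \<open>monom 1 n\<close>, that is by \<open>t^n\<close>, stands for
  the n-th iterate of the endomorphism.\<close>

primrec traj :: "'v set \<Rightarrow> nat \<Rightarrow> 'v set" where
  "traj F 0 = {0}"
| "traj F (Suc n) = (\<lambda>(a, b). a + monom 1 n *s b) ` (traj F n \<times> F)"

text \<open>The entropy of the image of \<open>F\<close> in the quotient by
  \<open>K\<close>.\<close>

definition entropy :: "'v set \<Rightarrow> 'v set \<Rightarrow> real" where
  "entropy K F = lim (\<lambda>n. ln (real (residue_count K (traj F n))) / real n)"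

lemma subspace_add_subgroup: "subspace K \<Longrightarrow> add_subgroup K"
  by (simp add: add_subgroup_def subspace_0 subspace_diff)

lemma finite_traj: "finite F \<Longrightarrow> finite (traj F n)"
  by (induction n) auto

lemma traj_nonempty: "F \<noteq> {} \<Longrightarrow> traj F n \<noteq> {}"
  by (induction n) auto

lemma traj_subspace: "subspace M \<Longrightarrow> F \<subseteq> M \<Longrightarrow> traj F n \<subseteq> M"
  by (induction n) (auto simp: subspace_0 intro!: subspace_add subspace_scale)

lemma traj_add: "x \<in> traj F (m + n) \<Longrightarrow> \<exists>a\<in>traj F m. \<exists>b\<in>traj F n. x = a + monom 1 m *s b"
proof (induction n arbitrary: x)
  case 0
  then show ?case by (auto intro!: bexI[of _ x])
next
  case (Suc n)
  then obtain y f where yf: "y \<in> traj F (m + n)" "f \<in> F" "x = y + monom 1 (m + n) *s f" by auto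
  from Suc.IH[OF yf(1)] obtain a b where ab: "a \<in> traj F m" "b \<in> traj F n" "y = a + monom 1 m *s b" by blast
  have "x = a + monom 1 m *s (b + monom 1 n *s f)"
    by (simp add: yf ab scale_right_distrib mult_monom add.assoc)
  moreover have "b + monom 1 n *s f \<in> traj F (Suc n)" using ab yf by (auto intro!: image_eqI)
  ultimately show ?case using ab by blast
qed

lemma traj_sum: "traj {a + b |a b. a \<in> A \<and> b \<in> B} n = {a + b |a b. a \<in> traj A n \<and> b \<in> traj B n}"
proof (induction n)
  case (Suc n)
  show ?case
  proof (intro Set.set_eqI iffI)
    fix x assume "x \<in> traj {a + b |a b. a \<in> A \<and> b \<in> B} (Suc n)"
    then obtain y a b where *: "y \<in> traj {a + b |a b. a \<in> A \<and> b \<in> B} n" "a \<in> A" "b \<in> B" "x = y + monom 1 n *s (a + b)"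
      by auto
    then obtain u v where uv: "u \<in> traj A n" "v \<in> traj B n" "y = u + v" using Suc by auto
    have "x = (u + monom 1 n *s a) + (v + monom 1 n *s b)"
      by (simp add: * uv scale_right_distrib algebra_simps)
    moreover have "u + monom 1 n *s a \<in> traj A (Suc n)" "v + monom 1 n *s b \<in> traj B (Suc n)"
      using uv * by (auto intro!: image_eqI)
    ultimately show "x \<in> {a + b |a b. a \<in> traj A (Suc n) \<and> b \<in> traj B (Suc n)}" by blast
  next
    fix x assume "x \<in> {a + b |a b. a \<in> traj A (Suc n) \<and> b \<in> traj B (Suc n)}"
    then obtain u v a b where *: "u \<in> traj A n" "v \<in> traj B n" "a \<in> A" "b \<in> B"
      "x = (u + monom 1 n *s a) + (v + monom 1 n *s b)" by auto
    then have "x = (u + v) + monom 1 n *s (a + b)" by (simp add: scale_right_distrib algebra_simps)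
    moreover have "u + v \<in> traj {a + b |a b. a \<in> A \<and> b \<in> B} n" using * Suc by auto
    ultimately show "x \<in> traj {a + b |a b. a \<in> A \<and> b \<in> B} (Suc n)"
      using * by (auto intro!: image_eqI[of _ _ "(u + v, a + b)"])
  qed
qed simp

lemma traj_cong:
  assumes K: "subspace K" and EF: "\<And>e. e \<in> E \<Longrightarrow> \<exists>f\<in>F. e - f \<in> K"
  shows "x \<in> traj E n \<Longrightarrow> \<exists>y\<in>traj F n. x - y \<in> K"
proof (induction n arbitrary: x)
  case 0
  then show ?case using K by (simp add: subspace_0)
next
  case (Suc n)
  then obtain y e where ye: "y \<in> traj E n" "e \<in> E" "x = y + monom 1 n *s e" by auto
  from Suc.IH[OF ye(1)] obtain z where z: "z \<in> traj F n" "y - z \<in> K" by blast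
  from EF[OF ye(2)] obtain f where f: "f \<in> F" "e - f \<in> K" by blast
  have "(y - z) + monom 1 n *s (e - f) \<in> K" using z f K by (intro subspace_add subspace_scale)
  then have "x - (z + monom 1 n *s f) \<in> K" by (simp add: ye scale_right_diff_distrib algebra_simps)
  moreover have "z + monom 1 n *s f \<in> traj F (Suc n)" using z f by (auto intro!: image_eqI)
  ultimately show ?case by blast
qed

text \<open>Multiplication by \<open>p\<close> is well defined on cosets of a submodule;
  \<open>g\<close> realizes it by multiplying a chosen representative.\<close>

lemma residue_count_scale_le:
  assumes K: "subspace K" and S: "finite S"
  shows "residue_count K ((*s) p ` S) \<le> residue_count K S"
proof -
  define g where "g X = residue_class K (p *s (SOME x. x \<in> X))" for X
  have "residue_class K ` ((*s) p ` S) \<subseteq> g ` (residue_class K ` S)"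
  proof (clarify, rule image_eqI)
    fix s assume "s \<in> S"
    have "s \<in> residue_class K s" using K by (simp add: residue_class_def subspace_0)
    then have "(SOME x. x \<in> residue_class K s) \<in> residue_class K s" by (rule someI)
    then have "p *s ((SOME x. x \<in> residue_class K s) - s) \<in> K"
      using K by (intro subspace_scale) (auto simp: residue_class_def)
    then have "p *s (SOME x. x \<in> residue_class K s) - p *s s \<in> K" by (simp add: scale_right_diff_distrib)
    then show "residue_class K (p *s s) = g (residue_class K s)" unfolding g_def
      using residue_class_eq_iff[OF subspace_add_subgroup[OF K]] by metis
  qed auto
  then show ?thesis unfolding residue_count_def
    using S by (meson card_image_le card_mono finite_imageI le_trans)
qed

text \<open>The last \<open>n\<close> terms of a trajectory of length \<open>m + n\<close> form a
  trajectory multiplied by \<open>t^m\<close>, which cannot increase the number of cosets; so the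
  logarithmic counts are subadditive.\<close>

lemma entropy_lim:
  assumes K: "subspace K" and F: "finite F" "F \<noteq> {}"
  shows "(\<lambda>n. ln (real (residue_count K (traj F n))) / real n) \<longlonglongrightarrow> entropy K F"
proof -
  have pos: "residue_count K (traj F n) > 0" for n by (intro residue_count_pos finite_traj traj_nonempty F)
  have "convergent (\<lambda>n. ln (real (residue_count K (traj F n))) / real n)"
  proof (rule fekete)
    fix m n
    have "residue_count K (traj F (m + n)) \<le> residue_count K (traj F m) * residue_count K ((*s) (monom 1 m) ` traj F n)"
    proof (rule residue_count_add_le)
      fix s assume "s \<in> traj F (m + n)"
      then obtain a b where "a\<in>traj F m" "b\<in>traj F n" "s = a + monom 1 m *s b" using traj_add by blast
      then show "\<exists>a\<in>traj F m. \<exists>b\<in>(*s) (monom 1 m) ` traj F n. s - (a + b) \<in> K"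
        using K by (intro bexI[of _ a] bexI[of _ "monom 1 m *s b"]) (auto simp: subspace_0)
    qed (use F K finite_traj subspace_add_subgroup in auto)
    also have "\<dots> \<le> residue_count K (traj F m) * residue_count K (traj F n)"
      by (intro mult_left_mono residue_count_scale_le K finite_traj F) simp
    finally have "real (residue_count K (traj F (m + n))) \<le> real (residue_count K (traj F m)) * real (residue_count K (traj F n))"
      by (metis of_nat_mono of_nat_mult)
    then have "ln (real (residue_count K (traj F (m + n)))) \<le> ln (real (residue_count K (traj F m)) * real (residue_count K (traj F n)))"
      using pos by simp
    also have "\<dots> = ln (real (residue_count K (traj F m))) + ln (real (residue_count K (traj F n)))"
      using pos[of m] pos[of n] by (simp add: ln_mult)
    finally show "ln (real (residue_count K (traj F (m + n)))) \<le> ln (real (residue_count K (traj F m))) + ln (real (residue_count K (traj F n)))" .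
  next
    fix n
    have "residue_count K (traj F n) \<ge> 1" using pos[of n] by linarith
    then show "0 \<le> ln (real (residue_count K (traj F n)))" by simp
  next
    show "ln (real (residue_count K (traj F 0))) = 0" by (simp add: residue_count_def)
  qed
  then show ?thesis by (simp add: entropy_def convergent_LIMSEQ_iff)
qed

lemma entropy_growth:
  fixes M M' C :: real
  assumes K: "subspace K" and F: "finite F" "F \<noteq> {}" and E: "finite E" "E \<noteq> {}" and pos: "M > 0" "M' > 0"
    and le: "\<And>n. n \<ge> n0 \<Longrightarrow> residue_count K (traj F n) * M ^ n \<le> C * real n ^ d * residue_count K (traj E (n + m)) * M' ^ n"
  shows "entropy K F + ln M \<le> entropy K E + ln M'"
  by (rule growth_le[OF entropy_lim[OF K F] entropy_lim[OF K E] _ _ pos le]) (auto intro!: residue_count_pos finite_traj traj_nonempty F E)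

lemma entropy_growth_const:
  fixes M' C :: real
  assumes K: "subspace K" and F: "finite F" "F \<noteq> {}" and pos: "M' > 0"
    and le: "\<And>n. n \<ge> n0 \<Longrightarrow> residue_count K (traj F n) \<le> C * real n ^ d * M' ^ n"
  shows "entropy K F \<le> ln M'"
proof -
  have "(\<lambda>n. ln (real (1::nat)) / real n) \<longlonglongrightarrow> 0" by simp
  then show ?thesis
    using growth_le[OF entropy_lim[OF K F], of "\<lambda>_. 1" 0 1 M' n0 C d 0] le pos
    by (simp add: residue_count_pos finite_traj traj_nonempty F)
qed

lemma entropy_mono:
  assumes K: "subspace K" and F: "finite F" "F \<noteq> {}" and E: "finite E"
    and sub: "\<And>x. x \<in> F \<Longrightarrow> \<exists>y\<in>E. x - y \<in> K"
  shows "entropy K F \<le> entropy K E"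
proof -
  have "E \<noteq> {}" using F sub by auto
  moreover have "residue_count K (traj F n) \<le> residue_count K (traj E n)" for n
    by (intro residue_count_mono subspace_add_subgroup K finite_traj E traj_cong[OF K sub])
  ultimately show ?thesis using entropy_growth[OF K F E, of 1 1 0 1 0 0] by simp
qed

text \<open>The supremum is required to be a maximum, which finitely generated torsion modules
  provide and which the comparison of successive extensions rests on.\<close>

definition has_entropy :: "'v set \<Rightarrow> 'v set \<Rightarrow> real \<Rightarrow> bool" where
  "has_entropy K M h \<longleftrightarrow> (\<exists>F. finite F \<and> F \<noteq> {} \<and> F \<subseteq> M \<and> entropy K F = h) \<and>
     (\<forall>F. finite F \<longrightarrow> F \<noteq> {} \<longrightarrow> F \<subseteq> M \<longrightarrow> entropy K F \<le> h)"

lemma has_entropy_mono: "has_entropy K M h \<Longrightarrow> has_entropy K N h' \<Longrightarrow> M \<subseteq> N \<Longrightarrow> h \<le> h'"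
  unfolding has_entropy_def by (meson order_trans)

definition span_box :: "'v set \<Rightarrow> nat \<Rightarrow> nat \<Rightarrow> 'v set" where
  "span_box B n c = (\<lambda>p. \<Sum>b\<in>B. p b *s b) ` (B \<rightarrow>\<^sub>E int_box n c)"

lemma finite_span_box: "finite B \<Longrightarrow> finite (span_box B n c)"
  unfolding span_box_def by (intro finite_imageI finite_PiE finite_int_box)

lemma span_box_I:
  assumes "\<And>b. b \<in> B \<Longrightarrow> p b \<in> int_box n c"
  shows "(\<Sum>b\<in>B. p b *s b) \<in> span_box B n c"
  unfolding span_box_def by (rule image_eqI[of _ _ "restrict p B"]) (use assms in auto)

lemma span_box_E:
  assumes "x \<in> span_box B n c"
  obtains p where "\<And>b. b \<in> B \<Longrightarrow> p b \<in> int_box n c" "x = (\<Sum>b\<in>B. p b *s b)"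
  using assms unfolding span_box_def by (auto simp: PiE_def Pi_def)

lemma zero_in_span_box [simp]: "0 \<in> span_box B n c"
  using span_box_I[of B "\<lambda>_. 0" n c] by simp

lemma span_box_mono: "m \<le> n \<Longrightarrow> a \<le> b \<Longrightarrow> span_box B m a \<subseteq> span_box B n b"
  by (rule subsetI, erule span_box_E) (simp, intro span_box_I, use int_box_mono in blast)

lemma span_box_add:
  assumes "x \<in> span_box B n a" "y \<in> span_box B n b"
  shows "x + y \<in> span_box B n (a + b)"
proof -
  obtain p where p: "\<And>b. b \<in> B \<Longrightarrow> p b \<in> int_box n a" "x = (\<Sum>b\<in>B. p b *s b)" using assms(1) by (rule span_box_E) blast
  obtain q where q: "\<And>c. c \<in> B \<Longrightarrow> q c \<in> int_box n b" "y = (\<Sum>b\<in>B. q b *s b)" using assms(2) by (rule span_box_E) blast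
  have "x + y = (\<Sum>b\<in>B. (p b + q b) *s b)" by (simp add: p q scale_left_distrib sum.distrib)
  then show ?thesis using span_box_I[of B "\<lambda>b. p b + q b"] p q int_box_add by simp
qed

lemma span_box_scale:
  assumes "q \<in> int_box m a" "x \<in> span_box B n c"
  shows "q *s x \<in> span_box B (m + n) (m * a * c)"
proof -
  obtain p where p: "\<And>b. b \<in> B \<Longrightarrow> p b \<in> int_box n c" "x = (\<Sum>b\<in>B. p b *s b)" using assms(2) by (rule span_box_E) blast
  have "q *s x = (\<Sum>b\<in>B. (q * p b) *s b)" by (simp add: p scale_sum_right)
  then show ?thesis using span_box_I[of B "\<lambda>b. q * p b"] p int_box_mult[OF assms(1)] by simp
qed

lemma span_box_monom:
  assumes "x \<in> span_box B n c"
  shows "monom 1 j *s x \<in> span_box B (n + j) c"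
proof -
  obtain p where p: "\<And>b. b \<in> B \<Longrightarrow> p b \<in> int_box n c" "x = (\<Sum>b\<in>B. p b *s b)" using assms(1) by (rule span_box_E) blast
  have "monom 1 j *s x = (\<Sum>b\<in>B. (monom 1 j * p b) *s b)" by (simp add: p scale_sum_right)
  then show ?thesis using span_box_I[of B "\<lambda>b. monom 1 j * p b"] p int_box_monom_mult by simp
qed

text \<open>Each of the \<open>n\<close> summands adds at most \<open>c\<close> to a coefficient, so
  the bound grows only linearly in \<open>n\<close>.\<close>

lemma traj_subset_span_box:
  assumes F: "F \<subseteq> span_box B m c"
  shows "traj F n \<subseteq> span_box B (n + m) (n * c)"
proof (induction n)
  case (Suc n)
  show ?case
  proof
    fix x assume "x \<in> traj F (Suc n)"
    then obtain y f where yf: "y \<in> traj F n" "f \<in> F" "x = y + monom 1 n *s f" by auto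
    have "y \<in> span_box B (Suc n + m) (n * c)" using yf Suc span_box_mono[of "n + m" "Suc n + m" "n * c" "n * c" B] by auto
    moreover have "monom 1 n *s f \<in> span_box B (Suc n + m) c"
      using span_box_monom[of f B m c n] F yf span_box_mono[of "m + n" "Suc n + m" c c] by auto
    ultimately have "x \<in> span_box B (Suc n + m) (n * c + c)" unfolding yf by (rule span_box_add)
    then show "x \<in> span_box B (Suc n + m) (Suc n * c)" by (simp add: add.commute)
  qed
qed simp

text \<open>A combination with polynomial coefficients is a sum of constant combinations multiplied
  by powers of \<open>t\<close>; the induction peels off the top coefficients. The bound
  \<open>c\<close> is preserved.\<close>

lemma span_box_subset_traj: "span_box B n c \<subseteq> traj (span_box B 1 c) n"
proof (induction n)
  case 0
  have "int_box 0 c = {0}" by (auto simp: int_box_def poly_eq_iff)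
  then show ?case by (auto elim!: span_box_E intro!: sum.neutral)
next
  case (Suc n)
  show ?case
  proof
    fix x assume "x \<in> span_box B (Suc n) c"
    then obtain p where p: "\<And>b. b \<in> B \<Longrightarrow> p b \<in> int_box (Suc n) c" "x = (\<Sum>b\<in>B. p b *s b)" by (rule span_box_E) blast
    define u where "u b = p b - monom (coeff (p b) n) n" for b
    define v where "v b = [:coeff (p b) n:]" for b
    have dec: "p b = u b + monom 1 n * v b" for b
      by (simp add: u_def v_def monom_altdef)
    have "u b \<in> int_box n c" if "b \<in> B" for b
      using p(1)[OF that] by (auto simp: int_box_def u_def)
    then have 1: "(\<Sum>b\<in>B. u b *s b) \<in> traj (span_box B 1 c) n" using Suc span_box_I by blast
    have "v b \<in> int_box 1 c" if "b \<in> B" for b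
      using p(1)[OF that] by (auto simp: int_box_def v_def coeff_pCons split: nat.splits)
    then have 2: "(\<Sum>b\<in>B. v b *s b) \<in> span_box B 1 c" by (rule span_box_I)
    have "x = (\<Sum>b\<in>B. u b *s b) + monom 1 n *s (\<Sum>b\<in>B. v b *s b)"
      unfolding p scale_sum_right by (subst dec) (simp add: scale_left_distrib sum.distrib)
    then show "x \<in> traj (span_box B 1 c) (Suc n)" using 1 2 by (auto intro!: image_eqI)
  qed
qed

lemma span_box_subset_span: "span_box B n c \<subseteq> span B"
  by (rule subsetI, erule span_box_E) (simp add: span_sum span_scale span_base)

lemma span_subset_span_box:
  assumes B: "finite B" and F: "finite F" "F \<subseteq> span B"
  shows "\<exists>n c. F \<subseteq> span_box B n c"
  using F
proof (induction F)
  case (insert x F)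
  then obtain n c where nc: "F \<subseteq> span_box B n c" by auto
  have "x \<in> span B" using insert by simp
  then obtain u where u: "x = (\<Sum>b\<in>B. u b *s b)" using span_finite[OF B] by auto
  have "\<forall>b. \<exists>nc. u b \<in> int_box (fst nc) (snd nc)" using int_box_exists by (metis fst_conv snd_conv)
  then obtain g where g: "\<And>b. u b \<in> int_box (fst (g b)) (snd (g b))" by metis
  define n' where "n' = n + (\<Sum>b\<in>B. fst (g b))"
  define c' where "c' = c + (\<Sum>b\<in>B. snd (g b))"
  have "u b \<in> int_box n' c'" if "b \<in> B" for b
  proof -
    have "fst (g b) \<le> n'" "snd (g b) \<le> c'" unfolding n'_def c'_def
      using member_le_sum[of b B "\<lambda>b. fst (g b)"] member_le_sum[of b B "\<lambda>b. snd (g b)"] B that by auto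
    then show ?thesis using g int_box_mono by blast
  qed
  then have "x \<in> span_box B n' c'" unfolding u by (rule span_box_I)
  moreover have "F \<subseteq> span_box B n' c'" using nc span_box_mono[of n n' c c'] unfolding n'_def c'_def by auto
  ultimately show ?case by blast
qed simp

lemma span_Un_subspace:
  assumes K: "subspace K" and x: "x \<in> span (B \<union> K)"
  shows "\<exists>u\<in>span B. x - u \<in> K"
proof -
  have "span K = K" using K by simp
  then obtain u k where "u \<in> span B" "k \<in> K" "x = u + k" using x unfolding span_Un by blast
  then show ?thesis by (intro bexI[of _ u]) auto
qed

end

section \<open>Division with polynomially bounded coefficients\<close>

definition complex_box :: "nat \<Rightarrow> real \<Rightarrow> complex poly set" where
  "complex_box n c = {p. (\<forall>i\<ge>n. coeff p i = 0) \<and> (\<forall>i. norm (coeff p i) \<le> c)}"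

lemma zero_in_complex_box [simp]: "c \<ge> 0 \<Longrightarrow> 0 \<in> complex_box n c"
  by (simp add: complex_box_def)

lemma complex_box_degree: "p \<in> complex_box n c \<Longrightarrow> p \<noteq> 0 \<Longrightarrow> degree p < n"
  unfolding complex_box_def by (metis (mono_tags, lifting) leading_coeff_0_iff linorder_not_less mem_Collect_eq)

lemma complex_box_norm_poly_le:
  assumes p: "p \<in> complex_box n c"
  shows "norm (poly p z) \<le> c * (\<Sum>i<n. norm z ^ i)"
proof -
  have "poly p z = (\<Sum>i<n. coeff p i * z ^ i)"
  proof (cases "p = 0")
    case False
    then have "degree p < n" using complex_box_degree p by blast
    then have "(\<Sum>i<n. coeff p i * z ^ i) = (\<Sum>i\<le>degree p. coeff p i * z ^ i)"
      by (intro sum.mono_neutral_right) (auto simp: coeff_eq_0)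
    then show ?thesis by (simp add: poly_altdef)
  qed simp
  also have "norm \<dots> \<le> (\<Sum>i<n. c * norm z ^ i)"
    by (intro order_trans[OF norm_sum] sum_mono)
      (use p in \<open>auto simp: norm_mult norm_power complex_box_def intro!: mult_right_mono\<close>)
  finally show ?thesis by (simp add: sum_distrib_left)
qed

text \<open>Dividing by \<open>t - \<alpha>\<close> from the top if \<open>\<alpha>\<close> lies in the closed unit disc and from the bottom otherwise
  keeps the coefficients of the quotient small.\<close>

lemma division_by_root:
  fixes \<alpha> :: complex
  assumes p: "p \<in> complex_box n c" and n: "n \<ge> 1" and c: "c \<ge> 0"
  shows "\<exists>q l. p = [:- \<alpha>, 1:] * q + monom l (if norm \<alpha> \<le> 1 then 0 else n - 1) \<and>
    q \<in> complex_box (n - 1) (n * c) \<and> norm l \<le> n * c"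
proof -
  define k where "k = (if norm \<alpha> \<le> 1 then 0 else n - 1)"
  \<comment> \<open>Evaluation at \<open>\<alpha>\<close> forces this value; outside the disc the
    denominator \<open>\<alpha> ^ (n - 1)\<close> compensates the growth of
    \<open>poly p \<alpha>\<close>.\<close>
  define l where "l = poly p \<alpha> / \<alpha> ^ k"
  have "\<alpha> ^ k \<noteq> 0" by (auto simp: k_def)
  have l: "norm l \<le> n * c"
  proof (cases "norm \<alpha> \<le> 1")
    case True
    have "norm (poly p \<alpha>) \<le> c * (\<Sum>i<n. norm \<alpha> ^ i)" by (rule complex_box_norm_poly_le[OF p])
    also have "\<dots> \<le> c * (\<Sum>i<n. 1)" using True c by (intro mult_left_mono sum_mono power_le_one) auto
    finally show ?thesis using True by (simp add: l_def k_def mult.commute)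
  next
    case False
    have "norm (poly p \<alpha>) \<le> c * (\<Sum>i<n. norm \<alpha> ^ i)" by (rule complex_box_norm_poly_le[OF p])
    also have "\<dots> \<le> c * (\<Sum>i<n. norm \<alpha> ^ (n - 1))"
      using False c by (intro mult_left_mono sum_mono power_increasing) auto
    also have "c * (\<Sum>i<n. norm \<alpha> ^ (n - 1)) = (n * c) * norm \<alpha> ^ k" using False by (simp add: k_def)
    finally have "norm (poly p \<alpha>) \<le> (n * c) * norm \<alpha> ^ k" .
    moreover have "norm \<alpha> ^ k > 0" using \<open>\<alpha> ^ k \<noteq> 0\<close> by (simp flip: norm_power)
    ultimately show ?thesis by (simp add: l_def norm_divide norm_power pos_divide_le_eq)
  qed
  define r where "r = p - monom l k"
  have deg0: "coeff r i = 0" if "i \<ge> n" for i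
    using that p n by (auto simp: r_def complex_box_def k_def split: if_splits)
  have "poly r \<alpha> = 0" using \<open>\<alpha> ^ k \<noteq> 0\<close> by (simp add: r_def l_def poly_monom)
  then have "[:- \<alpha>, 1:] dvd r" by (simp add: poly_eq_0_iff_dvd)
  then obtain q where q: "r = [:- \<alpha>, 1:] * q" by (elim dvdE)
  have rec0: "coeff r 0 = - \<alpha> * coeff q 0" by (simp add: q)
  have rec: "coeff r (Suc i) = coeff q i - \<alpha> * coeff q (Suc i)" for i by (simp add: q)
  have q0: "coeff q i = 0" if "i \<ge> n - 1" for i
  proof (cases "q = 0")
    case False
    then have "degree r = Suc (degree q)" unfolding q by (subst degree_mult_eq) auto
    moreover have "degree r < n"
      using deg0[of "degree r"] False q by (metis leading_coeff_0_iff linorder_not_less mult_eq_0_iff pCons_eq_0_iff zero_neq_one)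
    ultimately show ?thesis using that by (intro coeff_eq_0) simp
  qed simp
  have pc: "norm (coeff p i) \<le> c" for i using p by (simp add: complex_box_def)
  have bound: "norm (coeff q i) \<le> n * c" if i: "i < n - 1" for i
  proof (cases "norm \<alpha> \<le> 1")
    case True
    \<comment> \<open>Synthetic division from the top: each step adds one coefficient of
      \<open>p\<close> to a multiple by a number of norm at most 1.\<close>
    have "norm (coeff q (n - 1 - j)) \<le> j * c" if "j \<le> n - 1" for j
      using that
    proof (induction j)
      case 0
      then show ?case using q0[of "n - 1"] by simp
    next
      case (Suc j)
      define i where "i = n - 1 - Suc j"
      have i': "n - 1 - j = Suc i" using Suc.prems by (simp add: i_def)
      have "coeff q i = coeff r (Suc i) + \<alpha> * coeff q (Suc i)" using rec[of i] by simp
      also have "coeff r (Suc i) = coeff p (Suc i)" using True by (simp add: r_def k_def)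
      finally have "norm (coeff q i) \<le> norm (coeff p (Suc i)) + norm \<alpha> * norm (coeff q (Suc i))"
        by (metis norm_mult norm_triangle_ineq)
      also have "\<dots> \<le> c + 1 * norm (coeff q (Suc i))"
        by (intro add_mono mult_right_mono pc) (use True in auto)
      also have "\<dots> \<le> c + j * c" using Suc i' by simp
      finally show ?case by (simp add: i_def algebra_simps)
    qed
    from this[of "n - 1 - i"] have "norm (coeff q i) \<le> (n - 1 - i) * c" using i by simp
    also have "\<dots> \<le> n * c" using c by (intro mult_right_mono of_nat_mono) auto
    finally show ?thesis .
  next
    case False
    have \<alpha>: "norm \<alpha> > 0" "\<alpha> \<noteq> 0" using False by auto
    have red: "norm (x / \<alpha>) \<le> norm x" for x
      using False \<alpha> by (simp add: norm_divide divide_le_eq mult_le_cancel_left1)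
    have rp: "coeff r i = coeff p i" if "i < n - 1" for i using that False by (simp add: r_def k_def)
    \<comment> \<open>The recursion runs upwards from the constant term, because solving for the
      next coefficient divides by \<open>\<alpha>\<close>.\<close>
    have "norm (coeff q i) \<le> Suc i * c" using i
    proof (induction i)
      case 0
      have "coeff q 0 = - coeff p 0 / \<alpha>" using rec0 rp[of 0] 0 \<alpha> by (simp add: field_simps)
      then show ?case using red[of "coeff p 0"] pc[of 0] by (simp add: norm_divide)
    next
      case (Suc i)
      have "coeff q (Suc i) = (coeff q i - coeff p (Suc i)) / \<alpha>"
        using rec[of i] rp[of "Suc i"] Suc.prems \<alpha> by (simp add: field_simps)
      then have "norm (coeff q (Suc i)) \<le> norm (coeff q i - coeff p (Suc i))" using red by simp
      also have "\<dots> \<le> norm (coeff q i) + norm (coeff p (Suc i))" by (rule norm_triangle_ineq4)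
      also have "\<dots> \<le> Suc i * c + c" using Suc pc by (intro add_mono) auto
      finally show ?case by (simp add: algebra_simps)
    qed
    also have "\<dots> \<le> n * c" using c i by (intro mult_right_mono of_nat_mono) auto
    finally show ?thesis .
  qed
  have "norm (coeff q i) \<le> n * c" for i
    using q0[of i] bound[of i] c by (cases "i < n - 1") auto
  then have "q \<in> complex_box (n - 1) (n * c)" using q0 by (simp add: complex_box_def)
  moreover have "p = [:- \<alpha>, 1:] * q + monom l k" using q by (simp add: r_def algebra_simps)
  ultimately show ?thesis using l unfolding k_def by blast
qed

lemma complex_box_monom: "norm l \<le> D \<Longrightarrow> k < n \<Longrightarrow> monom l k \<in> complex_box n D"
  by (auto simp: complex_box_def intro: order_trans[OF norm_ge_zero])

lemma complex_box_add: "p \<in> complex_box n a \<Longrightarrow> q \<in> complex_box n b \<Longrightarrow> p + q \<in> complex_box n (a + b)"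
  unfolding complex_box_def by (auto intro!: order_trans[OF norm_triangle_ineq] add_mono)

lemma complex_box_linear_mult:
  assumes "q \<in> complex_box n a" "a \<ge> 0"
  shows "[:- \<alpha>, 1:] * q \<in> complex_box (Suc n) ((1 + norm \<alpha>) * a)"
proof -
  have "coeff ([:- \<alpha>, 1:] * q) i = (if i = 0 then 0 else coeff q (i - 1)) - \<alpha> * coeff q i" for i
    by (cases i) auto
  moreover have "norm ((if i = 0 then 0 else coeff q (i - 1)) - \<alpha> * coeff q i) \<le> a + norm \<alpha> * a" for i
    using assms by (intro order_trans[OF norm_triangle_ineq4] add_mono)
      (auto simp: complex_box_def norm_mult intro!: mult_left_mono)
  ultimately show ?thesis using assms by (auto simp: complex_box_def algebra_simps)
qed

text \<open>The label \<open>\<kappa>\<close> cuts a box into a number of cells polynomial in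
  \<open>c\<close> and \<open>n\<close>. Within a cell, differences are multiples of
  \<open>f\<close> up to a remainder whose bound \<open>D\<close> is independent of \<open>c\<close>
  and \<open>n\<close>. Labels are lists so that two integers can be prepended for each
  root.\<close>

definition complex_cells :: "complex poly \<Rightarrow> real \<Rightarrow> real \<Rightarrow> nat \<Rightarrow> bool" where
  "complex_cells f D A d \<longleftrightarrow> D \<ge> 0 \<and> A \<ge> 0 \<and> (\<forall>n c. c \<ge> 1 \<longrightarrow> (\<exists>\<kappa> :: complex poly \<Rightarrow> int list.
    finite (\<kappa> ` complex_box n c) \<and> real (card (\<kappa> ` complex_box n c)) \<le> (A * c * real (n + 1)) ^ d \<and>
    (\<forall>p\<in>complex_box n c. \<forall>p'\<in>complex_box n c. \<kappa> p = \<kappa> p' \<longrightarrow> (\<exists>q e. p - p' = f * q + e \<and> e \<in> complex_box n D))))"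

text \<open>The roots are divided out one after another, and the label records the integer parts of
  each leftover coefficient \<open>l\<close>. Equal labels make the leftovers nearly equal, and the
  small differences go into \<open>D\<close>.\<close>

lemma complex_cells_exist:
  fixes a :: complex
  assumes a: "a \<noteq> 0"
  shows "\<exists>D A d. complex_cells (Polynomial.smult a (\<Prod>\<alpha>\<leftarrow>xs. [:- \<alpha>, 1:])) D A d"
proof (induction xs)
  case Nil
  have "complex_cells [:a:] 0 0 0" unfolding complex_cells_def
  proof (intro conjI allI impI)
    fix n :: nat and c :: real assume "c \<ge> 1"
    have 1: "p - p' = [:a:] * Polynomial.smult (1 / a) (p - p') + 0" for p p' :: "complex poly"
      using a by simp
    have 2: "\<exists>q e. p - p' = [:a:] * q + e \<and> e \<in> complex_box n 0" for p p' :: "complex poly"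
      by (intro exI conjI, rule 1) simp
    have "complex_box n c \<noteq> {}" using zero_in_complex_box[of c n] \<open>c \<ge> 1\<close> by force
    then have "(\<lambda>_. []) ` complex_box n c = {[] :: int list}" by auto
    then show "\<exists>\<kappa> :: complex poly \<Rightarrow> int list.
        finite (\<kappa> ` complex_box n c) \<and> real (card (\<kappa> ` complex_box n c)) \<le> (0 * c * real (n + 1)) ^ 0 \<and>
        (\<forall>p\<in>complex_box n c. \<forall>p'\<in>complex_box n c. \<kappa> p = \<kappa> p' \<longrightarrow> (\<exists>q e. p - p' = [:a:] * q + e \<and> e \<in> complex_box n 0))"
      using 2 by (intro exI[of _ "\<lambda>_. []"]) simp
  qed auto
  then show ?case by auto
next
  case (Cons \<alpha> xs)
  define f where "f = Polynomial.smult a (\<Prod>\<alpha>\<leftarrow>xs. [:- \<alpha>, 1:])"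
  have f': "Polynomial.smult a (\<Prod>\<alpha>\<leftarrow>\<alpha> # xs. [:- \<alpha>, 1:]) = [:- \<alpha>, 1:] * f" by (simp add: f_def)
  obtain D A d where "complex_cells f D A d" using Cons unfolding f_def by blast
  then have D: "D \<ge> 0" and A: "A \<ge> 0" and
    IH: "\<And>n c. c \<ge> 1 \<Longrightarrow> \<exists>\<kappa> :: complex poly \<Rightarrow> int list.
    finite (\<kappa> ` complex_box n c) \<and> real (card (\<kappa> ` complex_box n c)) \<le> (A * c * real (n + 1)) ^ d \<and>
    (\<forall>p\<in>complex_box n c. \<forall>p'\<in>complex_box n c. \<kappa> p = \<kappa> p' \<longrightarrow> (\<exists>q e. p - p' = f * q + e \<and> e \<in> complex_box n D))"
    unfolding complex_cells_def by blast+
  \<comment> \<open>The remainder of the quotients gets multiplied by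
    \<open>[:- \<alpha>, 1:]\<close>, and two leftovers with equal integer parts differ by at most
    2.\<close>
  define D' where "D' = (1 + norm \<alpha>) * D + 2"
  \<comment> \<open>Large enough that \<open>7 \<le> A'\<close>, for the \<open>2 * N + 1\<close>
    values of each integer part, and that \<open>A \<le> A' * A'\<close>.\<close>
  define A' where "A' = 49 * A + 49"
  have "complex_cells ([:- \<alpha>, 1:] * f) D' A' (2 * d + 2)" unfolding complex_cells_def
  proof (intro conjI allI impI)
    show "D' \<ge> 0" "A' \<ge> 0" using D A by (auto simp: D'_def A'_def)
    fix n :: nat and c :: real assume c: "c \<ge> 1"
    show "\<exists>\<kappa> :: complex poly \<Rightarrow> int list.
      finite (\<kappa> ` complex_box n c) \<and> real (card (\<kappa> ` complex_box n c)) \<le> (A' * c * real (n + 1)) ^ (2 * d + 2) \<and>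
      (\<forall>p\<in>complex_box n c. \<forall>p'\<in>complex_box n c. \<kappa> p = \<kappa> p' \<longrightarrow>
         (\<exists>q e. p - p' = [:- \<alpha>, 1:] * f * q + e \<and> e \<in> complex_box n D'))"
    proof (cases "n = 0")
      case True
      have *: "complex_box n c = {0}" using c True by (auto simp: complex_box_def poly_eq_iff)
      have "1 * 1 \<le> A' * c" using c A by (intro mult_mono) (auto simp: A'_def)
      then have "1 \<le> (A' * c * real (n + 1)) ^ (2 * d + 2)" using True by (intro one_le_power) simp
      moreover have "\<exists>q e. (0 :: complex poly) - 0 = [:- \<alpha>, 1:] * f * q + e \<and> e \<in> complex_box n D'"
        by (rule exI[of _ 0], rule exI[of _ 0]) (simp add: \<open>D' \<ge> 0\<close>)
      ultimately show ?thesis unfolding * by (intro exI[of _ "\<lambda>_. []"]) simp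
    next
      case False
      then have n: "n \<ge> 1" by simp
      have nc: "n * c \<ge> 1" using mult_mono[of 1 "real n" 1 c] n c by simp
      define k where "k = (if norm \<alpha> \<le> 1 then 0 else n - 1)"
      have "k < n" using n by (auto simp: k_def)
      have "\<forall>p\<in>complex_box n c. \<exists>ql. p = [:- \<alpha>, 1:] * fst ql + monom (snd ql) k \<and>
        fst ql \<in> complex_box (n - 1) (n * c) \<and> norm (snd ql) \<le> n * c"
        using division_by_root[OF _ n, of _ c \<alpha>] c unfolding k_def by fastforce
      then obtain g where g: "\<And>p. p \<in> complex_box n c \<Longrightarrow> p = [:- \<alpha>, 1:] * fst (g p) + monom (snd (g p)) k"
        "\<And>p. p \<in> complex_box n c \<Longrightarrow> fst (g p) \<in> complex_box (n - 1) (n * c)"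
        "\<And>p. p \<in> complex_box n c \<Longrightarrow> norm (snd (g p)) \<le> n * c" by metis
      obtain \<kappa> :: "complex poly \<Rightarrow> int list" where \<kappa>: "finite (\<kappa> ` complex_box (n - 1) (n * c))"
        "real (card (\<kappa> ` complex_box (n - 1) (n * c))) \<le> (A * (n * c) * real (n - 1 + 1)) ^ d"
        "\<And>p p'. p \<in> complex_box (n - 1) (n * c) \<Longrightarrow> p' \<in> complex_box (n - 1) (n * c) \<Longrightarrow> \<kappa> p = \<kappa> p' \<Longrightarrow>
          (\<exists>q e. p - p' = f * q + e \<and> e \<in> complex_box (n - 1) D)"
        using IH[OF nc, of "n - 1"] by blast
      define \<kappa>' where "\<kappa>' p = \<lfloor>Re (snd (g p))\<rfloor> # \<lfloor>Im (snd (g p))\<rfloor> # \<kappa> (fst (g p))" for p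
      define N where "N = \<lceil>n * c\<rceil> + 1"
      define L where "L = (\<lambda>(x, y, z). x # y # z) ` ({- N..N} \<times> {- N..N} \<times> \<kappa> ` complex_box (n - 1) (n * c))"
      have sub: "\<kappa>' ` complex_box n c \<subseteq> L"
      proof (clarify)
        fix p assume p: "p \<in> complex_box n c"
        have "\<bar>Re (snd (g p))\<bar> \<le> n * c" "\<bar>Im (snd (g p))\<bar> \<le> n * c"
          using g(3)[OF p] abs_Re_le_cmod abs_Im_le_cmod order_trans by blast+
        then have "\<lfloor>Re (snd (g p))\<rfloor> \<in> {- N..N}" "\<lfloor>Im (snd (g p))\<rfloor> \<in> {- N..N}"
          unfolding N_def by (auto simp: floor_le_iff le_floor_iff abs_le_iff; linarith)+
        then show "\<kappa>' p \<in> L" unfolding L_def \<kappa>'_def using g(2)[OF p] by force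
      qed
      have finL: "finite L" unfolding L_def using \<kappa>(1) by auto
      have "card L \<le> card ({- N..N} \<times> {- N..N} \<times> \<kappa> ` complex_box (n - 1) (n * c))"
        unfolding L_def by (rule card_image_le) (use \<kappa>(1) in auto)
      also have "\<dots> = nat (2 * N + 1) * nat (2 * N + 1) * card (\<kappa> ` complex_box (n - 1) (n * c))"
        by (simp add: card_cartesian_product)
      finally have "real (card L) \<le> real (nat (2 * N + 1)) * real (nat (2 * N + 1)) * real (card (\<kappa> ` complex_box (n - 1) (n * c)))"
        by (metis of_nat_mono of_nat_mult)
      also have "\<dots> \<le> (7 * (n * c)) * (7 * (n * c)) * (A * (n * c) * real (n - 1 + 1)) ^ d"
      proof (intro mult_mono \<kappa>(2))
        have "real_of_int N \<le> n * c + 2" unfolding N_def by linarith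
        then have "real_of_int (2 * N + 1) \<le> 7 * (n * c)" using nc by linarith
        then show "real (nat (2 * N + 1)) \<le> 7 * (n * c)" "real (nat (2 * N + 1)) \<le> 7 * (n * c)" using nc by linarith+
      qed (use c A in auto)
      also have "\<dots> \<le> (A' * c * real (n + 1)) ^ 2 * ((A' * c * real (n + 1)) ^ 2) ^ d"
      proof (intro mult_mono power_mono)
        have "7 * (n * c) \<le> A' * c * real (n + 1)"
        proof -
          have "7 * (c * real n) \<le> A' * (c * real (n + 1))" using A c by (intro mult_mono) (auto simp: A'_def)
          then show ?thesis by (simp add: mult_ac)
        qed
        then have "(7 * (n * c)) ^ 2 \<le> (A' * c * real (n + 1)) ^ 2" using c by (intro power_mono) auto
        then show "7 * (n * c) * (7 * (n * c)) \<le> (A' * c * real (n + 1))\<^sup>2"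
          by (simp only: power2_eq_square)
        have "A * (n * c) * real (n - 1 + 1) = A * c * (real n * real n)" using n by (simp add: mult_ac)
        also have "\<dots> \<le> (A' * A') * (c * c) * (real (n + 1) * real (n + 1))"
        proof (intro mult_mono)
          have "A * 1 \<le> A' * A'" using A by (intro mult_mono) (auto simp: A'_def)
          then show "A \<le> A' * A'" by simp
          show "c \<le> c * c" using c by simp
        qed (use A c in \<open>auto simp: A'_def\<close>)
        also have "\<dots> = (A' * c * real (n + 1))\<^sup>2" by (simp add: power2_eq_square mult_ac)
        finally show "A * (n * c) * real (n - 1 + 1) \<le> (A' * c * real (n + 1))\<^sup>2" .
      qed (use A c in \<open>auto simp: A'_def\<close>)
      also have "\<dots> = (A' * c * real (n + 1)) ^ (2 * d + 2)" by (simp only: power_mult[symmetric] power_add[symmetric] add.commute)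
      finally have cardL: "real (card L) \<le> (A' * c * real (n + 1)) ^ (2 * d + 2)" .
      have "\<exists>q e. p - p' = [:- \<alpha>, 1:] * f * q + e \<and> e \<in> complex_box n D'"
        if p: "p \<in> complex_box n c" "p' \<in> complex_box n c" and eq: "\<kappa>' p = \<kappa>' p'" for p p'
      proof -
        from eq have "\<kappa> (fst (g p)) = \<kappa> (fst (g p'))" by (simp add: \<kappa>'_def)
        with \<kappa>(3) g(2) p obtain q e where qe: "fst (g p) - fst (g p') = f * q + e" "e \<in> complex_box (n - 1) D" by blast
        define l where "l = snd (g p) - snd (g p')"
        have "\<bar>Re l\<bar> \<le> 1" "\<bar>Im l\<bar> \<le> 1" using eq unfolding \<kappa>'_def l_def by (simp; linarith)+
        then have "norm l \<le> 2" using cmod_le[of l] by linarith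
        then have "monom l k \<in> complex_box n 2" using \<open>k < n\<close> by (rule complex_box_monom)
        moreover have "[:- \<alpha>, 1:] * e \<in> complex_box n ((1 + norm \<alpha>) * D)"
          using complex_box_linear_mult[OF qe(2) D, of \<alpha>] n by simp
        ultimately have "[:- \<alpha>, 1:] * e + monom l k \<in> complex_box n D'" unfolding D'_def by (intro complex_box_add)
        moreover have "p - p' = [:- \<alpha>, 1:] * (fst (g p) - fst (g p')) + monom l k"
          using g(1)[OF p(1)] g(1)[OF p(2)] unfolding l_def diff_monom[symmetric] right_diff_distrib
          by (metis add_diff_add)
        then have "p - p' = [:- \<alpha>, 1:] * f * q + ([:- \<alpha>, 1:] * e + monom l k)"
          unfolding qe by (simp only: ring_distribs mult.assoc add.assoc)
        ultimately show ?thesis by blast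
      qed
      moreover have "finite (\<kappa>' ` complex_box n c)" using sub finL by (rule finite_subset)
      moreover have "real (card (\<kappa>' ` complex_box n c)) \<le> (A' * c * real (n + 1)) ^ (2 * d + 2)"
        using cardL card_mono[OF finL sub] by linarith
      ultimately show ?thesis by blast
    qed
  qed
  then show ?case unfolding f' by blast
qed

lemma poly_roots_list:
  fixes f :: "complex poly"
  assumes "f \<noteq> 0"
  obtains xs where "f = Polynomial.smult (lead_coeff f) (\<Prod>\<alpha>\<leftarrow>xs. [:- \<alpha>, 1:])" "mset xs = proots f"
proof -
  obtain xs where xs: "mset xs = proots f" using ex_mset by blast
  have "f = Polynomial.smult (lead_coeff f) (\<Prod>\<alpha>\<in>#proots f. [:- \<alpha>, 1:])" by (simp add: complex_poly_decompose_multiset)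
  also have "(\<Prod>\<alpha>\<in>#proots f. [:- \<alpha>, 1:]) = (\<Prod>\<alpha>\<leftarrow>xs. [:- \<alpha>, 1:])"
    unfolding xs[symmetric] by (metis prod_mset_prod_list mset_map)
  finally show ?thesis using that xs by blast
qed

abbreviation cpoly :: "int poly \<Rightarrow> complex poly" where "cpoly \<equiv> map_poly of_int"

lemma coeff_cpoly [simp]: "coeff (cpoly p) i = of_int (coeff p i)"
  by (simp add: coeff_map_poly)

lemma cpoly_eq_0_iff [simp]: "cpoly p = 0 \<longleftrightarrow> p = 0"
  by (auto simp: poly_eq_iff)

lemma cpoly_diff: "cpoly (p - q) = cpoly p - cpoly q"
  by (rule poly_eqI) simp

lemma cpoly_mult: "cpoly (p * q) = cpoly p * cpoly q"
  by (rule poly_eqI) (simp add: coeff_mult)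

lemma cpoly_in_complex_box: "p \<in> int_box n c \<Longrightarrow> cpoly p \<in> complex_box n (real c)"
  by (auto simp: int_box_def complex_box_def simp flip: of_int_abs) (metis of_int_le_iff of_int_of_nat_eq)

definition int_cells :: "int poly \<Rightarrow> nat \<Rightarrow> real \<Rightarrow> nat \<Rightarrow> bool" where
  "int_cells f C A d \<longleftrightarrow> A \<ge> 0 \<and> (\<forall>n c. c \<ge> 1 \<longrightarrow> (\<exists>\<kappa> :: int poly \<Rightarrow> int list.
    finite (\<kappa> ` int_box n c) \<and> real (card (\<kappa> ` int_box n c)) \<le> (A * real c * real (n + 1)) ^ d \<and>
    (\<forall>p\<in>int_box n c. \<forall>p'\<in>int_box n c. \<kappa> p = \<kappa> p' \<longrightarrow> (\<exists>q. p - p' - f * q \<in> int_box n C))))"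

text \<open>The complex quotient \<open>q\<close> is rounded coefficientwise to an integer
  polynomial \<open>Q\<close>. The coefficients of \<open>f * (q - Q)\<close> have real parts
  bounded by the sum of the absolute coefficients of \<open>f\<close>, so the integral remainder
  stays in a fixed box.\<close>

lemma int_cells_exist:
  fixes f :: "int poly"
  assumes f: "f \<noteq> 0"
  shows "\<exists>C A d. int_cells f C A d"
proof -
  have f0: "cpoly f \<noteq> 0" using f by simp
  obtain xs where xs: "cpoly f = Polynomial.smult (lead_coeff (cpoly f)) (\<Prod>\<alpha>\<leftarrow>xs. [:- \<alpha>, 1:])"
    by (rule poly_roots_list[OF f0])
  obtain D A d where "complex_cells (cpoly f) D A d"
    using complex_cells_exist[of "lead_coeff (cpoly f)" xs, folded xs] f0 leading_coeff_0_iff by blast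
  then have D: "D \<ge> 0" and A: "A \<ge> 0" and
    cells: "\<And>n c. c \<ge> 1 \<Longrightarrow> \<exists>\<kappa> :: complex poly \<Rightarrow> int list.
    finite (\<kappa> ` complex_box n c) \<and> real (card (\<kappa> ` complex_box n c)) \<le> (A * c * real (n + 1)) ^ d \<and>
    (\<forall>p\<in>complex_box n c. \<forall>p'\<in>complex_box n c. \<kappa> p = \<kappa> p' \<longrightarrow>
       (\<exists>q e. p - p' = cpoly f * q + e \<and> e \<in> complex_box n D))"
    unfolding complex_cells_def by blast+
  define C where "C = nat \<lceil>(\<Sum>i\<le>degree f. real_of_int \<bar>coeff f i\<bar>) + D\<rceil>"
  have "int_cells f C A d" unfolding int_cells_def
  proof (intro conjI allI impI A)
    fix n c :: nat assume c: "c \<ge> 1"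
    then have "real c \<ge> 1" by simp
    from cells[OF this, of n] obtain \<kappa> :: "complex poly \<Rightarrow> int list" where
      \<kappa>: "finite (\<kappa> ` complex_box n c)" "real (card (\<kappa> ` complex_box n c)) \<le> (A * c * real (n + 1)) ^ d"
      "\<And>p p'. p \<in> complex_box n c \<Longrightarrow> p' \<in> complex_box n c \<Longrightarrow> \<kappa> p = \<kappa> p' \<Longrightarrow>
         (\<exists>q e. p - p' = cpoly f * q + e \<and> e \<in> complex_box n D)" by blast
    have sub: "(\<kappa> \<circ> cpoly) ` int_box n c \<subseteq> \<kappa> ` complex_box n c" using cpoly_in_complex_box by auto
    have "\<exists>q. p - p' - f * q \<in> int_box n C" if p: "p \<in> int_box n c" "p' \<in> int_box n c" and eq: "(\<kappa> \<circ> cpoly) p = (\<kappa> \<circ> cpoly) p'" for p p'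
    proof -
      from \<kappa>(3)[OF cpoly_in_complex_box[OF p(1)] cpoly_in_complex_box[OF p(2)]] eq obtain q e
        where qe: "cpoly (p - p') = cpoly f * q + e" "e \<in> complex_box n D" by (auto simp: cpoly_diff)
      define Q where "Q = map_poly (\<lambda>z. \<lfloor>Re z\<rfloor>) q"
      have cQ: "coeff Q i = \<lfloor>Re (coeff q i)\<rfloor>" for i by (simp add: Q_def coeff_map_poly)
      define r where "r = p - p' - f * Q"
      have dr: "coeff r i = 0" if i: "i \<ge> n" for i
      proof -
        \<comment> \<open>Rounding cannot raise the degree, so \<open>f * Q\<close> keeps the degree
          bound of \<open>f * q\<close>.\<close>
        have "coeff (f * Q) i = 0"
        proof (cases "q = 0")
          case True
          then show ?thesis by (simp add: Q_def)
        next
          case False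
          have "cpoly f * q = cpoly (p - p') - e" using qe by simp
          then have "coeff (cpoly f * q) j = 0" if "j \<ge> n" for j using that p qe(2) by (auto simp: int_box_def complex_box_def)
          moreover have "cpoly f * q \<noteq> 0" using False f0 by simp
          ultimately have "degree (cpoly f * q) < n"
            by (metis leading_coeff_0_iff linorder_not_less)
          moreover have "degree (cpoly f * q) = degree f + degree q"
            using False f0 by (simp add: degree_mult_eq) (simp add: degree_map_poly)
          moreover have "degree Q \<le> degree q" by (rule degree_le) (simp add: cQ coeff_eq_0)
          moreover have "degree (f * Q) \<le> degree f + degree Q" by (rule degree_mult_le)
          ultimately show ?thesis using i by (intro coeff_eq_0) linarith
        qed
        then show ?thesis using i p by (simp add: r_def int_box_def)
      qed
      have "\<bar>coeff r i\<bar> \<le> int C" for i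
      proof -
        have "cpoly r = cpoly f * (q - cpoly Q) + e" unfolding r_def cpoly_diff[of "p - p'"] cpoly_mult qe(1) by (simp add: algebra_simps)
        then have "of_int (coeff r i) = (\<Sum>j\<le>i. of_int (coeff f j) * (coeff q (i - j) - of_int (coeff Q (i - j)))) + coeff e i"
          by (simp add: coeff_mult flip: coeff_cpoly)
        then have "Re (of_int (coeff r i)) = Re ((\<Sum>j\<le>i. of_int (coeff f j) * (coeff q (i - j) - of_int (coeff Q (i - j)))) + coeff e i)"
          by metis
        then have "real_of_int (coeff r i) = (\<Sum>j\<le>i. real_of_int (coeff f j) * (Re (coeff q (i - j)) - of_int (coeff Q (i - j)))) + Re (coeff e i)"
          by simp
        then have "\<bar>real_of_int (coeff r i)\<bar> \<le> \<bar>\<Sum>j\<le>i. real_of_int (coeff f j) * (Re (coeff q (i - j)) - of_int (coeff Q (i - j)))\<bar> + \<bar>Re (coeff e i)\<bar>"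
          by linarith
        also have "\<bar>Re (coeff e i)\<bar> \<le> D" using qe(2) abs_Re_le_cmod order_trans by (fastforce simp: complex_box_def)
        also have "\<bar>\<Sum>j\<le>i. real_of_int (coeff f j) * (Re (coeff q (i - j)) - of_int (coeff Q (i - j)))\<bar>
            \<le> (\<Sum>j\<le>i. \<bar>real_of_int (coeff f j)\<bar> * 1)"
        proof (intro order_trans[OF sum_abs] sum_mono, unfold abs_mult, intro mult_left_mono)
          fix j show "\<bar>Re (coeff q (i - j)) - of_int (coeff Q (i - j))\<bar> \<le> 1" unfolding cQ by linarith
        qed auto
        also have "\<dots> = (\<Sum>j\<in>{..i} \<inter> {..degree f}. \<bar>real_of_int (coeff f j)\<bar>)"
          unfolding mult_1_right by (intro sum.mono_neutral_right) (auto intro: le_degree)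
        also have "\<dots> \<le> (\<Sum>j\<le>degree f. \<bar>real_of_int (coeff f j)\<bar>)"
          by (rule sum_mono2) auto
        finally have "real_of_int \<bar>coeff r i\<bar> \<le> (\<Sum>i\<le>degree f. real_of_int \<bar>coeff f i\<bar>) + D" by simp
        also have "\<dots> \<le> real C" unfolding C_def by linarith
        finally show ?thesis by linarith
      qed
      then show ?thesis using dr unfolding r_def by (intro exI[of _ Q]) (simp add: int_box_def)
    qed
    moreover have "finite ((\<kappa> \<circ> cpoly) ` int_box n c)" using sub \<kappa>(1) by (rule finite_subset)
    moreover have "real (card ((\<kappa> \<circ> cpoly) ` int_box n c)) \<le> (A * real c * real (n + 1)) ^ d"
      using \<kappa>(2) card_mono[OF \<kappa>(1) sub] by linarith
    ultimately show "\<exists>\<kappa> :: int poly \<Rightarrow> int list.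
      finite (\<kappa> ` int_box n c) \<and> real (card (\<kappa> ` int_box n c)) \<le> (A * real c * real (n + 1)) ^ d \<and>
      (\<forall>p\<in>int_box n c. \<forall>p'\<in>int_box n c. \<kappa> p = \<kappa> p' \<longrightarrow> (\<exists>q. p - p' - f * q \<in> int_box n C))" by blast
  qed
  then show ?thesis by blast
qed

section \<open>Finitely generated torsion modules realize their entropy\<close>

context int_poly_module
begin

text \<open>Raising the coefficient bound from \<open>C\<close> to any \<open>c\<close> costs a
  polynomial factor only, so in the limit coefficients up to \<open>C\<close> already give the full
  entropy.\<close>

definition robust :: "'v set \<Rightarrow> 'v set \<Rightarrow> nat \<Rightarrow> bool" where
  "robust K B C \<longleftrightarrow> (\<exists>A d. A \<ge> 0 \<and> (\<forall>n c. c \<ge> 1 \<longrightarrow>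
     real (residue_count K (span_box B n c)) \<le> (A * real c * real (n + 1)) ^ d * real (residue_count K (span_box B n C))))"

lemma torsion_robust:
  assumes K: "subspace K" and B: "finite B" and f: "f \<noteq> 0" "\<And>b. b \<in> B \<Longrightarrow> f *s b \<in> K"
  shows "\<exists>C. robust K B C"
proof -
  obtain C A d where "int_cells f C A d" using int_cells_exist[OF f(1)] by blast
  then have A: "A \<ge> 0" and cells: "\<And>n c. c \<ge> 1 \<Longrightarrow> \<exists>\<kappa> :: int poly \<Rightarrow> int list.
    finite (\<kappa> ` int_box n c) \<and> real (card (\<kappa> ` int_box n c)) \<le> (A * real c * real (n + 1)) ^ d \<and>
    (\<forall>p\<in>int_box n c. \<forall>p'\<in>int_box n c. \<kappa> p = \<kappa> p' \<longrightarrow> (\<exists>q. p - p' - f * q \<in> int_box n C))"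
    unfolding int_cells_def by blast+
  have "real (residue_count K (span_box B n c)) \<le> (A * real c * real (n + 1)) ^ (d * card B) * real (residue_count K (span_box B n C))"
    if c: "c \<ge> 1" for n c
  proof -
    obtain \<kappa> :: "int poly \<Rightarrow> int list" where \<kappa>: "finite (\<kappa> ` int_box n c)"
      "real (card (\<kappa> ` int_box n c)) \<le> (A * real c * real (n + 1)) ^ d"
      "\<And>p p'. p \<in> int_box n c \<Longrightarrow> p' \<in> int_box n c \<Longrightarrow> \<kappa> p = \<kappa> p' \<Longrightarrow> (\<exists>q. p - p' - f * q \<in> int_box n C)"
      using cells[OF c, of n] by blast
    \<comment> \<open>\<open>r\<close> picks one polynomial from each cell, so \<open>R\<close> has
      at most one element for each tuple of labels.\<close>
    define r where "r = inv_into (int_box n c) \<kappa>"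
    define R where "R = (\<lambda>l. \<Sum>b\<in>B. r (l b) *s b) ` (B \<rightarrow>\<^sub>E \<kappa> ` int_box n c)"
    have finE: "finite (B \<rightarrow>\<^sub>E \<kappa> ` int_box n c)" using B \<kappa>(1) by (intro finite_PiE) auto
    then have finR: "finite R" unfolding R_def by simp
    have "card R \<le> card (B \<rightarrow>\<^sub>E \<kappa> ` int_box n c)" unfolding R_def by (rule card_image_le[OF finE])
    also have "\<dots> = card (\<kappa> ` int_box n c) ^ card B" using B by (simp add: card_PiE)
    finally have "real (card R) \<le> real (card (\<kappa> ` int_box n c)) ^ card B" by (metis of_nat_mono of_nat_power)
    also have "\<dots> \<le> ((A * real c * real (n + 1)) ^ d) ^ card B" by (intro power_mono \<kappa>(2)) simp
    finally have cardR: "real (card R) \<le> (A * real c * real (n + 1)) ^ (d * card B)" by (simp add: power_mult)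
    have "residue_count K (span_box B n c) \<le> residue_count K R * residue_count K (span_box B n C)"
    proof (rule residue_count_add_le)
      fix s assume "s \<in> span_box B n c"
      then obtain p where p: "\<And>b. b \<in> B \<Longrightarrow> p b \<in> int_box n c" "s = (\<Sum>b\<in>B. p b *s b)" by (rule span_box_E) blast
      have "\<exists>q. p b - r (\<kappa> (p b)) - f * q \<in> int_box n C" if "b \<in> B" for b
        using p(1)[OF that] by (intro \<kappa>(3)) (auto simp: r_def f_inv_into_f inv_into_into)
      then obtain q where q: "\<And>b. b \<in> B \<Longrightarrow> p b - r (\<kappa> (p b)) - f * q b \<in> int_box n C" by metis
      define x where "x = (\<Sum>b\<in>B. r (\<kappa> (p b)) *s b)"
      define y where "y = (\<Sum>b\<in>B. (p b - r (\<kappa> (p b)) - f * q b) *s b)"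
      have xR: "x \<in> R" unfolding R_def x_def
        by (rule image_eqI[of _ _ "restrict (\<lambda>b. \<kappa> (p b)) B"]) (use p in auto)
      have "y \<in> span_box B n C" unfolding y_def by (rule span_box_I) (rule q)
      have "s - (x + y) = (\<Sum>b\<in>B. q b *s (f *s b))"
        unfolding p(2) x_def y_def
        by (simp add: sum.distrib[symmetric] sum_subtractf[symmetric] scale_left_diff_distrib mult.commute)
      moreover have "(\<Sum>b\<in>B. q b *s (f *s b)) \<in> K" by (intro subspace_sum subspace_scale K f(2))
      ultimately have "s - (x + y) \<in> K" by (simp only:)
      then show "\<exists>a\<in>R. \<exists>b\<in>span_box B n C. s - (a + b) \<in> K" using xR \<open>y \<in> span_box B n C\<close> by blast
    qed (use K B finR in \<open>auto intro: subspace_add_subgroup finite_span_box\<close>)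
    also have "\<dots> \<le> card R * residue_count K (span_box B n C)" by (intro mult_right_mono residue_count_le_card finR) simp
    finally have "real (residue_count K (span_box B n c)) \<le> real (card R) * real (residue_count K (span_box B n C))"
      by (metis of_nat_mono of_nat_mult)
    also have "\<dots> \<le> (A * real c * real (n + 1)) ^ (d * card B) * real (residue_count K (span_box B n C))"
      by (intro mult_right_mono cardR) simp
    finally show ?thesis .
  qed
  then show ?thesis unfolding robust_def using A by blast
qed

text \<open>A polynomial factor, coefficients of polynomial size and a shift of the degree by
  \<open>m\<close> all disappear in the limit, which leaves the fixed bound
  \<open>C\<close>.\<close>

lemma robust_entropy_le:
  assumes K: "subspace K" and B: "finite B" and rob: "robust K B C" and F: "finite F" "F \<noteq> {}"
    and le: "\<And>n. n \<ge> 1 \<Longrightarrow> residue_count K (traj F n) \<le> R * real n ^ e * residue_count K (span_box B (n + m) (a * n ^ e'))"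
    and R: "R \<ge> 0" and a: "a \<ge> 1"
  shows "entropy K F \<le> entropy K (span_box B 1 C)"
proof -
  obtain A d where A: "A \<ge> 0" and rob': "\<And>n c. c \<ge> 1 \<Longrightarrow>
     real (residue_count K (span_box B n c)) \<le> (A * real c * real (n + 1)) ^ d * real (residue_count K (span_box B n C))"
    using rob unfolding robust_def by blast
  have one: "(0::real) < 1" by simp
  have ne: "span_box B 1 C \<noteq> {}" using zero_in_span_box[of B 1 C] by blast
  have "real (residue_count K (traj F n)) * 1 ^ n \<le> (R * (A * a * (m + 2)) ^ d) * real n ^ (e + (e' + 1) * d) * residue_count K (traj (span_box B 1 C) (n + m)) * 1 ^ n"
    if n: "n \<ge> 1" for n
  proof -
    have "1 \<le> a * n ^ e'" using a n by (metis mult_le_mono nat_mult_1 one_le_power)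
    have "residue_count K (traj F n) \<le> R * real n ^ e * residue_count K (span_box B (n + m) (a * n ^ e'))" by (rule le[OF n])
    also have "\<dots> \<le> R * real n ^ e * ((A * real (a * n ^ e') * real (n + m + 1)) ^ d * real (residue_count K (span_box B (n + m) C)))"
      by (intro mult_left_mono rob') (use R \<open>1 \<le> a * n ^ e'\<close> in auto)
    also have "\<dots> \<le> R * real n ^ e * ((A * real (a * n ^ e') * (real (m + 2) * real n)) ^ d * real (residue_count K (traj (span_box B 1 C) (n + m))))"
    proof -
      have "m * 1 \<le> m * n" using n by (intro mult_left_mono) auto
      then have 1: "n + m + 1 \<le> (m + 2) * n" using n unfolding distrib_right by linarith
      have 2: "residue_count K (span_box B (n + m) C) \<le> residue_count K (traj (span_box B 1 C) (n + m))"
        by (intro residue_count_subset finite_traj finite_span_box B span_box_subset_traj)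
      have "real (n + m + 1) \<le> real (m + 2) * real n" using 1 by (metis of_nat_mono of_nat_mult)
      then show ?thesis using R A 2 by (intro mult_mono power_mono) auto
    qed
    also have "\<dots> = (R * (A * a * (m + 2)) ^ d) * real n ^ (e + (e' + 1) * d) * residue_count K (traj (span_box B 1 C) (n + m)) * 1 ^ n"
    proof -
      have "A * real (a * n ^ e') * (real (m + 2) * real n) = (A * a * (m + 2)) * real n ^ (e' + 1)" by simp
      then have "(A * real (a * n ^ e') * (real (m + 2) * real n)) ^ d = (A * a * (m + 2)) ^ d * real n ^ ((e' + 1) * d)"
        by (simp only: power_mult_distrib power_mult)
      then show ?thesis by (simp add: power_add)
    qed
    finally show ?thesis by simp
  qed
  then have "entropy K F + ln 1 \<le> entropy K (span_box B 1 C) + ln 1"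
    by (rule entropy_growth[OF K F finite_span_box[OF B] ne one one])
  then show ?thesis by simp
qed

text \<open>Modulo \<open>K\<close>, finitely many elements are combinations of the generators with
  bounded coefficients, and along a trajectory the bounds grow linearly.\<close>

lemma fg_entropy_le:
  assumes K: "subspace K" and B: "finite B" and rob: "robust K B C"
    and F: "finite F" "F \<noteq> {}" "F \<subseteq> span (B \<union> K)"
  shows "entropy K F \<le> entropy K (span_box B 1 C)"
proof -
  have "\<forall>x\<in>F. \<exists>u\<in>span B. x - u \<in> K" using span_Un_subspace[OF K] F by blast
  then obtain g where g: "\<And>x. x \<in> F \<Longrightarrow> g x \<in> span B" "\<And>x. x \<in> F \<Longrightarrow> x - g x \<in> K" by metis
  have gF: "finite (g ` F)" "g ` F \<noteq> {}" "g ` F \<subseteq> span B" using g F by auto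
  obtain m c where mc: "g ` F \<subseteq> span_box B m c" using span_subset_span_box[OF B gF(1,3)] by blast
  have "entropy K F \<le> entropy K (g ` F)" by (rule entropy_mono) (use K F g in auto)
  also have "\<dots> \<le> entropy K (span_box B 1 C)"
  proof (rule robust_entropy_le[OF K B rob gF(1,2), of 1 0 m "c + 1" 1])
    fix n :: nat
    have "traj (g ` F) n \<subseteq> span_box B (n + m) (n * c)" by (rule traj_subset_span_box[OF mc])
    also have "\<dots> \<subseteq> span_box B (n + m) ((c + 1) * n ^ 1)" by (intro span_box_mono) auto
    finally have "residue_count K (traj (g ` F) n) \<le> residue_count K (span_box B (n + m) ((c + 1) * n ^ 1))"
      by (intro residue_count_subset finite_span_box B)
    then show "real (residue_count K (traj (g ` F) n)) \<le> 1 * real n ^ 0 * real (residue_count K (span_box B (n + m) ((c + 1) * n ^ 1)))"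
      by simp
  qed auto
  finally show ?thesis .
qed

lemma fg_has_entropy:
  assumes K: "subspace K" and B: "finite B" and rob: "robust K B C"
  shows "has_entropy K (span (B \<union> K)) (entropy K (span_box B 1 C))"
proof -
  have "span_box B 1 C \<subseteq> span (B \<union> K)" using span_box_subset_span[of B 1 C] span_mono[of B "B \<union> K"] by auto
  moreover have "span_box B 1 C \<noteq> {}" using zero_in_span_box by (metis empty_iff)
  ultimately have "\<exists>F. finite F \<and> F \<noteq> {} \<and> F \<subseteq> span (B \<union> K) \<and> entropy K F = entropy K (span_box B 1 C)"
    using finite_span_box[OF B] by (intro exI[of _ "span_box B 1 C"]) simp
  then show ?thesis unfolding has_entropy_def using fg_entropy_le[OF K B rob] by simp
qed

end

section \<open>Counting residue classes of integer polynomials\<close>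

text \<open>The columns of the adjugate show that the determinant times each unit vector lies in the
  lattice spanned by the columns of the matrix.\<close>

lemma adjugate_entries:
  fixes a :: "nat \<Rightarrow> nat \<Rightarrow> int"
  obtains b where
    "\<And>i j. i < n \<Longrightarrow> j < n \<Longrightarrow> (\<Sum>k<n. a i k * b k j) = (if i = j then det (mat n n (\<lambda>(i, j). a i j)) else 0)"
proof -
  define A where "A = mat n n (\<lambda>(i, j). a i j)"
  have A: "A \<in> carrier_mat n n" by (simp add: A_def)
  note adj = adj_mat[OF A]
  have "(\<Sum>k<n. a i k * adj_mat A $$ (k, j)) = (if i = j then det A else 0)" if "i < n" "j < n" for i j
  proof -
    have "(A * adj_mat A) $$ (i, j) = (\<Sum>k<n. a i k * adj_mat A $$ (k, j))"
      using that adj(1) A by (simp add: scalar_prod_def lessThan_atLeast0 A_def)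
    moreover have "(A * adj_mat A) $$ (i, j) = (if i = j then det A else 0)" using adj(2) that by simp
    ultimately show ?thesis by simp
  qed
  then show ?thesis unfolding A_def by (rule that)
qed

text \<open>The lattice \<open>a \<int>\<^sup>n\<close> contains a triangular system of vectors with minimal diagonal entries \<open>d\<close>.
  The box with side lengths \<open>d\<close> consists of incongruent points, and its size is a multiple of \<open>det a\<close>.\<close>

lemma det_le_card_incongruent:
  fixes a :: "nat \<Rightarrow> nat \<Rightarrow> int"
  assumes D0: "det (mat n n (\<lambda>(i, j). a i j)) \<noteq> 0"
  shows "\<exists>X. finite X \<and> \<bar>det (mat n n (\<lambda>(i, j). a i j))\<bar> \<le> int (card X) \<and>
    (\<forall>x\<in>X. \<forall>y\<in>X. (\<exists>q. \<forall>i<n. x i - y i = (\<Sum>j<n. a i j * q j)) \<longrightarrow> x = y)"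
proof -
  define D where "D = det (mat n n (\<lambda>(i, j). a i j))"
  define app where "app q i = (\<Sum>j<n. a i j * q j)" for q i
  have app_minus: "app (\<lambda>j. - q j) i = - app q i" for q i by (simp add: app_def sum_negf)
  obtain b where b: "\<And>i j. i < n \<Longrightarrow> j < n \<Longrightarrow> (\<Sum>k<n. a i k * b k j) = (if i = j then D else 0)"
    using adjugate_entries[where a = a and n = n] unfolding D_def by blast
  \<comment> \<open>Such a \<open>v\<close> is a candidate for the i-th diagonal entry of a
    triangular system of lattice vectors.\<close>
  define P where "P i v \<longleftrightarrow> v > 0 \<and> (\<exists>q. app q i = int v \<and> (\<forall>j. i < j \<longrightarrow> j < n \<longrightarrow> app q j = 0))" for i v
  have P_ex: "P i (nat \<bar>D\<bar>)" if i: "i < n" for i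
  proof -
    \<comment> \<open>A column of the adjugate, with its sign corrected, yields
      \<open>\<bar>D\<bar>\<close> times a unit vector.\<close>
    define q where "q k = sgn D * b k i" for k
    have "app q j = sgn D * (\<Sum>k<n. a j k * b k i)" for j
      unfolding app_def q_def by (simp add: sum_distrib_left mult_ac)
    moreover have "sgn D * D = \<bar>D\<bar>" by (simp add: sgn_if)
    ultimately have "app q i = int (nat \<bar>D\<bar>)" "\<And>j. i < j \<Longrightarrow> j < n \<Longrightarrow> app q j = 0"
      using b i by simp_all
    then show ?thesis using D0 unfolding P_def D_def by auto
  qed
  define d where "d i = (LEAST v. P i v)" for i
  have d: "P i (d i)" if "i < n" for i unfolding d_def using P_ex[OF that] by (rule LeastI)
  have d_le: "d i \<le> v" if "P i v" for i v unfolding d_def using that by (rule Least_le)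
  have "\<forall>i\<in>{..<n}. \<exists>q. app q i = int (d i) \<and> (\<forall>j. i < j \<longrightarrow> j < n \<longrightarrow> app q j = 0)"
    using d unfolding P_def by blast
  from bchoice[OF this] obtain u where "\<forall>i\<in>{..<n}. app (u i) i = int (d i) \<and> (\<forall>j. i < j \<longrightarrow> j < n \<longrightarrow> app (u i) j = 0)"
    by blast
  then have u: "\<And>i. i < n \<Longrightarrow> app (u i) i = int (d i)"
    "\<And>i j. i < j \<Longrightarrow> j < n \<Longrightarrow> app (u i) j = 0" by auto
  define A where "A = mat n n (\<lambda>(i, j). a i j)"
  define U where "U = mat n n (\<lambda>(i, j). u j i)"
  have A: "A \<in> carrier_mat n n" and U: "U \<in> carrier_mat n n" by (auto simp: A_def U_def)
  have AU: "(A * U) $$ (i, j) = app (u j) i" if "i < n" "j < n" for i j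
    using that by (simp add: scalar_prod_def lessThan_atLeast0 A_def U_def app_def)
  have "upper_triangular (A * U)"
    unfolding upper_triangular_def using A U AU u(2) by auto
  then have "det (A * U) = prod_list (diag_mat (A * U))"
    by (rule det_upper_triangular) (use A U in auto)
  also have "\<dots> = (\<Prod>i<n. int (d i))"
    unfolding prod_list_diag_prod using A U AU u(1) by (auto simp: lessThan_atLeast0 intro!: prod.cong)
  \<comment> \<open>\<open>U\<close> has integer entries, so
    \<open>\<bar>det U\<bar> \<ge> 1\<close> and the product of the \<open>d i\<close> bounds
    \<open>\<bar>det A\<bar>\<close>.\<close>
  finally have det: "det A * det U = (\<Prod>i<n. int (d i))" using det_mult[OF A U] by simp
  have pos: "(\<Prod>i<n. int (d i)) > 0" using d by (intro prod_pos) (auto simp: P_def)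
  then have "det A * det U \<noteq> 0" using det by linarith
  then have "det U \<noteq> 0" by simp
  then have "\<bar>det A\<bar> * 1 \<le> \<bar>det A\<bar> * \<bar>det U\<bar>" by (intro mult_left_mono) auto
  also have "\<dots> = (\<Prod>i<n. int (d i))" using det pos by (simp flip: abs_mult)
  finally have le: "\<bar>D\<bar> \<le> (\<Prod>i<n. int (d i))" by (simp add: D_def A_def)
  define X where "X = PiE {..<n} (\<lambda>i. {0..<int (d i)})"
  have fin: "finite X" unfolding X_def by (intro finite_PiE) auto
  have "card X = (\<Prod>i<n. d i)" unfolding X_def by (simp add: card_PiE)
  then have card: "\<bar>D\<bar> \<le> int (card X)" using le by simp
  have inj: "x = y" if xy: "x \<in> X" "y \<in> X" and q: "\<And>i. i < n \<Longrightarrow> x i - y i = app q i" for x y q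
  proof (rule ccontr)
    assume ne: "x \<noteq> y"
    \<comment> \<open>At the last coordinate where \<open>x\<close> and \<open>y\<close> differ,
      their difference, up to sign, is a lattice value strictly between 0 and \<open>d i\<close>,
      against minimality.\<close>
    define I where "I = {i. i < n \<and> x i \<noteq> y i}"
    have "I \<noteq> {}" using ne xy unfolding I_def X_def by (auto simp: PiE_def extensional_def fun_eq_iff) (metis linorder_not_less)
    moreover have "finite I" by (simp add: I_def)
    ultimately have "Max I \<in> I" and max: "\<And>j. j \<in> I \<Longrightarrow> j \<le> Max I" by auto
    define i where "i = Max I"
    have i: "i < n" "x i \<noteq> y i" using \<open>Max I \<in> I\<close> by (auto simp: I_def i_def)
    have eq: "x j = y j" if "i < j" "j < n" for j
    proof (rule ccontr)
      assume "x j \<noteq> y j"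
      then have "j \<in> I" using that by (simp add: I_def)
      then show False using max[of j] that by (simp add: i_def)
    qed
    have range: "0 \<le> x i" "x i < int (d i)" "0 \<le> y i" "y i < int (d i)" using xy i by (auto simp: X_def PiE_def Pi_def)
    have no: "\<not> (0 < app p i \<and> app p i < int (d i) \<and> (\<forall>j. i < j \<longrightarrow> j < n \<longrightarrow> app p j = 0))" for p
    proof
      assume *: "0 < app p i \<and> app p i < int (d i) \<and> (\<forall>j. i < j \<longrightarrow> j < n \<longrightarrow> app p j = 0)"
      then have "P i (nat (app p i))" unfolding P_def by auto
      then show False using d_le * by fastforce
    qed
    have zero: "app q j = 0" if "i < j" "j < n" for j using q[of j] eq[of j] that by simp
    have val: "app q i = x i - y i" using q i by simp
    show False
    proof (cases "x i > y i")
      case True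
      then show False using no[of q] zero range val by simp
    next
      case False
      then show False using no[of "\<lambda>j. - q j"] zero range val i(2) by (simp add: app_minus)
    qed
  qed
  show ?thesis
    using fin card inj unfolding D_def app_def by (intro exI[of _ X]) blast
qed

text \<open>The matrix of multiplication by \<open>g\<close> on \<open>R[t]/(t\<^sup>n - 2)\<close>, for \<open>g\<close> of degree less than \<open>n\<close>.\<close>

definition twisted :: "nat \<Rightarrow> 'a::comm_ring_1 poly \<Rightarrow> nat \<Rightarrow> nat \<Rightarrow> 'a" where
  "twisted n g i j = (if j \<le> i then coeff g (i - j) else 2 * coeff g (n + i - j))"

definition twisted_mat :: "nat \<Rightarrow> 'a::comm_ring_1 poly \<Rightarrow> 'a mat" where
  "twisted_mat n g = mat n n (\<lambda>(i, j). twisted n g i j)"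

lemma twisted_mat_carrier [simp]: "twisted_mat n g \<in> carrier_mat n n"
  by (simp add: twisted_mat_def)

lemma twisted_mat_const: "twisted_mat n [:a:] = a \<cdot>\<^sub>m 1\<^sub>m n"
  by (rule eq_matI) (auto simp: twisted_mat_def twisted_def coeff_pCons split: nat.splits)

lemma twisted_linear:
  assumes "i < n" "j < n"
  shows "twisted n [:- \<alpha>, 1:] i j =
    (if i = j then - \<alpha> else if i = Suc j then 1 else if i = 0 \<and> j = n - 1 then 2 else 0)"
  using assms by (auto simp: twisted_def coeff_pCons split: nat.splits)

lemma sum_two_terms:
  assumes "finite A" "x \<in> A" "y \<in> A" "x \<noteq> y" "\<And>z. z \<in> A \<Longrightarrow> z \<noteq> x \<Longrightarrow> z \<noteq> y \<Longrightarrow> f z = 0"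
  shows "sum f A = f x + (f y :: 'a::comm_monoid_add)"
proof -
  have "sum f A = sum f {x, y}" using assms by (intro sum.mono_neutral_right) auto
  then show ?thesis using assms by simp
qed

text \<open>Row \<open>i\<close> of the linear factor has at most two nonzero entries, at
  \<open>i\<close> and at its cyclic predecessor \<open>i'\<close>. The bound on
  \<open>degree h\<close> keeps the product below degree \<open>n\<close>, as it must be since
  \<open>twisted\<close> has no term for the coefficient of \<open>t^n\<close>.\<close>

lemma twisted_mat_linear_mult:
  assumes n: "n \<ge> 2" and h: "degree h < n - 1"
  shows "twisted_mat n ([:- \<alpha>, 1:] * h) = twisted_mat n [:- \<alpha>, 1:] * twisted_mat n h"
proof (rule eq_matI)
  fix i j assume "i < dim_row (twisted_mat n [:- \<alpha>, 1:] * twisted_mat n h)"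
    "j < dim_col (twisted_mat n [:- \<alpha>, 1:] * twisted_mat n h)"
  then have ij: "i < n" "j < n" by (auto simp: twisted_mat_def)
  define i' where "i' = (if i = 0 then n - 1 else i - 1)"
  have i': "i' < n" "i' \<noteq> i" using ij n by (auto simp: i'_def)
  have h0: "coeff h (n - 1) = 0" by (rule coeff_eq_0[OF h])
  have "(twisted_mat n [:- \<alpha>, 1:] * twisted_mat n h) $$ (i, j) =
      (\<Sum>k<n. twisted n [:- \<alpha>, 1:] i k * twisted n h k j)"
    using ij by (simp add: twisted_mat_def scalar_prod_def lessThan_atLeast0)
  also have "\<dots> = twisted n [:- \<alpha>, 1:] i i * twisted n h i j + twisted n [:- \<alpha>, 1:] i i' * twisted n h i' j"
    using ij i' by (intro sum_two_terms) (auto simp: twisted_linear i'_def)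
  also have "\<dots> = twisted n ([:- \<alpha>, 1:] * h) i j"
  proof (cases "i = 0")
    case True
    have "n - j = Suc (n - Suc j)" using ij by arith
    then have c: "coeff (pCons 0 h) (n - j) = coeff h (n - Suc j)" by simp
    have L: "twisted n [:- \<alpha>, 1:] 0 0 = - \<alpha>" "twisted n [:- \<alpha>, 1:] 0 (n - 1) = 2"
      using n by (simp_all add: twisted_linear)
    have H: "twisted n h (n - 1) j = coeff h (n - Suc j)" using ij by (simp add: twisted_def)
    show ?thesis
    proof (cases "j = 0")
      case True
      then show ?thesis using \<open>i = 0\<close> L H h0 by (simp add: i'_def twisted_def)
    next
      case False
      then show ?thesis using \<open>i = 0\<close> L H c by (simp add: i'_def twisted_def algebra_simps)
    qed
  next
    case False
    have "twisted n [:- \<alpha>, 1:] i i' = 1" using False ij by (simp add: twisted_linear i'_def)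
    moreover have "twisted n h (i - 1) j - \<alpha> * twisted n h i j = twisted n ([:- \<alpha>, 1:] * h) i j"
    proof -
      consider "j < i" | "j = i" | "j > i" by linarith
      then show ?thesis
      proof cases
        case 1
        define m where "m = i - 1 - j"
        have m: "i - j = Suc m" "i - 1 - j = m" "j \<le> i - 1" unfolding m_def using 1 by arith+
        show ?thesis using 1 m by (simp add: twisted_def)
      next
        case 2
        then show ?thesis using False h0 ij n by (simp add: twisted_def)
      next
        case 3
        define m where "m = n + (i - 1) - j"
        have m: "n + i - j = Suc m" "n + (i - 1) - j = m" "i + n - Suc j = m" "\<not> j \<le> i - 1" unfolding m_def using False ij 3 by arith+
        show ?thesis using 3 m by (simp add: twisted_def algebra_simps)
      qed
    qed
    ultimately show ?thesis using False ij by (simp add: twisted_linear i'_def)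
  qed
  finally show "twisted_mat n ([:- \<alpha>, 1:] * h) $$ (i, j) = (twisted_mat n [:- \<alpha>, 1:] * twisted_mat n h) $$ (i, j)"
    using ij by (simp add: twisted_mat_def)
qed (auto simp: twisted_mat_def)

text \<open>Expansion along row 0 meets only the entry \<open>- \<alpha>\<close> and the corner
  entry 2; both minors are triangular, with diagonal entries \<open>- \<alpha>\<close> and 1
  respectively.\<close>

lemma det_twisted_mat_linear:
  fixes \<alpha> :: complex
  assumes n: "n \<ge> 2"
  shows "norm (det (twisted_mat n [:- \<alpha>, 1:])) = norm (\<alpha> ^ n - 2)"
proof -
  define S where "S = twisted_mat n [:- \<alpha>, 1:]"
  have S: "S \<in> carrier_mat n n" by (simp add: S_def)
  have e: "S $$ (i, j) = (if i = j then - \<alpha> else if i = Suc j then 1 else if i = 0 \<and> j = n - 1 then 2 else 0)"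
    if "i < n" "j < n" for i j 
  proof -
    have "S $$ (i, j) = twisted n [:- \<alpha>, 1:] i j" using that by (simp add: S_def twisted_mat_def)
    then show ?thesis using twisted_linear[OF that, of \<alpha>] by simp
  qed
  have "det S = (\<Sum>j<n. S $$ (0, j) * cofactor S 0 j)" using n by (intro laplace_expansion_row[OF S]) auto
  also have "\<dots> = S $$ (0, 0) * cofactor S 0 0 + S $$ (0, n - 1) * cofactor S 0 (n - 1)"
    using n e by (intro sum_two_terms) auto
  also have "\<dots> = - \<alpha> * cofactor S 0 0 + 2 * cofactor S 0 (n - 1)" using e n by simp
  also have "cofactor S 0 0 = (- \<alpha>) ^ (n - 1)"
  proof -
    have 1: "mat_delete S 0 0 \<in> carrier_mat (n - 1) (n - 1)" using S by (auto simp: mat_delete_def)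
    have 2: "mat_delete S 0 0 $$ (i, j) = S $$ (Suc i, Suc j)" if "i < n - 1" "j < n - 1" for i j
      using S that by (simp add: mat_delete_def)
    have "det (mat_delete S 0 0) = prod_list (diag_mat (mat_delete S 0 0))"
      by (rule det_lower_triangular[OF _ 1]) (use 2 e in auto)
    also have "\<dots> = (\<Prod>i<n - 1. - \<alpha>)"
      unfolding prod_list_diag_prod using 1 2 e by (auto simp: lessThan_atLeast0 intro!: prod.cong)
    finally show ?thesis by (simp add: cofactor_def)
  qed
  also have "cofactor S 0 (n - 1) = (- 1) ^ (n - 1)"
  proof -
    have 1: "mat_delete S 0 (n - 1) \<in> carrier_mat (n - 1) (n - 1)" using S by (auto simp: mat_delete_def)
    have 2: "mat_delete S 0 (n - 1) $$ (i, j) = S $$ (Suc i, j)" if "i < n - 1" "j < n - 1" for i j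
      using S that by (simp add: mat_delete_def)
    have "upper_triangular (mat_delete S 0 (n - 1))" unfolding upper_triangular_def using 1 2 e by auto
    then have "det (mat_delete S 0 (n - 1)) = prod_list (diag_mat (mat_delete S 0 (n - 1)))"
      by (rule det_upper_triangular[OF _ 1])
    also have "\<dots> = (\<Prod>i<n - 1. 1)"
      unfolding prod_list_diag_prod using 1 2 e by (auto simp: lessThan_atLeast0 intro!: prod.neutral)
    finally show ?thesis by (simp add: cofactor_def)
  qed
  also have "- \<alpha> * (- \<alpha>) ^ (n - 1) = (- \<alpha>) ^ n" using n by (cases n) auto
  also have "(- \<alpha>) ^ n + 2 * (- 1) ^ (n - 1) = (- 1) ^ n * (\<alpha> ^ n - 2)"
  proof -
    obtain m where "n = Suc m" using n by (cases n) auto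
    then show ?thesis by (simp add: power_minus[of \<alpha>] algebra_simps)
  qed
  finally show ?thesis by (simp add: S_def norm_mult norm_power)
qed

lemma degree_linear_prod: "degree (\<Prod>\<alpha>\<leftarrow>xs. [:- \<alpha>, 1:] :: 'a::idom poly) = length xs"
proof (induction xs)
  case (Cons \<alpha> xs)
  have "(\<Prod>\<alpha>\<leftarrow>xs. [:- \<alpha>, 1:] :: 'a poly) \<noteq> 0" by (auto simp: prod_list_zero_iff)
  then have "degree ([:- \<alpha>, 1:] * (\<Prod>\<alpha>\<leftarrow>xs. [:- \<alpha>, 1:])) = 1 + degree (\<Prod>\<alpha>\<leftarrow>xs. [:- \<alpha>, 1:])"
    by (subst degree_mult_eq) auto
  then show ?case using Cons by simp
qed simp

text \<open>Multiplicativity of the determinant, one linear factor at a time. The value is the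
  absolute resultant of the polynomial with \<open>t^n - 2\<close>.\<close>

lemma det_twisted_mat:
  fixes a :: complex
  assumes n: "n \<ge> 2" and a: "a \<noteq> 0" and len: "length xs < n"
  shows "norm (det (twisted_mat n (Polynomial.smult a (\<Prod>\<alpha>\<leftarrow>xs. [:- \<alpha>, 1:])))) =
    norm a ^ n * (\<Prod>\<alpha>\<leftarrow>xs. norm (\<alpha> ^ n - 2))"
  using len
proof (induction xs)
  case Nil
  then show ?case by (simp add: twisted_mat_const norm_power)
next
  case (Cons \<alpha> xs)
  define h where "h = Polynomial.smult a (\<Prod>\<alpha>\<leftarrow>xs. [:- \<alpha>, 1:])"
  have "degree h = length xs" using a by (simp add: h_def degree_linear_prod)
  then have "twisted_mat n ([:- \<alpha>, 1:] * h) = twisted_mat n [:- \<alpha>, 1:] * twisted_mat n h"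
    using Cons.prems by (intro twisted_mat_linear_mult n) auto
  then have "det (twisted_mat n ([:- \<alpha>, 1:] * h)) = det (twisted_mat n [:- \<alpha>, 1:]) * det (twisted_mat n h)"
    by (simp add: det_mult[of _ n])
  moreover have "Polynomial.smult a (\<Prod>\<alpha>\<leftarrow>\<alpha> # xs. [:- \<alpha>, 1:]) = [:- \<alpha>, 1:] * h" by (simp add: h_def)
  ultimately show ?case using Cons det_twisted_mat_linear[OF n, of \<alpha>] by (simp add: h_def norm_mult)
qed

text \<open>The product has degree below \<open>n\<close>, so no reduction by \<open>t^n = 2\<close>
  takes place and the doubled terms vanish.\<close>

lemma twisted_mult:
  assumes g: "degree g < n" and h: "\<And>i. i \<ge> n - degree g \<Longrightarrow> coeff h i = 0" and i: "i < n"
  shows "coeff (g * h) i = (\<Sum>j<n. twisted n g i j * coeff h j)"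
proof -
  have "coeff (g * h) i = (\<Sum>j\<le>i. coeff h j * coeff g (i - j))"
    by (subst mult.commute) (rule coeff_mult)
  also have "\<dots> = (\<Sum>j\<le>i. twisted n g i j * coeff h j)"
    by (intro sum.cong) (auto simp: twisted_def mult.commute)
  also have "\<dots> = (\<Sum>j<n. twisted n g i j * coeff h j)"
  proof (rule sum.mono_neutral_left)
    show "\<forall>j\<in>{..<n} - {..i}. twisted n g i j * coeff h j = 0"
    proof
      fix j assume j: "j \<in> {..<n} - {..i}"
      show "twisted n g i j * coeff h j = 0"
      proof (cases "j \<ge> n - degree g")
        case False
        then have "n + i - j > degree g" using j by auto
        then have "coeff g (n + i - j) = 0" by (rule coeff_eq_0)
        then show ?thesis using j by (simp add: twisted_def)
      qed (simp add: h)
    qed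
  qed (use i in auto)
  finally show ?thesis .
qed

text \<open>A row runs through distinct coefficients of \<open>g\<close>, some of them
  doubled.\<close>

lemma twisted_row_sum:
  fixes g :: "int poly"
  assumes g: "degree g < n" and i: "i < n"
  shows "(\<Sum>j<n. \<bar>twisted n g i j\<bar>) \<le> 2 * (\<Sum>m\<le>degree g. \<bar>coeff g m\<bar>)"
proof -
  define m where "m j = (if j \<le> i then i - j else n + i - j)" for j
  have inj: "inj_on m {..<n}" using i by (auto simp: inj_on_def m_def split: if_splits)
  have "(\<Sum>j<n. \<bar>twisted n g i j\<bar>) \<le> (\<Sum>j<n. 2 * \<bar>coeff g (m j)\<bar>)"
    by (intro sum_mono) (auto simp: twisted_def m_def abs_mult)
  also have "\<dots> = (\<Sum>k\<in>m ` {..<n}. 2 * \<bar>coeff g k\<bar>)" by (simp add: sum.reindex[OF inj])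
  also have "\<dots> \<le> (\<Sum>k<n. 2 * \<bar>coeff g k\<bar>)"
    by (intro sum_mono2) (use i in \<open>auto simp: m_def\<close>)
  also have "\<dots> = (\<Sum>k\<le>degree g. 2 * \<bar>coeff g k\<bar>)"
    by (intro sum.mono_neutral_right) (use g in \<open>auto simp: coeff_eq_0\<close>)
  finally show ?thesis by (simp add: sum_distrib_left)
qed

text \<open>Rounding the coordinates with respect to the lattice moves each residue class into a fixed box.\<close>

lemma incongruent_box:
  fixes g :: "int poly"
  assumes g: "degree g < n" and D0: "det (twisted_mat n g) \<noteq> 0"
  shows "\<exists>X \<subseteq> int_box n (nat (2 * (\<Sum>m\<le>degree g. \<bar>coeff g m\<bar>))).
    \<bar>det (twisted_mat n g)\<bar> \<le> int (card X) \<and> (\<forall>x\<in>X. \<forall>y\<in>X. g dvd x - y \<longrightarrow> x = y)"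
proof -
  define a where "a = twisted n g"
  define D where "D = det (twisted_mat n g)"
  have D: "D = det (mat n n (\<lambda>(i, j). a i j))" by (simp add: D_def twisted_mat_def a_def)
  have D0: "D \<noteq> 0" using assms by (simp add: D_def)
  obtain X0 where X0: "finite X0" "\<bar>D\<bar> \<le> int (card X0)" and
    X0': "\<forall>x\<in>X0. \<forall>y\<in>X0. (\<exists>q. \<forall>i<n. x i - y i = (\<Sum>j<n. a i j * q j)) \<longrightarrow> x = y"
    using det_le_card_incongruent[of n a] D0 unfolding D by blast
  obtain b where b: "\<And>i j. i < n \<Longrightarrow> j < n \<Longrightarrow> (\<Sum>k<n. a i k * b k j) = (if i = j then D else 0)"
    using adjugate_entries[where a = a and n = n] unfolding D by blast
  \<comment> \<open>These are \<open>D\<close> times the coordinates of \<open>x\<close> with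
    respect to the lattice, so \<open>y x k div D\<close> are the rounded coordinates.\<close>
  define y where "y x k = (\<Sum>j<n. b k j * x j)" for x k
  have ay: "(\<Sum>k<n. a i k * y x k) = D * x i" if i: "i < n" for x i
  proof -
    have "(\<Sum>k<n. a i k * y x k) = (\<Sum>k<n. \<Sum>j<n. a i k * b k j * x j)"
      by (simp add: y_def sum_distrib_left mult.assoc)
    also have "\<dots> = (\<Sum>j<n. (\<Sum>k<n. a i k * b k j) * x j)"
      by (subst sum.swap) (simp add: sum_distrib_right)
    also have "\<dots> = (\<Sum>j<n. if j = i then D * x i else 0)" using i b by (intro sum.cong) auto
    also have "\<dots> = D * x i" using i by simp
    finally show ?thesis .
  qed
  define red where "red x i = x i - (\<Sum>k<n. a i k * (y x k div D))" for x i
  define C where "C = 2 * (\<Sum>m\<le>degree g. \<bar>coeff g m\<bar>)"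
  have C: "C \<ge> 0" by (simp add: C_def sum_nonneg)
  have red_le: "\<bar>red x i\<bar> \<le> C" if i: "i < n" for x i
  proof -
    \<comment> \<open>\<open>D * red x\<close> is the lattice matrix applied to remainders modulo
      \<open>D\<close>. These are below \<open>\<bar>D\<bar>\<close>, so after cancelling
      \<open>D\<close> the row sums of the matrix bound \<open>red x\<close>.\<close>
    have "D * red x i = (\<Sum>k<n. a i k * y x k) - D * (\<Sum>k<n. a i k * (y x k div D))"
      using ay[OF i] by (simp add: red_def right_diff_distrib)
    also have "\<dots> = (\<Sum>k<n. a i k * (y x k mod D))"
      by (simp add: sum_distrib_left sum_subtractf[symmetric] minus_mult_div_eq_mod[symmetric] algebra_simps)
    finally have "\<bar>D\<bar> * \<bar>red x i\<bar> = \<bar>\<Sum>k<n. a i k * (y x k mod D)\<bar>" by (simp flip: abs_mult)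
    also have "\<dots> \<le> (\<Sum>k<n. \<bar>a i k\<bar> * \<bar>D\<bar>)"
      by (intro order_trans[OF sum_abs] sum_mono)
        (use abs_mod_less[OF D0] in \<open>auto simp: abs_mult less_imp_le intro!: mult_left_mono\<close>)
    also have "\<dots> = \<bar>D\<bar> * (\<Sum>k<n. \<bar>a i k\<bar>)" by (simp add: sum_distrib_left mult.commute)
    also have "\<dots> \<le> \<bar>D\<bar> * C"
      unfolding a_def C_def by (intro mult_left_mono twisted_row_sum g i) auto
    finally show ?thesis using D0 by simp
  qed
  define P where "P x = Poly (map (red x) [0..<n])" for x
  have cP: "coeff (P x) i = (if i < n then red x i else 0)" for x i
    by (simp add: P_def nth_default_def)
  have int_box: "P x \<in> int_box n (nat C)" for x
    by (rule int_box_I) (use red_le C in \<open>auto simp: cP\<close>)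
  have inj: "x = x'" if x: "x \<in> X0" "x' \<in> X0" and dvd: "g dvd P x - P x'" for x x'
  proof -
    obtain h where h: "P x - P x' = g * h" using dvd by (elim dvdE)
    have h0: "coeff h i = 0" if "i \<ge> n - degree g" for i
    proof (cases "h = 0")
      case False
      have "g \<noteq> 0"
      proof
        assume "g = 0"
        then have "twisted_mat n g = 0\<^sub>m n n" by (auto simp: twisted_mat_def twisted_def intro!: eq_matI)
        moreover have "n > 0" using g by simp
        ultimately show False using D0 by (simp add: D_def)
      qed
      have "degree g + degree h < n"
      proof -
        have "coeff (g * h) i = 0" if "i \<ge> n" for i using that unfolding h[symmetric] by (simp add: cP)
        then have "degree (g * h) < n" using \<open>g \<noteq> 0\<close> False
          by (metis leading_coeff_0_iff linorder_not_less mult_eq_0_iff)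
        then show ?thesis using \<open>g \<noteq> 0\<close> False by (simp add: degree_mult_eq)
      qed
      then show ?thesis using that by (intro coeff_eq_0) simp
    qed simp
    \<comment> \<open>The multiple \<open>g * h\<close> is a lattice vector with coordinates
      \<open>coeff h\<close>; undoing the rounding of both points adds further lattice
      vectors.\<close>
    have "\<forall>i<n. x i - x' i = (\<Sum>j<n. a i j * (coeff h j + y x j div D - y x' j div D))"
    proof (intro allI impI)
      fix i assume i: "i < n"
      have "red x i - red x' i = (\<Sum>j<n. a i j * coeff h j)"
        using twisted_mult[OF g h0 i] i unfolding a_def h[symmetric] by (simp add: cP)
      then show "x i - x' i = (\<Sum>j<n. a i j * (coeff h j + y x j div D - y x' j div D))"
        by (simp add: red_def sum.distrib sum_subtractf algebra_simps)
    qed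
    then show ?thesis
      by (intro X0'[THEN bspec, OF x(1), THEN bspec, OF x(2), THEN mp] exI)
  qed
  have "inj_on P X0" by (rule inj_onI, rule inj) auto
  then have "card (P ` X0) = card X0" by (rule card_image)
  then show ?thesis using int_box inj X0(2) unfolding C_def[symmetric] D_def[symmetric]
    by (intro exI[of _ "P ` X0"]) auto
qed

text \<open>The exponential of \<open>log_mahler_measure\<close> for nonzero \<open>g\<close>; its
  powers compare directly with cardinalities.\<close>

definition mahler :: "int poly \<Rightarrow> real" where
  "mahler g = \<bar>real_of_int (lead_coeff g)\<bar> * (\<Prod>\<alpha>\<in>#proots (cpoly g). max 1 (norm \<alpha>))"

lemma prod_mset_max_ge_1: "(1::real) \<le> (\<Prod>\<alpha>\<in>#A. max 1 (norm \<alpha>))"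
proof (induction A)
  case (add \<alpha> A)
  then show ?case using mult_mono[of 1 "max 1 (norm \<alpha>)" 1 "\<Prod>\<alpha>\<in>#A. max 1 (norm \<alpha>)"] by simp
qed simp

lemma mahler_ge_1:
  assumes "g \<noteq> 0"
  shows "mahler g \<ge> 1"
proof -
  have "\<bar>lead_coeff g\<bar> \<ge> 1" using assms by (simp add: Ints_nonzero_abs_ge1 int_one_le_iff_zero_less)
  then have "(1::real) \<le> \<bar>real_of_int (lead_coeff g)\<bar>" by linarith
  then show ?thesis unfolding mahler_def
    using mult_mono[of 1 "\<bar>real_of_int (lead_coeff g)\<bar>" 1] prod_mset_max_ge_1[of "proots (cpoly g)"] by simp
qed

text \<open>If \<open>norm \<alpha> \<le> 1\<close>, then \<open>\<alpha> ^ n - 2\<close> has norm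
  at least 1; otherwise 2 is at most half of \<open>norm \<alpha> ^ n\<close> once this power
  exceeds 4. Each root thus costs a factor 2 at most.\<close>

lemma prod_max_power_le:
  fixes xs :: "complex list"
  shows "\<exists>n0. \<forall>n\<ge>n0. (\<Prod>\<alpha>\<leftarrow>xs. max 1 (norm \<alpha>)) ^ n \<le> 2 ^ length xs * (\<Prod>\<alpha>\<leftarrow>xs. norm (\<alpha> ^ n - 2))"
proof (induction xs)
  case (Cons \<alpha> xs)
  then obtain n0 where n0: "\<And>n. n \<ge> n0 \<Longrightarrow> (\<Prod>\<alpha>\<leftarrow>xs. max 1 (norm \<alpha>)) ^ n \<le> 2 ^ length xs * (\<Prod>\<alpha>\<leftarrow>xs. norm (\<alpha> ^ n - 2))"
    by blast
  have "\<exists>n1. \<forall>n\<ge>n1. max 1 (norm \<alpha>) ^ n \<le> 2 * norm (\<alpha> ^ n - 2)"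
  proof (cases "norm \<alpha> \<le> 1")
    case True
    have "1 ^ n \<le> 2 * norm (\<alpha> ^ n - 2)" for n
    proof -
      have "norm (\<alpha> ^ n) \<le> 1" using True by (simp add: norm_power power_le_one)
      moreover have "norm (2 :: complex) \<le> norm (\<alpha> ^ n) + norm (\<alpha> ^ n - 2)"
        using norm_triangle_ineq4[of "\<alpha> ^ n" "\<alpha> ^ n - 2"] by simp
      ultimately show ?thesis by simp
    qed
    then show ?thesis using True by (simp add: max_def)
  next
    case False
    then obtain n1 where n1: "4 < norm \<alpha> ^ n1" using real_arch_pow[of "norm \<alpha>" 4] by auto
    have "norm \<alpha> ^ n \<le> 2 * norm (\<alpha> ^ n - 2)" if "n \<ge> n1" for n
    proof -
      have "norm \<alpha> ^ n1 \<le> norm \<alpha> ^ n" using False that by (intro power_increasing) auto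
      moreover have "norm (\<alpha> ^ n) \<le> norm (\<alpha> ^ n - 2) + 2"
        using norm_triangle_ineq[of "\<alpha> ^ n - 2" 2] by simp
      ultimately show ?thesis using n1 by (simp add: norm_power)
    qed
    then show ?thesis using False by (auto simp: max_def)
  qed
  then obtain n1 where n1: "\<And>n. n \<ge> n1 \<Longrightarrow> max 1 (norm \<alpha>) ^ n \<le> 2 * norm (\<alpha> ^ n - 2)" by blast
  have "(\<Prod>\<alpha>\<leftarrow>\<alpha> # xs. max 1 (norm \<alpha>)) ^ n \<le> 2 ^ length (\<alpha> # xs) * (\<Prod>\<alpha>\<leftarrow>\<alpha> # xs. norm (\<alpha> ^ n - 2))"
    if "n \<ge> max n0 n1" for n
  proof -
    have nn: "0 \<le> (\<Prod>\<alpha>\<leftarrow>xs. max 1 (norm \<alpha>))" by (rule prod_list_nonneg) auto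
    have "max 1 (norm \<alpha>) ^ n * (\<Prod>\<alpha>\<leftarrow>xs. max 1 (norm \<alpha>)) ^ n \<le>
        (2 * norm (\<alpha> ^ n - 2)) * (2 ^ length xs * (\<Prod>\<alpha>\<leftarrow>xs. norm (\<alpha> ^ n - 2)))"
      by (rule mult_mono) (use n0[of n] n1[of n] that nn in auto)
    then show ?thesis by (simp add: power_mult_distrib mult_ac)
  qed
  then show ?case by blast
qed auto

text \<open>The determinant counts incongruent polynomials, and over the complex numbers it factors
  into the roots. The coefficient bound \<open>C\<close> does not depend on \<open>n\<close>, so
  \<open>X\<close> arises along the trajectory of one fixed finite set.\<close>

lemma residue_count_lower:
  fixes g :: "int poly"
  assumes g: "g \<noteq> 0"
  shows "\<exists>C n0. \<forall>n\<ge>n0. \<exists>X \<subseteq> int_box n C. mahler g ^ n \<le> 2 ^ degree g * real (card X) \<and>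
    (\<forall>x\<in>X. \<forall>y\<in>X. g dvd x - y \<longrightarrow> x = y)"
proof -
  have g': "cpoly g \<noteq> 0" using g by simp
  obtain xs where xs: "cpoly g = Polynomial.smult (lead_coeff (cpoly g)) (\<Prod>\<alpha>\<leftarrow>xs. [:- \<alpha>, 1:])"
    "mset xs = proots (cpoly g)" by (rule poly_roots_list[OF g'])
  have deg: "degree (cpoly g) = degree g" by (simp add: degree_map_poly)
  have lc: "lead_coeff (cpoly g) = of_int (lead_coeff g)" by (simp add: deg)
  have len: "length xs = degree g"
    using degree_linear_prod[of xs] xs(1) g' deg by (metis degree_smult_eq leading_coeff_0_iff)
  obtain n0 where n0: "\<And>n. n \<ge> n0 \<Longrightarrow> (\<Prod>\<alpha>\<leftarrow>xs. max 1 (norm \<alpha>)) ^ n \<le> 2 ^ length xs * (\<Prod>\<alpha>\<leftarrow>xs. norm (\<alpha> ^ n - 2))"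
    using prod_max_power_le by blast
  have mah: "mahler g = \<bar>real_of_int (lead_coeff g)\<bar> * (\<Prod>\<alpha>\<leftarrow>xs. max 1 (norm \<alpha>))"
    unfolding mahler_def xs(2)[symmetric] by (metis mset_map prod_mset_prod_list)
  have "\<exists>X \<subseteq> int_box n (nat (2 * (\<Sum>m\<le>degree g. \<bar>coeff g m\<bar>))). mahler g ^ n \<le> 2 ^ degree g * real (card X) \<and>
    (\<forall>x\<in>X. \<forall>y\<in>X. g dvd x - y \<longrightarrow> x = y)" if n: "n \<ge> n0 + degree g + 2" for n
  proof -
    have "map_mat complex_of_int (twisted_mat n g) = twisted_mat n (cpoly g)"
      by (rule eq_matI) (auto simp: twisted_mat_def twisted_def)
    then have "complex_of_int (det (twisted_mat n g)) = det (twisted_mat n (cpoly g))"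
      by (metis of_int_hom.hom_det)
    then have "real_of_int \<bar>det (twisted_mat n g)\<bar> = norm (det (twisted_mat n (cpoly g)))"
      by (metis norm_of_int of_int_abs)
    also have "\<dots> = norm (lead_coeff (cpoly g)) ^ n * (\<Prod>\<alpha>\<leftarrow>xs. norm (\<alpha> ^ n - 2))"
    proof (subst xs(1), rule det_twisted_mat)
      show "lead_coeff (cpoly g) \<noteq> 0" using g' by (simp only: leading_coeff_0_iff not_False_eq_True)
    qed (use n len in auto)
    also have "norm (lead_coeff (cpoly g)) = \<bar>real_of_int (lead_coeff g)\<bar>" unfolding lc by simp
    finally have det: "real_of_int \<bar>det (twisted_mat n g)\<bar> =
      \<bar>real_of_int (lead_coeff g)\<bar> ^ n * (\<Prod>\<alpha>\<leftarrow>xs. norm (\<alpha> ^ n - 2))" .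
    have le: "mahler g ^ n \<le> 2 ^ degree g * real_of_int \<bar>det (twisted_mat n g)\<bar>"
    proof -
      have "\<bar>real_of_int (lead_coeff g)\<bar> ^ n * (\<Prod>\<alpha>\<leftarrow>xs. max 1 (norm \<alpha>)) ^ n \<le>
        \<bar>real_of_int (lead_coeff g)\<bar> ^ n * (2 ^ length xs * (\<Prod>\<alpha>\<leftarrow>xs. norm (\<alpha> ^ n - 2)))"
        by (intro mult_left_mono n0) (use n in auto)
      then show ?thesis unfolding det mah len power_mult_distrib by (simp add: mult_ac)
    qed
    have "mahler g > 0" using mahler_ge_1[OF g] by simp
    then have "mahler g ^ n > 0" by (rule zero_less_power)
    then have "det (twisted_mat n g) \<noteq> 0" using le by auto
    then obtain X where X: "X \<subseteq> int_box n (nat (2 * (\<Sum>m\<le>degree g. \<bar>coeff g m\<bar>)))"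
      "\<bar>det (twisted_mat n g)\<bar> \<le> int (card X)" "\<forall>x\<in>X. \<forall>y\<in>X. g dvd x - y \<longrightarrow> x = y"
      using incongruent_box[of g n] n by auto
    have "real_of_int \<bar>det (twisted_mat n g)\<bar> \<le> real (card X)" using X(2) by linarith
    then have "2 ^ degree g * real_of_int \<bar>det (twisted_mat n g)\<bar> \<le> 2 ^ degree g * real (card X)"
      by (intro mult_left_mono) auto
    from order_trans[OF le this] show ?thesis using X by blast
  qed
  then show ?thesis by blast
qed

section \<open>Ideals of integer polynomials\<close>

text \<open>By Gauss's lemma the cofactor has the content of \<open>Polynomial.smult a p\<close>,
  which is divisible by \<open>a\<close>; so \<open>a\<close> cancels.\<close>

lemma primitive_dvd_smult:
  fixes g p :: "int poly"
  assumes "content g = 1" "a \<noteq> 0" "g dvd Polynomial.smult a p"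
  shows "g dvd p"
proof -
  obtain h where h: "Polynomial.smult a p = g * h" using assms(3) by (elim dvdE)
  have "content (Polynomial.smult a p) = content h" unfolding h using assms(1) by (simp add: content_mult)
  then have "a dvd content h" by (metis content_smult dvd_normalize_iff dvd_refl dvd_triv_left mult.commute normalize_idem normalize_mult dvd_mult2 normalize_dvd_iff)
  then have "[:a:] dvd h" by (simp add: const_poly_dvd_iff_dvd_content)
  then obtain h' where "h = [:a:] * h'" by (elim dvdE)
  then have "Polynomial.smult a p = Polynomial.smult a (g * h')" using h by simp
  then show ?thesis using assms(2) by (metis smult_cancel dvd_triv_left)
qed

text \<open>An element \<open>p0\<close> of least degree generates the ideal over the rationals, and
  \<open>g\<close> is its primitive part. By pseudo-division \<open>g\<close> divides an integer
  multiple of each element, and primitivity removes the multiple. The integer \<open>c\<close>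
  bridges the gap between \<open>g\<close> and the ideal.\<close>

lemma ideal_generator:
  fixes I :: "int poly set"
  assumes diff: "\<And>p q. p \<in> I \<Longrightarrow> q \<in> I \<Longrightarrow> p - q \<in> I" and mult: "\<And>p q. p \<in> I \<Longrightarrow> q * p \<in> I"
    and f: "f \<in> I" "f \<noteq> 0"
  obtains g c where "content g = 1" "c \<noteq> 0" "[:c:] * g \<in> I" "\<And>p. p \<in> I \<Longrightarrow> g dvd p"
proof -
  define d where "d = (LEAST d. \<exists>p\<in>I. p \<noteq> 0 \<and> degree p = d)"
  have "\<exists>p\<in>I. p \<noteq> 0 \<and> degree p = d" unfolding d_def by (rule LeastI_ex) (use f in blast)
  then obtain p0 where p0: "p0 \<in> I" "p0 \<noteq> 0" "degree p0 = d" by blast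
  have min: "d \<le> degree p" if "p \<in> I" "p \<noteq> 0" for p
    unfolding d_def by (rule Least_le) (use that in blast)
  define g where "g = primitive_part p0"
  have g: "content g = 1" using p0 by (simp add: g_def)
  have p0_eq: "p0 = [:content p0:] * g" by (simp add: g_def)
  show ?thesis
  proof (rule that[OF g])
    show "content p0 \<noteq> 0" using p0 by simp
    show "[:content p0:] * g \<in> I" using p0(1) p0_eq by simp
    fix p assume p: "p \<in> I"
    obtain q r where qr: "pseudo_divmod p p0 = (q, r)" by fastforce
    define a where "a = lead_coeff p0 ^ (Suc (degree p) - degree p0)"
    have div: "Polynomial.smult a p = p0 * q + r" "r = 0 \<or> degree r < degree p0"
      using pseudo_divmod[OF p0(2) qr] by (auto simp: a_def)
    have "r = [:a:] * p - q * p0" using div(1) by (simp add: algebra_simps)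
    then have "r \<in> I" using diff[OF mult[OF p] mult[OF p0(1)]] by (simp only:)
    then have "r = 0" using min div(2) p0(3) by fastforce
    then have "Polynomial.smult a p = g * ([:content p0:] * q)"
      using div(1) p0_eq by (metis add.right_neutral mult.assoc mult.commute)
    moreover have "lead_coeff p0 \<noteq> 0" using p0(2) by (simp only: leading_coeff_0_iff not_False_eq_True)
    then have "a \<noteq> 0" unfolding a_def by (rule power_not_zero)
    ultimately show "g dvd p" using primitive_dvd_smult[OF g] by (metis dvd_triv_left)
  qed
qed

section \<open>Division by polynomials with all roots in the closed unit disc\<close>

text \<open>Division by a root in the disc multiplies the coefficient bound by at most
  \<open>n + 1\<close>, so after a fixed number of roots it is still polynomial in
  \<open>n\<close>.\<close>

lemma complex_division_unit_disc:
  fixes xs :: "complex list"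
  assumes "\<And>\<alpha>. \<alpha> \<in> set xs \<Longrightarrow> norm \<alpha> \<le> 1" "p \<in> complex_box n c" "c \<ge> 0"
  shows "\<exists>q r. p = (\<Prod>\<alpha>\<leftarrow>xs. [:- \<alpha>, 1:]) * q + r \<and> q \<in> complex_box n (c * real (n + 1) ^ length xs) \<and>
    r \<in> complex_box (length xs) (4 ^ length xs * (c * real (n + 1) ^ length xs))"
  using assms
proof (induction xs arbitrary: p c)
  case Nil
  then show ?case by (intro exI[of _ p] exI[of _ 0]) simp
next
  case (Cons \<alpha> xs)
  define k where "k = length xs"
  show ?case
  proof (cases "n = 0")
    case True
    then have "p = 0" using Cons.prems by (auto simp: complex_box_def poly_eq_iff)
    then show ?thesis using Cons.prems by (intro exI[of _ 0]) simp
  next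
    case False
    obtain p1 l where p1: "p = [:- \<alpha>, 1:] * p1 + monom l 0" "p1 \<in> complex_box (n - 1) (n * c)" "norm l \<le> n * c"
      using division_by_root[OF Cons.prems(2) _ Cons.prems(3), of \<alpha>] False Cons.prems(1) by auto
    have "complex_box (n - 1) (n * c) \<subseteq> complex_box n (real (n + 1) * c)"
      using Cons.prems(3) by (auto simp: complex_box_def distrib_right intro: order_trans)
    then have "p1 \<in> complex_box n (real (n + 1) * c)" using p1 by blast
    then obtain q r where qr: "p1 = (\<Prod>\<alpha>\<leftarrow>xs. [:- \<alpha>, 1:]) * q + r"
      "q \<in> complex_box n (real (n + 1) * c * real (n + 1) ^ k)" "r \<in> complex_box k (4 ^ k * (real (n + 1) * c * real (n + 1) ^ k))"
      using Cons.IH[of p1 "real (n + 1) * c"] Cons.prems unfolding k_def by auto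
    define b where "b = c * real (n + 1) ^ Suc k"
    have b: "real (n + 1) * c * real (n + 1) ^ k = b" by (simp add: b_def)
    have b0: "b \<ge> 0" using Cons.prems by (simp add: b_def)
    have "n * c \<le> b"
    proof -
      have "n * c \<le> real (n + 1) * c * 1" using Cons.prems(3) by (simp add: distrib_right)
      also have "\<dots> \<le> real (n + 1) * c * real (n + 1) ^ k"
        using Cons.prems(3) by (intro mult_left_mono one_le_power) auto
      finally show ?thesis unfolding b .
    qed
    have "[:- \<alpha>, 1:] * r \<in> complex_box (Suc k) ((1 + norm \<alpha>) * (4 ^ k * b))"
      using qr(3) b0 unfolding b by (intro complex_box_linear_mult) auto
    moreover have "monom l 0 \<in> complex_box (Suc k) b" using p1(3) \<open>n * c \<le> b\<close> by (intro complex_box_monom) auto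
    ultimately have r': "[:- \<alpha>, 1:] * r + monom l 0 \<in> complex_box (Suc k) ((1 + norm \<alpha>) * (4 ^ k * b) + b)"
      by (rule complex_box_add)
    \<comment> \<open>The left side is at most three times \<open>4 ^ k * b\<close>, which the base
      4 absorbs.\<close>
    have le: "(1 + norm \<alpha>) * (4 ^ k * b) + b \<le> 4 ^ Suc k * b"
    proof -
      define x where "x = 4 ^ k * b"
      have "1 * b \<le> x" unfolding x_def using b0 by (intro mult_right_mono) auto
      moreover have "(1 + norm \<alpha>) * x \<le> 2 * x"
        using Cons.prems(1)[of \<alpha>] b0 by (intro mult_right_mono) (auto simp: x_def)
      moreover have "4 ^ Suc k * b = 4 * x" by (simp add: x_def)
      ultimately show ?thesis using b0 unfolding x_def[symmetric] by linarith
    qed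
    have "[:- \<alpha>, 1:] * r + monom l 0 \<in> complex_box (Suc k) (4 ^ Suc k * b)"
      using r' le order_trans[OF _ le] unfolding complex_box_def by blast
    moreover have "p = (\<Prod>\<alpha>\<leftarrow>\<alpha> # xs. [:- \<alpha>, 1:]) * q + ([:- \<alpha>, 1:] * r + monom l 0)"
      unfolding p1(1) qr(1) by (simp only: list.map prod_list.Cons distrib_left mult.assoc add.assoc)
    moreover have len: "length (\<alpha> # xs) = Suc k" by (simp add: k_def)
    ultimately show ?thesis using qr(2) unfolding b len b_def[symmetric] by blast
  qed
qed

text \<open>With leading coefficient \<open>1\<close> or \<open>- 1\<close>, division with remainder
  works over the integers and is unique over the complex numbers, so the integral quotient and
  remainder inherit the complex bounds.\<close>

lemma int_division_unit_disc:
  fixes g :: "int poly"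
  assumes lc: "\<bar>lead_coeff g\<bar> = 1" and roots: "\<And>\<alpha>. poly (cpoly g) \<alpha> = 0 \<Longrightarrow> norm \<alpha> \<le> 1"
    and p: "p \<in> int_box n c"
  shows "\<exists>q r. p = g * q + r \<and> q \<in> int_box n (c * (n + 1) ^ degree g) \<and>
    r \<in> int_box (degree g) (4 ^ degree g * (c * (n + 1) ^ degree g))"
proof -
  have g0: "g \<noteq> 0" using lc by auto
  then have g': "cpoly g \<noteq> 0" by simp
  obtain xs where xs: "cpoly g = Polynomial.smult (lead_coeff (cpoly g)) (\<Prod>\<alpha>\<leftarrow>xs. [:- \<alpha>, 1:])"
    "mset xs = proots (cpoly g)" by (rule poly_roots_list[OF g'])
  define P where "P = (\<Prod>\<alpha>\<leftarrow>xs. [:- \<alpha>, 1:])"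
  define k where "k = degree g"
  define e where "e = lead_coeff g"
  have e: "e = 1 \<or> e = - 1" using lc unfolding e_def by linarith
  have deg: "degree (cpoly g) = k" by (simp add: degree_map_poly k_def)
  have "lead_coeff (cpoly g) = of_int e" unfolding deg by (simp add: k_def e_def)
  then have gP: "cpoly g = Polynomial.smult (of_int e) P" using xs(1) by (simp add: P_def)
  then have len: "length xs = k" using degree_linear_prod[of xs] deg e by (auto simp: P_def)
  have "norm \<alpha> \<le> 1" if "\<alpha> \<in> set xs" for \<alpha>
  proof -
    have "\<alpha> \<in># proots (cpoly g)" using that xs(2) by (metis set_mset_mset)
    then show ?thesis using roots g' by simp
  qed
  then obtain q r where qr: "cpoly p = P * q + r" "q \<in> complex_box n (c * real (n + 1) ^ k)"
    "r \<in> complex_box k (4 ^ k * (c * real (n + 1) ^ k))"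
    using complex_division_unit_disc[of xs "cpoly p" n "real c"] cpoly_in_complex_box[OF p] unfolding P_def len by auto
  obtain Q0 R0 where "pseudo_divmod p g = (Q0, R0)" by fastforce
  from pseudo_divmod[OF g0 this] have div: "Polynomial.smult (e ^ (Suc (degree p) - k)) p = g * Q0 + R0"
    "R0 = 0 \<or> degree R0 < k" by (auto simp: e_def k_def)
  \<comment> \<open>The pseudo-quotient is exact up to this factor, which is its own
    inverse.\<close>
  define u where "u = e ^ (Suc (degree p) - k)"
  have "u * u = 1" unfolding u_def using e by (auto simp flip: power_mult_distrib)
  define Q where "Q = Polynomial.smult u Q0"
  define R where "R = Polynomial.smult u R0"
  have "Polynomial.smult u (Polynomial.smult u p) = g * Q + R"
    using div(1) unfolding u_def[symmetric] by (simp add: Q_def R_def smult_add_right)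
  then have pQR: "p = g * Q + R" using \<open>u * u = 1\<close> by simp
  have R: "R = 0 \<or> degree R < k" using div(2) unfolding R_def by (auto intro: le_less_trans[OF degree_smult_le])
  have R0: "coeff R i = 0" if "i \<ge> k" for i using R that by (auto intro: coeff_eq_0)
  have cpQR: "cpoly p = P * Polynomial.smult (of_int e) (cpoly Q) + cpoly R"
  proof -
    have "cpoly (g * Q + R) = cpoly g * cpoly Q + cpoly R" unfolding cpoly_mult[symmetric] by (rule poly_eqI) simp
    then show ?thesis using pQR gP by simp
  qed
  have eq: "P * (Polynomial.smult (of_int e) (cpoly Q) - q) = r - cpoly R"
    using cpQR qr(1) by (simp add: algebra_simps)
  have P0: "P \<noteq> 0" using gP g' by auto
  have degP: "degree P = k" using degree_linear_prod[of xs] len by (simp add: P_def)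
  have "Polynomial.smult (of_int e) (cpoly Q) - q = 0"
  proof (rule ccontr)
    assume ne: "Polynomial.smult (of_int e) (cpoly Q) - q \<noteq> 0"
    then have "degree (P * (Polynomial.smult (of_int e) (cpoly Q) - q)) \<ge> k"
      using P0 degP by (simp add: degree_mult_eq)
    moreover have "P * (Polynomial.smult (of_int e) (cpoly Q) - q) \<noteq> 0" using ne P0 by simp
    moreover have "coeff (r - cpoly R) i = 0" if "i \<ge> k" for i using that R0 qr(3) by (simp add: complex_box_def)
    ultimately show False unfolding eq by (metis leading_coeff_0_iff)
  qed
  then have q: "q = Polynomial.smult (of_int e) (cpoly Q)" and r: "r = cpoly R" using eq by auto
  have "Q \<in> int_box n (c * (n + 1) ^ k)"
  proof (rule int_box_I)
    fix i
    show "coeff Q i = 0" if "i \<ge> n"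
      using that qr(2) e unfolding q by (auto simp: complex_box_def)
    have "norm (coeff q i) \<le> c * real (n + 1) ^ k" using qr(2) by (simp add: complex_box_def)
    moreover have "norm (coeff q i) = real_of_int \<bar>coeff Q i\<bar>" unfolding q using e by (auto simp: norm_mult)
    ultimately have "real_of_int \<bar>coeff Q i\<bar> \<le> real_of_int (int (c * (n + 1) ^ k))" by simp
    then show "\<bar>coeff Q i\<bar> \<le> int (c * (n + 1) ^ k)" by (simp only: of_int_le_iff)
  qed
  moreover have "R \<in> int_box k (4 ^ k * (c * (n + 1) ^ k))"
  proof (rule int_box_I)
    fix i
    show "coeff R i = 0" if "i \<ge> k" using R0 that .
    have "norm (coeff r i) \<le> 4 ^ k * (c * real (n + 1) ^ k)" using qr(3) by (simp add: complex_box_def)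
    then have "real_of_int \<bar>coeff R i\<bar> \<le> real_of_int (int (4 ^ k * (c * (n + 1) ^ k)))" unfolding r by simp
    then show "\<bar>coeff R i\<bar> \<le> int (4 ^ k * (c * (n + 1) ^ k))" by (simp only: of_int_le_iff)
  qed
  ultimately show ?thesis using pQR unfolding k_def by blast
qed

lemma card_int_box: "card (int_box n c) \<le> (2 * c + 1) ^ n"
proof -
  let ?L = "{xs. set xs \<subseteq> {- int c..int c} \<and> length xs = n}"
  have fin: "finite ?L" by (intro finite_lists_length_eq) simp
  have inj: "inj_on (\<lambda>p. map (coeff p) [0..<n]) (int_box n c)"
  proof (rule inj_onI)
    fix p q assume pq: "p \<in> int_box n c" "q \<in> int_box n c" "map (coeff p) [0..<n] = map (coeff q) [0..<n]"
    show "p = q"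
    proof (rule poly_eqI)
      fix i show "coeff p i = coeff q i" using pq by (cases "i < n") (auto simp: int_box_def)
    qed
  qed
  have sub: "(\<lambda>p. map (coeff p) [0..<n]) ` int_box n c \<subseteq> ?L"
  proof (clarify, intro conjI subsetI)
    fix p x assume p: "p \<in> int_box n c" and x: "x \<in> set (map (coeff p) [0..<n])"
    then obtain i where "x = coeff p i" by auto
    then show "x \<in> {- int c..int c}" using p by (auto simp: int_box_def abs_le_iff minus_le_iff)
  qed auto
  have "card (int_box n c) \<le> card ?L" using card_inj_on_le[OF inj sub fin] .
  also have "\<dots> = (2 * c + 1) ^ n" by (subst card_lists_length_eq) (simp_all add: nat_add_distrib nat_mult_distrib)
  finally show ?thesis .
qed

section \<open>Residues modulo a prime and a polynomial\<close>

text \<open>Modulo \<open>p\<close> the leading coefficient of \<open>u\<close> is invertible, so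
  \<open>u\<close> acts like a monic polynomial: Horner's scheme keeps the remainder below degree
  \<open>degree u\<close>, with coefficients reduced modulo \<open>p\<close>.\<close>

lemma finite_residues:
  fixes I :: "int poly set"
  assumes diff: "\<And>p q. p \<in> I \<Longrightarrow> q \<in> I \<Longrightarrow> p - q \<in> I" and mult: "\<And>p q. p \<in> I \<Longrightarrow> q * p \<in> I"
    and p: "[:int p:] \<in> I" "p > 0" and u: "u \<in> I" "coprime (lead_coeff u) (int p)"
  shows "\<exists>r\<in>int_box (degree u) p. q - r \<in> I"
proof (induction q)
  case 0
  have "0 - 0 \<in> I" using mult[OF u(1), of 0] by simp
  then show ?case by (intro bexI[of _ 0]) auto
next
  case (pCons a q)
  have add: "x + y \<in> I" if "x \<in> I" "y \<in> I" for x y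
    using diff[OF that(1) mult[OF that(2), of "- 1"]] by simp
  obtain r where r: "r \<in> int_box (degree u) p" "q - r \<in> I" using pCons by blast
  obtain w v where w: "w * lead_coeff u + v * int p = 1" using bezout_int[of "lead_coeff u" "int p"] u(2) by auto
  define d where "d = degree u"
  define X where "X = pCons a r"
  \<comment> \<open>Since \<open>w\<close> inverts the leading coefficient modulo \<open>p\<close>,
    this makes the coefficient in degree \<open>d\<close> divisible by \<open>p\<close>.\<close>
  define Y where "Y = X - [:coeff X d * w:] * u"
  define r' where "r' = map_poly (\<lambda>c. c mod int p) Y"
  have cr': "coeff r' i = coeff Y i mod int p" for i by (simp add: r'_def coeff_map_poly)
  have Y0: "coeff Y i = 0" if "i > d" for i
  proof -
    have "coeff X i = 0" using that r(1) unfolding X_def by (cases i) (auto simp: int_box_def d_def)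
    then show ?thesis using that by (simp add: Y_def d_def coeff_eq_0)
  qed
  have "coeff Y d = coeff X d * (1 - lead_coeff u * w)" by (simp add: Y_def d_def algebra_simps)
  moreover have "1 - lead_coeff u * w = v * int p" using w by (simp add: algebra_simps)
  ultimately have Yd: "coeff Y d mod int p = 0" by simp
  have "r' \<in> int_box d p"
  proof (rule int_box_I)
    fix i
    show "coeff r' i = 0" if "i \<ge> d" using that Y0 Yd by (cases "i = d") (auto simp: cr')
    show "\<bar>coeff r' i\<bar> \<le> int p"
    proof -
      have "0 \<le> coeff Y i mod int p" "coeff Y i mod int p < int p" using p(2) by simp_all
      then show ?thesis unfolding cr' by linarith
    qed
  qed
  moreover have "pCons a q - r' \<in> I"
  proof -
    have "[:int p:] dvd Y - r'" unfolding const_poly_dvd_iff by (simp add: cr' dvd_minus_mod)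
    then obtain s where s: "Y - r' = [:int p:] * s" by (elim dvdE)
    then have 1: "Y - r' \<in> I" using mult[OF p(1), of s] by (simp add: mult.commute)
    have 2: "[:coeff X d * w:] * u \<in> I" using mult u(1) by blast
    have "pCons a q - X = [:0, 1:] * (q - r)" by (simp add: X_def)
    then have 3: "pCons a q - X \<in> I" using mult r(2) by metis
    have "pCons a q - r' = (pCons a q - X) + [:coeff X d * w:] * u + (Y - r')" by (simp add: Y_def)
    then show ?thesis using add[OF add[OF 3 2] 1] by metis
  qed
  ultimately show ?case unfolding d_def by blast
qed

text \<open>From an element of least degree among those not divisible by \<open>p\<close>, a leading
  term divisible by \<open>p\<close> could be subtracted within the ideal, giving a smaller such
  element.\<close>

lemma ideal_lead_coeff_not_dvd:
  fixes I :: "int poly set"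
  assumes diff: "\<And>p q. p \<in> I \<Longrightarrow> q \<in> I \<Longrightarrow> p - q \<in> I" and mult: "\<And>p q. p \<in> I \<Longrightarrow> q * p \<in> I"
    and p: "[:p:] \<in> I" and q: "q \<in> I" "\<not> [:p:] dvd q"
  obtains u where "u \<in> I" "\<not> p dvd lead_coeff u"
proof -
  define d where "d = (LEAST d. \<exists>q\<in>I. \<not> [:p:] dvd q \<and> degree q = d)"
  have "\<exists>q\<in>I. \<not> [:p:] dvd q \<and> degree q = d" unfolding d_def by (rule LeastI_ex) (use q in blast)
  then obtain u where u: "u \<in> I" "\<not> [:p:] dvd u" "degree u = d" by blast
  have min: "d \<le> degree q" if "q \<in> I" "\<not> [:p:] dvd q" for q
    unfolding d_def by (rule Least_le) (use that in blast)
  have "\<not> p dvd lead_coeff u"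
  proof
    assume "p dvd lead_coeff u"
    then obtain a where a: "lead_coeff u = p * a" by (elim dvdE)
    define m where "m = monom a d * [:p:]"
    have m: "m \<in> I" unfolding m_def using mult p by blast
    have "[:p:] dvd m" by (simp only: m_def dvd_triv_right)
    then have u': "u - m \<in> I" "\<not> [:p:] dvd u - m"
      using diff[OF u(1) m] u(2) by (simp, metis diff_add_cancel dvd_add)
    have lead: "coeff (u - m) d = 0" using a u(3) by (simp add: m_def coeff_monom_mult mult.commute)
    have "degree (u - m) \<le> d"
      unfolding m_def using u(3) by (intro degree_diff_le) (auto simp: mult.commute smult_monom degree_monom_le)
    moreover have "u - m \<noteq> 0" using u'(2) by auto
    ultimately have "degree (u - m) < d" using lead by (metis leading_coeff_0_iff le_neq_implies_less)
    then show False using min[OF u'] by simp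
  qed
  then show ?thesis using that u by blast
qed

section \<open>Entropy of a one-generator extension\<close>

context int_poly_module
begin

lemma traj_Suc_left: "e \<in> F \<Longrightarrow> b \<in> traj F n \<Longrightarrow> e + monom 1 1 *s b \<in> traj F (Suc n)"
proof (induction n arbitrary: b)
  case 0
  have "e = 0 + monom 1 0 *s e" by simp
  then show ?case using 0 by (auto intro!: image_eqI[of _ _ "(0, e)"])
next
  case (Suc n)
  then obtain b' f where b: "b' \<in> traj F n" "f \<in> F" "b = b' + monom 1 n *s f" by auto
  have "e + monom 1 1 *s b = (e + monom 1 1 *s b') + monom 1 (Suc n) *s f"
    by (simp add: b scale_right_distrib mult_monom add.assoc)
  moreover have "(e + monom 1 1 *s b', f) \<in> traj F (Suc n) \<times> F" using Suc b by blast
  ultimately show ?case unfolding traj.simps(2)[of F "Suc n"]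
    by (intro image_eqI[of _ _ "(e + monom 1 1 *s b', f)"]) (simp_all only: case_prod_conv)
qed

text \<open>Horner evaluation of a trajectory point keeps a residue in \<open>R\<close> and emits one element of \<open>F\<close> per step.\<close>

lemma horner:
  assumes K: "subspace K" and R0: "0 \<in> R"
    and step: "\<And>r e. r \<in> R \<Longrightarrow> e \<in> E \<Longrightarrow> \<exists>r'\<in>R. \<exists>m\<in>F. monom 1 1 *s r + e - (r' + m) \<in> K"
  shows "x \<in> traj E n \<Longrightarrow> \<exists>r\<in>R. \<exists>m\<in>traj F n. x - (r + m) \<in> K"
proof (induction n arbitrary: x)
  case 0
  then show ?case using R0 K by (intro bexI[of _ 0]) (auto simp: subspace_0)
next
  case (Suc n)
  then have "x \<in> traj E (1 + n)" by simp
  from traj_add[OF this] obtain a b where ab: "a \<in> traj E 1" "b \<in> traj E n" "x = a + monom 1 1 *s b" by blast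
  then have a: "a \<in> E" by auto
  from Suc.IH[OF ab(2)] obtain r m where rm: "r \<in> R" "m \<in> traj F n" "b - (r + m) \<in> K" by blast
  from step[OF rm(1) a] obtain r' m' where rm': "r' \<in> R" "m' \<in> F" "monom 1 1 *s r + a - (r' + m') \<in> K" by blast
  have "x - (r' + (m' + monom 1 1 *s m)) = (monom 1 1 *s r + a - (r' + m')) + monom 1 1 *s (b - (r + m))"
    by (simp add: ab scale_right_distrib scale_right_diff_distrib algebra_simps)
  then have "x - (r' + (m' + monom 1 1 *s m)) \<in> K" using rm rm' K by (simp only: subspace_add subspace_scale)
  then show ?case using rm'(1) traj_Suc_left[OF rm'(2) rm(2)] by blast
qed

text \<open>The final residue takes at most \<open>card R\<close> values, a constant factor.\<close>

lemma entropy_horner: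
  assumes K: "subspace K" and E: "finite E" "E \<noteq> {}" and R: "finite R" "0 \<in> R" and F: "finite F"
    and step: "\<And>r e. r \<in> R \<Longrightarrow> e \<in> E \<Longrightarrow> \<exists>r'\<in>R. \<exists>m\<in>F. monom 1 1 *s r + e - (r' + m) \<in> K"
  shows "entropy K E \<le> entropy K F"
proof -
  have one: "(0::real) < 1" by simp
  have F0: "F \<noteq> {}" using step R(2) E(2) by fastforce
  have "real (residue_count K (traj E n)) * 1 ^ n \<le> real (card R) * real n ^ 0 * real (residue_count K (traj F (n + 0))) * 1 ^ n"
    if "n \<ge> 0" for n
  proof -
    have "residue_count K (traj E n) \<le> residue_count K R * residue_count K (traj F n)"
      by (rule residue_count_add_le[OF subspace_add_subgroup[OF K] R(1) finite_traj[OF F]]) (rule horner[OF K R(2) step])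
    also have "\<dots> \<le> card R * residue_count K (traj F n)" by (intro mult_right_mono residue_count_le_card R) simp
    finally show ?thesis by (simp add: of_nat_mono flip: of_nat_mult)
  qed
  then have "entropy K E + ln 1 \<le> entropy K F + ln 1"
    by (rule entropy_growth[OF K E F F0 one one])
  then show ?thesis by simp
qed

text \<open>The multiples of \<open>y\<close> have finitely many residues modulo \<open>M\<close>,
  so Horner's scheme runs on a finite state set: the new residue is chosen from \<open>R\<close>,
  and the emitted rest \<open>m r e\<close> lies in \<open>M\<close>. The count for \<open>E\<close>
  is then at most a constant times that for a finite subset of \<open>M\<close>.\<close>

lemma entropy_finite_residues:
  assumes K: "subspace K" and M: "subspace M" and h: "has_entropy K M h"
    and R: "finite R" "0 \<in> R" "\<And>q. \<exists>r\<in>R. (q - r) *s y \<in> M"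
    and E: "finite E" "E \<noteq> {}" "E \<subseteq> span (insert y M)"
  shows "entropy K E \<le> h"
proof -
  have "span M = M" using M by simp
  then have "E \<subseteq> {x. \<exists>k. x - k *s y \<in> M}" using E(3) unfolding span_insert by (simp only:)
  then have "\<forall>e\<in>E. \<exists>q. e - q *s y \<in> M" by blast
  then obtain q where q: "\<And>e. e \<in> E \<Longrightarrow> e - q e *s y \<in> M" by metis
  obtain \<rho> where \<rho>: "\<And>q. \<rho> q \<in> R" "\<And>q. (q - \<rho> q) *s y \<in> M" using R(3) by metis
  define m where "m r e = monom 1 1 *s (r *s y) + e - \<rho> (monom 1 1 * r + q e) *s y" for r e
  have mM: "m r e \<in> M" if "e \<in> E" for r e
  proof -
    have "m r e = (e - q e *s y) + ((monom 1 1 * r + q e) - \<rho> (monom 1 1 * r + q e)) *s y"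
      by (simp add: m_def scale_left_distrib scale_left_diff_distrib algebra_simps)
    then show ?thesis using q[OF that] \<rho>(2) M by (simp only: subspace_add)
  qed
  define F where "F = (\<lambda>(r, e). m r e) ` (R \<times> E)"
  have F: "finite F" "F \<subseteq> M" "F \<noteq> {}" unfolding F_def using R E mM by auto
  have "entropy K E \<le> entropy K F"
  proof (rule entropy_horner[OF K E(1,2) _ _ F(1)])
    show "finite ((\<lambda>r. r *s y) ` R)" "0 \<in> (\<lambda>r. r *s y) ` R" using R by (auto intro: image_eqI[of _ _ 0])
    fix x e assume x: "x \<in> (\<lambda>r. r *s y) ` R" and e: "e \<in> E"
    then obtain r where r: "r \<in> R" "x = r *s y" by auto
    have "monom 1 1 *s x + e - (\<rho> (monom 1 1 * r + q e) *s y + m r e) = 0" by (simp add: m_def r)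
    then have "monom 1 1 *s x + e - (\<rho> (monom 1 1 * r + q e) *s y + m r e) \<in> K" using K by (simp only: subspace_0)
    moreover have "m r e \<in> F" unfolding F_def using r e by auto
    moreover have "\<rho> (monom 1 1 * r + q e) *s y \<in> (\<lambda>r. r *s y) ` R" using \<rho>(1) by blast
    ultimately show "\<exists>r'\<in>(\<lambda>r. r *s y) ` R. \<exists>m\<in>F. monom 1 1 *s x + e - (r' + m) \<in> K" by blast
  qed
  also have "\<dots> \<le> h" using h F unfolding has_entropy_def by simp
  finally show ?thesis .
qed

text \<open>Polynomials incongruent modulo \<open>g\<close> give multiples of \<open>y\<close> that
  are distinct modulo \<open>M\<close>. The trajectory of \<open>F\<close> stays inside
  \<open>M\<close>, so the two counts multiply.\<close>

lemma entropy_gain: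
  assumes K: "subspace K" and M: "subspace M" "K \<subseteq> M" and F: "finite F" "F \<noteq> {}" "F \<subseteq> M"
    and g: "g \<noteq> 0" "\<And>q. q *s y \<in> M \<Longrightarrow> g dvd q"
  shows "\<exists>E. finite E \<and> E \<noteq> {} \<and> E \<subseteq> span (insert y M) \<and> entropy K F + ln (mahler g) \<le> entropy K E"
proof -
  obtain C n0 where res: "\<And>n. n \<ge> n0 \<Longrightarrow> \<exists>X \<subseteq> int_box n C. mahler g ^ n \<le> 2 ^ degree g * real (card X) \<and>
    (\<forall>x\<in>X. \<forall>x'\<in>X. g dvd x - x' \<longrightarrow> x = x')" using residue_count_lower[OF g(1)] by blast
  define A where "A = span_box {y} 1 C"
  define E where "E = {a + b |a b. a \<in> A \<and> b \<in> F}"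
  have A: "finite A" unfolding A_def by (simp add: finite_span_box)
  have "E = (\<lambda>(a, b). a + b) ` (A \<times> F)" unfolding E_def by auto
  then have Efin: "finite E" using A F by simp
  have "0 \<in> A" by (simp add: A_def)
  then have Ene: "E \<noteq> {}" unfolding E_def using F(2) by blast
  have AE: "A \<subseteq> span (insert y M)"
    using span_box_subset_span[of "{y}" 1 C] span_mono[of "{y}" "insert y M"] by (auto simp: A_def)
  have ME: "M \<subseteq> span (insert y M)" using span_superset by blast
  have Esub: "E \<subseteq> span (insert y M)" unfolding E_def using AE ME F(3) by (auto intro!: span_add)
  have le: "real (residue_count K (traj F n)) * mahler g ^ n \<le> 2 ^ degree g * real n ^ 0 * real (residue_count K (traj E (n + 0))) * 1 ^ n"
    if n: "n \<ge> n0" for n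
  proof -
    obtain X where X: "X \<subseteq> int_box n C" "mahler g ^ n \<le> 2 ^ degree g * real (card X)"
      "\<And>x x'. x \<in> X \<Longrightarrow> x' \<in> X \<Longrightarrow> g dvd x - x' \<Longrightarrow> x = x'" using res[OF n] by blast
    define Y where "Y = (\<lambda>x. x *s y) ` X"
    have "(\<lambda>x. x *s y) ` int_box n C \<subseteq> span_box {y} n C"
      using span_box_I[of "{y}" "\<lambda>_. x" n C for x] by auto
    then have Y: "Y \<subseteq> traj A n" unfolding Y_def A_def using X(1) span_box_subset_traj[of "{y}" n C] by blast
    have "inj_on (\<lambda>x. residue_class M (x *s y)) X"
    proof (rule inj_onI)
      fix x x' assume *: "x \<in> X" "x' \<in> X" "residue_class M (x *s y) = residue_class M (x' *s y)"
      then have "(x - x') *s y \<in> M"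
        using residue_class_eq_iff[OF subspace_add_subgroup[OF M(1)]] by (simp add: scale_left_diff_distrib)
      then show "x = x'" using g(2) X(3) * by blast
    qed
    then have "card X = residue_count M Y" unfolding residue_count_def Y_def image_image by (simp add: card_image)
    also have "\<dots> \<le> residue_count M (traj A n)" by (rule residue_count_subset[OF finite_traj[OF A] Y])
    finally have cX: "card X \<le> residue_count M (traj A n)" .
    have "residue_count M (traj A n) * residue_count K (traj F n) \<le> residue_count K (traj E n)"
    proof (rule residue_count_mult_le)
      show "traj F n \<subseteq> M" by (rule traj_subspace[OF M(1) F(3)])
      show "a + b \<in> traj E n" if "a \<in> traj A n" "b \<in> traj F n" for a b using that unfolding E_def traj_sum by blast
    qed (use K M Efin in \<open>auto intro: subspace_add_subgroup finite_traj\<close>)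
    then have "card X * residue_count K (traj F n) \<le> residue_count K (traj E n)" using cX by (meson le_trans mult_le_mono1)
    then have le: "real (card X) * real (residue_count K (traj F n)) \<le> real (residue_count K (traj E n))" by (simp flip: of_nat_mult)
    have "real (residue_count K (traj F n)) * mahler g ^ n \<le> real (residue_count K (traj F n)) * (2 ^ degree g * real (card X))"
      by (intro mult_left_mono X) simp
    also have "\<dots> = 2 ^ degree g * (real (card X) * real (residue_count K (traj F n)))" by simp
    also have "\<dots> \<le> 2 ^ degree g * real (residue_count K (traj E n))" by (intro mult_left_mono le) simp
    finally show ?thesis by simp
  qed
  have pos: "mahler g > 0" and one: "(0::real) < 1" using mahler_ge_1[OF g(1)] by simp_all
  have "entropy K F + ln (mahler g) \<le> entropy K E + ln 1"
    using le by (rule entropy_growth[OF K F(1,2) Efin Ene pos one])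
  then show ?thesis using Efin Ene Esub by auto
qed

text \<open>The coefficient of \<open>y\<close> is written as \<open>g * Q + R\<close>. Through
  \<open>g *s y\<close> the part with \<open>Q\<close> moves into \<open>span B\<close> modulo
  \<open>K\<close>, with coefficients of polynomial size, which \<open>robust\<close> absorbs. The
  part \<open>R\<close> has degree below \<open>degree g\<close> and takes polynomially many
  values.\<close>

lemma entropy_unit_disc:
  assumes K: "subspace K" and B: "finite B" and rob: "robust K B C"
    and g: "\<bar>lead_coeff g\<bar> = 1" "\<And>\<alpha>. poly (cpoly g) \<alpha> = 0 \<Longrightarrow> norm \<alpha> \<le> 1"
    and gy: "g *s y \<in> span (B \<union> K)"
    and F: "finite F" "F \<noteq> {}" "F \<subseteq> span (insert y (B \<union> K))"
  shows "entropy K F \<le> entropy K (span_box B 1 C)"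
proof -
  have "span (insert y (B \<union> K)) = span (({y} \<union> B) \<union> K)" by simp
  then have "\<forall>x\<in>F. \<exists>u\<in>span ({y} \<union> B). x - u \<in> K" using span_Un_subspace[OF K, of _ "{y} \<union> B"] F(3) by auto
  then obtain u where u: "\<And>x. x \<in> F \<Longrightarrow> u x \<in> span ({y} \<union> B)" "\<And>x. x \<in> F \<Longrightarrow> x - u x \<in> K" by metis
  have "\<forall>x\<in>F. \<exists>v w. v \<in> span {y} \<and> w \<in> span B \<and> u x = v + w" using u(1) unfolding span_Un by blast
  then obtain v w where vw: "\<And>x. x \<in> F \<Longrightarrow> v x \<in> span {y}" "\<And>x. x \<in> F \<Longrightarrow> w x \<in> span B"
    "\<And>x. x \<in> F \<Longrightarrow> u x = v x + w x" by metis
  obtain m1 c1 where mc1: "v ` F \<subseteq> span_box {y} m1 c1" using span_subset_span_box[of "{y}" "v ` F"] vw(1) F(1) by auto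
  obtain m2 c2 where mc2: "w ` F \<subseteq> span_box B m2 c2" using span_subset_span_box[OF B, of "w ` F"] vw(2) F(1) by auto
  obtain z where z: "z \<in> span B" "g *s y - z \<in> K" using span_Un_subspace[OF K gy] by blast
  obtain m3 c3 where mc3: "z \<in> span_box B m3 c3" using span_subset_span_box[OF B, of "{z}"] z(1) by auto
  define k where "k = degree g"
  define V where "V = span_box {y} m1 c1"
  define W where "W = span_box B m2 c2"
  define G where "G = {a + b |a b. a \<in> V \<and> b \<in> W}"
  have FG: "\<exists>f\<in>G. e - f \<in> K" if "e \<in> F" for e
  proof (rule bexI[of _ "u e"])
    show "e - u e \<in> K" by (rule u(2)[OF that])
    have "v e \<in> V" "w e \<in> W" using that mc1 mc2 unfolding V_def W_def by auto
    then show "u e \<in> G" unfolding G_def vw(3)[OF that] by blast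
  qed
  define m where "m = m1 + m2 + m3"
  \<comment> \<open>Adds up the coefficient bounds of \<open>q\<close> and \<open>Q *s z\<close>
    below, relative to \<open>n ^ (k + 2)\<close>; the final 1 makes it positive.\<close>
  define a where "a = c2 + (m1 + 1) * (c1 * (m1 + 2) ^ k) * c3 + 1"
  define r where "r = 4 ^ k * (c1 * (m1 + 2) ^ k)"
  have cover: "residue_count K (traj F n) \<le> real ((2 * r + 1) ^ k) * real n ^ ((k + 1) * k) * residue_count K (span_box B (n + m) (a * n ^ (k + 2)))"
    if n: "n \<ge> 1" for n
  proof -
    define b where "b = n * c1 * (n + m1 + 1) ^ k"
    define S where "S = span_box {y} k (4 ^ k * b)"
    have nm: "n + m1 + 1 \<le> (m1 + 2) * n"
    proof -
      have "m1 * 1 \<le> m1 * n" using n by (intro mult_left_mono) auto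
      then show ?thesis using n unfolding distrib_right by linarith
    qed
    have b_le: "b \<le> c1 * (m1 + 2) ^ k * n ^ (k + 1)"
    proof -
      have "b \<le> n * c1 * ((m1 + 2) * n) ^ k" unfolding b_def by (intro mult_left_mono power_mono nm) auto
      also have "\<dots> = c1 * (m1 + 2) ^ k * n ^ (k + 1)"
        by (simp only: power_mult_distrib power_add power_one_right mult_ac)
      finally show ?thesis .
    qed
    have cov: "\<exists>s\<in>S. \<exists>t\<in>span_box B (n + m) (a * n ^ (k + 2)). x - (s + t) \<in> K" if x: "x \<in> traj F n" for x
    proof -
      obtain x' where x': "x' \<in> traj G n" "x - x' \<in> K" using traj_cong[OF K FG x] by blast
      then obtain p q where pq: "p \<in> traj V n" "q \<in> traj W n" "x' = p + q" unfolding G_def traj_sum by blast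
      have "p \<in> span_box {y} (n + m1) (n * c1)" using traj_subset_span_box[of V "{y}" m1 c1 n] pq(1) unfolding V_def by blast
      then obtain P where P: "P \<in> int_box (n + m1) (n * c1)" "p = P *s y" by (auto elim!: span_box_E)
      have q: "q \<in> span_box B (n + m2) (n * c2)" using traj_subset_span_box[of W B m2 c2 n] pq(2) unfolding W_def by blast
      obtain Q R where QR: "P = g * Q + R" "Q \<in> int_box (n + m1) b" "R \<in> int_box k (4 ^ k * b)"
        using int_division_unit_disc[OF g P(1)] unfolding b_def k_def by (auto simp: mult.assoc)
      have "Q *s z \<in> span_box B ((n + m1) + m3) ((n + m1) * b * c3)" by (rule span_box_scale[OF QR(2) mc3])
      then have 1: "Q *s z \<in> span_box B (n + m) ((n + m1) * b * c3)"
        using span_box_mono[of "(n + m1) + m3" "n + m"] unfolding m_def by auto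
      have 2: "q \<in> span_box B (n + m) (n * c2)" using q span_box_mono[of "n + m2" "n + m"] unfolding m_def by auto
      have le: "n * c2 + (n + m1) * b * c3 \<le> a * n ^ (k + 2)"
      proof -
        have "n * c2 \<le> c2 * n ^ (k + 2)" using n by (simp add: power_increasing[of 1 "k + 2" n, simplified])
        moreover have "(n + m1) * b * c3 \<le> ((m1 + 1) * n) * (c1 * (m1 + 2) ^ k * n ^ (k + 1)) * c3"
        proof (intro mult_mono b_le)
          have "m1 * 1 \<le> m1 * n" using n by (intro mult_left_mono) auto
          then show "n + m1 \<le> (m1 + 1) * n" unfolding distrib_right by linarith
        qed auto
        moreover have "((m1 + 1) * n) * (c1 * (m1 + 2) ^ k * n ^ (k + 1)) * c3 =
          ((m1 + 1) * (c1 * (m1 + 2) ^ k) * c3) * n ^ (k + 2)"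
        proof -
          have "n ^ (k + 2) = n * n ^ (k + 1)" by simp
          then show ?thesis by (simp only: mult_ac)
        qed
        ultimately show ?thesis unfolding a_def distrib_right by linarith
      qed
      have "q + Q *s z \<in> span_box B (n + m) (a * n ^ (k + 2))"
        using span_box_add[OF 2 1] span_box_mono[OF order_refl le] by blast
      moreover have "R *s y \<in> S" unfolding S_def using span_box_I[of "{y}" "\<lambda>_. R"] QR(3) by auto
      moreover have "x - (R *s y + (q + Q *s z)) = (x - x') + Q *s (g *s y - z)"
        by (simp add: pq P(2) QR(1) scale_left_distrib scale_right_diff_distrib mult.commute algebra_simps)
      then have "x - (R *s y + (q + Q *s z)) \<in> K" using K x'(2) z(2) by (simp only: subspace_add subspace_scale)
      ultimately show ?thesis by blast
    qed
    have Sfin: "finite S" unfolding S_def by (simp add: finite_span_box)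
    have "residue_count K (traj F n) \<le> residue_count K S * residue_count K (span_box B (n + m) (a * n ^ (k + 2)))"
      by (rule residue_count_add_le[OF subspace_add_subgroup[OF K] Sfin finite_span_box[OF B] cov])
    also have "\<dots> \<le> (2 * r + 1) ^ k * n ^ ((k + 1) * k) * residue_count K (span_box B (n + m) (a * n ^ (k + 2)))"
    proof (rule mult_right_mono)
      have "S \<subseteq> (\<lambda>p. p *s y) ` int_box k (4 ^ k * b)" unfolding S_def by (auto elim!: span_box_E)
      then have "card S \<le> card (int_box k (4 ^ k * b))" by (rule surj_card_le[OF finite_int_box])
      then have "residue_count K S \<le> card (int_box k (4 ^ k * b))" using residue_count_le_card[OF Sfin, of K] by (rule order_trans[rotated])
      also have "\<dots> \<le> (2 * (4 ^ k * b) + 1) ^ k" by (rule card_int_box)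
      also have "\<dots> \<le> ((2 * r + 1) * n ^ (k + 1)) ^ k"
      proof (rule power_mono)
        have "4 ^ k * b \<le> r * n ^ (k + 1)" using b_le unfolding r_def by (simp add: mult.assoc)
        moreover have "1 \<le> n ^ (k + 1)" using n by (intro one_le_power)
        ultimately show "2 * (4 ^ k * b) + 1 \<le> (2 * r + 1) * n ^ (k + 1)" unfolding distrib_right by linarith
      qed simp
      also have "\<dots> = (2 * r + 1) ^ k * n ^ ((k + 1) * k)" by (simp only: power_mult_distrib power_mult)
      finally show "residue_count K S \<le> (2 * r + 1) ^ k * n ^ ((k + 1) * k)" .
    qed simp
    finally have "real (residue_count K (traj F n)) \<le> real ((2 * r + 1) ^ k * n ^ ((k + 1) * k) * residue_count K (span_box B (n + m) (a * n ^ (k + 2))))"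
      by (rule of_nat_mono)
    then show ?thesis by simp
  qed
  show ?thesis
    by (rule robust_entropy_le[OF K B rob F(1,2) cover]) (auto simp: a_def)
qed

section \<open>The gap dichotomy\<close>

text \<open>One polynomial kills all generators at once, because \<open>torsion_robust\<close>
  divides every coefficient by the same \<open>f\<close>.\<close>

definition fg_torsion :: "'v set \<Rightarrow> 'v set \<Rightarrow> bool" where
  "fg_torsion K M \<longleftrightarrow> (\<exists>B f. finite B \<and> f \<noteq> 0 \<and> (\<forall>b\<in>B. f *s b \<in> K) \<and> M = span (B \<union> K))"

text \<open>Attained maxima are unique, so this is a property of the extension alone; the dichotomy
  is the form in which gains compose along a chain.\<close>

definition gap :: "real \<Rightarrow> 'v set \<Rightarrow> 'v set \<Rightarrow> 'v set \<Rightarrow> bool" where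
  "gap \<delta> K M N \<longleftrightarrow> (\<forall>h h'. has_entropy K M h \<longrightarrow> has_entropy K N h' \<longrightarrow> h' \<le> h \<or> h + \<delta> \<le> h')"

lemma fg_torsionE:
  assumes "subspace K" "fg_torsion K M"
  obtains B C where "finite B" "M = span (B \<union> K)" "robust K B C" "has_entropy K M (entropy K (span_box B 1 C))"
  using assms torsion_robust fg_has_entropy unfolding fg_torsion_def by metis

lemma fg_torsion_subspace: "fg_torsion K M \<Longrightarrow> subspace M \<and> K \<subseteq> M"
  unfolding fg_torsion_def using span_superset by blast

lemma span_insert_span: "span (insert y (span S)) = span (insert y S)"
  unfolding span_insert by (simp add: span_span)

lemma span_insert_multiple: "span (insert z (span (insert (p *s z) M))) = span (insert z M)"
proof -
  have "span (insert z (span (insert (p *s z) M))) = span (insert (p *s z) (insert z M))"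
    unfolding span_insert_span by (simp only: insert_commute)
  also have "\<dots> = span (insert z M)"
  proof (rule antisym)
    have "p *s z \<in> span (insert z M)" by (intro span_scale span_base) simp
    then show "span (insert (p *s z) (insert z M)) \<subseteq> span (insert z M)"
      by (intro span_minimal) (auto intro: span_base)
    show "span (insert z M) \<subseteq> span (insert (p *s z) (insert z M))" by (rule span_mono) auto
  qed
  finally show ?thesis .
qed

lemma fg_torsion_insert:
  assumes K: "subspace K" and M: "fg_torsion K M" and f: "f \<noteq> 0" "f *s y \<in> K"
  shows "fg_torsion K (span (insert y M))"
proof -
  obtain B f' where B: "finite B" "f' \<noteq> 0" "\<And>b. b \<in> B \<Longrightarrow> f' *s b \<in> K" "M = span (B \<union> K)"
    using M unfolding fg_torsion_def by blast
  have "f * f' \<noteq> 0" using f B by simp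
  moreover have "(f * f') *s b \<in> K" if "b \<in> insert y B" for b
  proof (cases "b = y")
    case True
    then show ?thesis using subspace_scale[OF K f(2), of f'] by (simp add: mult.commute)
  next
    case False
    then show ?thesis using subspace_scale[OF K B(3), of b f] that by simp
  qed
  moreover have "span (insert y M) = span (insert y B \<union> K)" unfolding B(4) span_insert_span by simp
  ultimately show ?thesis unfolding fg_torsion_def using B(1) by blast
qed

lemma gap_no_gain:
  assumes "has_entropy K M h" "\<And>E. finite E \<Longrightarrow> E \<noteq> {} \<Longrightarrow> E \<subseteq> N \<Longrightarrow> entropy K E \<le> h"
  shows "gap \<delta> K M N"
proof -
  have "h2 \<le> h1" if 1: "has_entropy K M h1" and 2: "has_entropy K N h2" for h1 h2
  proof -
    have "h = h1" using has_entropy_mono[OF assms(1) 1 order_refl] has_entropy_mono[OF 1 assms(1) order_refl] by simp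
    moreover obtain E where "finite E" "E \<noteq> {}" "E \<subseteq> N" "entropy K E = h2" using 2 unfolding has_entropy_def by blast
    ultimately show ?thesis using assms(2) by blast
  qed
  then show ?thesis unfolding gap_def by blast
qed

lemma gap_gain:
  assumes K: "subspace K" and M: "subspace M" "K \<subseteq> M"
    and g: "g \<noteq> 0" "\<And>q. q *s y \<in> M \<Longrightarrow> g dvd q" "\<delta> \<le> ln (mahler g)"
  shows "gap \<delta> K M (span (insert y M))"
  unfolding gap_def
proof (intro allI impI disjI2)
  fix h h' assume h: "has_entropy K M h" and h': "has_entropy K (span (insert y M)) h'"
  obtain F where F: "finite F" "F \<noteq> {}" "F \<subseteq> M" "entropy K F = h" using h unfolding has_entropy_def by blast
  from entropy_gain[OF K M F(1-3) g(1,2)] obtain E where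
    "finite E" "E \<noteq> {}" "E \<subseteq> span (insert y M)" "entropy K F + ln (mahler g) \<le> entropy K E" by blast
  then show "h + \<delta> \<le> h'" using h' F(4) g(3) unfolding has_entropy_def by fastforce
qed

text \<open>Both gains are nonnegative by monotonicity, so a total gain below
  \<open>\<delta>\<close> forces each of them to vanish.\<close>

lemma gap_trans:
  assumes "gap \<delta> K M M'" "gap \<delta> K M' N" "M \<subseteq> M'" "M' \<subseteq> N" "has_entropy K M' h"
  shows "gap \<delta> K M N"
  unfolding gap_def
proof (intro allI impI)
  fix h1 h2 assume 1: "has_entropy K M h1" and 2: "has_entropy K N h2"
  have "h1 \<le> h" "h \<le> h2" using has_entropy_mono 1 2 assms(3-5) by blast+
  moreover have "h \<le> h1 \<or> h1 + \<delta> \<le> h" using assms(1,5) 1 unfolding gap_def by blast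
  moreover have "h2 \<le> h \<or> h + \<delta> \<le> h2" using assms(2,5) 2 unfolding gap_def by blast
  ultimately show "h2 \<le> h1 \<or> h1 + \<delta> \<le> h2" by linarith
qed

lemma mahler_const: "mahler [:c:] = \<bar>real_of_int c\<bar>"
proof -
  have "cpoly [:c:] = [:of_int c:]" by (rule poly_eqI) (simp add: coeff_pCons split: nat.splits)
  then show ?thesis by (simp add: mahler_def)
qed

text \<open>The polynomials taking \<open>z\<close> into \<open>M\<close> form an ideal containing
  \<open>p\<close>. If all of them are multiples of \<open>p\<close>, the gain is at least
  \<open>ln p\<close>. Otherwise the ideal is nonzero modulo \<open>p\<close>, the extension is
  finite and nothing is gained.\<close>

lemma gap_prime:
  assumes K: "subspace K" and M: "fg_torsion K M" and p: "prime p" "[:int p:] *s z \<in> M" and \<delta>: "\<delta> \<le> ln 2"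
  shows "gap \<delta> K M (span (insert z M))"
proof -
  have sM: "subspace M" "K \<subseteq> M" using fg_torsion_subspace[OF M] by auto
  define I where "I = {q. q *s z \<in> M}"
  have diff: "p - q \<in> I" if "p \<in> I" "q \<in> I" for p q
    using that sM by (simp add: I_def scale_left_diff_distrib subspace_diff)
  have mult: "q * p \<in> I" if "p \<in> I" for p q
    using that subspace_scale[OF sM(1), of "p *s z" q] by (simp add: I_def)
  show ?thesis
  proof (cases "\<forall>q\<in>I. [:int p:] dvd q")
    case True
    have "ln 2 \<le> ln (real p)" using prime_ge_2_nat[OF p(1)] by simp
    then have "\<delta> \<le> ln (mahler [:int p:])" using \<delta> by (simp add: mahler_const)
    then show ?thesis using True p(1) by (intro gap_gain[OF K sM, of "[:int p:]"]) (auto simp: I_def)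
  next
    case False
    then obtain q where q: "q \<in> I" "\<not> [:int p:] dvd q" by blast
    have pI: "[:int p:] \<in> I" using p(2) by (simp add: I_def)
    obtain u where u: "u \<in> I" "\<not> int p dvd lead_coeff u"
      using ideal_lead_coeff_not_dvd[of I "int p", OF diff mult pI q] by blast
    have "prime (int p)" using p(1) by simp
    then have cop: "coprime (lead_coeff u) (int p)" using u(2) by (simp add: prime_imp_coprime coprime_commute)
    obtain h where h: "has_entropy K M h" using fg_torsionE[OF K M] by metis
    show ?thesis
    proof (rule gap_no_gain[OF h])
      fix E assume E: "finite E" "E \<noteq> {}" "E \<subseteq> span (insert z M)"
      have "\<exists>r\<in>int_box (degree u) p. (q - r) *s z \<in> M" for q
        using finite_residues[of I p u q, OF diff mult pI _ u(1) cop] prime_gt_0_nat[OF p(1)] unfolding I_def by simp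
      then show "entropy K E \<le> h"
        by (intro entropy_finite_residues[OF K sM(1) h finite_int_box _ _ E]) auto
    qed
  qed
qed

text \<open>A prime factor is split off \<open>c\<close>: then \<open>p\<close> takes
  \<open>z'\<close> into \<open>M\<close>, and the smaller number \<open>c'\<close> takes
  \<open>z\<close> into \<open>M'\<close>.\<close>

lemma gap_torsion:
  assumes K: "subspace K" and \<delta>: "\<delta> \<le> ln 2"
  shows "fg_torsion K M \<Longrightarrow> c > 0 \<Longrightarrow> [:int c:] *s z \<in> M \<Longrightarrow> f \<noteq> 0 \<Longrightarrow> f *s z \<in> K \<Longrightarrow>
    gap \<delta> K M (span (insert z M))"
proof (induction c arbitrary: M rule: less_induct)
  case (less c)
  have sM: "subspace M" "K \<subseteq> M" using fg_torsion_subspace[OF less.prems(1)] by auto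
  show ?case
  proof (cases "c = 1")
    case True
    then have "z \<in> M" using less.prems(3) by (simp add: one_pCons[symmetric])
    then have "span (insert z M) = M" using sM(1) by (simp add: insert_absorb)
    then show ?thesis by (auto simp: gap_def intro: has_entropy_mono)
  next
    case False
    then obtain p where p: "prime p" "p dvd c" using prime_factor_nat by blast
    then obtain c' where c': "c = p * c'" by (elim dvdE)
    define z' where "z' = [:int c':] *s z"
    define M' where "M' = span (insert z' M)"
    have "c' > 0" "c' < c" using less.prems(2) p(1) prime_ge_2_nat[OF p(1)] by (auto simp: c')
    have "[:int p:] *s z' = [:int c:] *s z" by (simp add: z'_def c' mult.commute)
    then have 1: "gap \<delta> K M M'" unfolding M'_def using less.prems(3) by (intro gap_prime[OF K less.prems(1) p(1) _ \<delta>]) simp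
    have "f *s z' = [:int c':] *s (f *s z)" by (simp add: z'_def mult.commute)
    then have "f *s z' \<in> K" using less.prems(5) K by (simp only: subspace_scale)
    then have fg': "fg_torsion K M'" unfolding M'_def by (rule fg_torsion_insert[OF K less.prems(1,4)])
    have "z' \<in> M'" unfolding M'_def by (intro span_base) simp
    then have 2: "gap \<delta> K M' (span (insert z M'))"
      using less.IH[OF \<open>c' < c\<close> fg' \<open>c' > 0\<close> _ less.prems(4,5)] unfolding z'_def by simp
    have "span (insert z M') = span (insert z M)" unfolding M'_def z'_def by (rule span_insert_multiple)
    moreover obtain h where "has_entropy K M' h" using fg_torsionE[OF K fg'] by metis
    moreover have "M \<subseteq> M'" unfolding M'_def using span_superset by blast
    moreover have "M' \<subseteq> span (insert z M')" using span_superset by blast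
    ultimately show ?thesis using gap_trans[OF 1 2] by simp
  qed
qed

text \<open>With \<open>g\<close> and \<open>c\<close> from \<open>ideal_generator\<close>, the
  element \<open>g *s y\<close> is adjoined first; an integer takes it into \<open>M\<close>. After
  that, the polynomials taking \<open>y\<close> into the module are exactly the multiples of
  \<open>g\<close>.\<close>

lemma gap_insert:
  assumes K: "subspace K" and M: "fg_torsion K M" and f: "f \<noteq> 0" "f *s y \<in> K"
    and \<delta>: "\<delta> \<le> ln 2" "\<And>g. content g = 1 \<Longrightarrow> mahler g > 1 \<Longrightarrow> \<delta> \<le> ln (mahler g)"
  shows "gap \<delta> K M (span (insert y M))"
proof -
  have sM: "subspace M" "K \<subseteq> M" using fg_torsion_subspace[OF M] by auto
  define I where "I = {q. q *s y \<in> M}"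
  have diff: "p - q \<in> I" if "p \<in> I" "q \<in> I" for p q
    using that sM by (simp add: I_def scale_left_diff_distrib subspace_diff)
  have mult: "q * p \<in> I" if "p \<in> I" for p q
    using that subspace_scale[OF sM(1), of "p *s y" q] by (simp add: I_def)
  have "f \<in> I" using f(2) sM(2) by (auto simp: I_def)
  from ideal_generator[of I, OF diff mult this f(1)] obtain g c where
    gc: "content g = 1" "c \<noteq> 0" "[:c:] * g \<in> I" "\<And>p. p \<in> I \<Longrightarrow> g dvd p" by blast
  have g0: "g \<noteq> 0" using gc(1) by auto
  define z where "z = g *s y"
  define M' where "M' = span (insert z M)"
  have "f *s z = g *s (f *s y)" by (simp add: z_def mult.commute)
  then have fz: "f *s z \<in> K" using f(2) K by (simp only: subspace_scale)
  then have fg': "fg_torsion K M'" unfolding M'_def by (rule fg_torsion_insert[OF K M f(1)])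
  have sM': "subspace M'" "K \<subseteq> M'" using fg_torsion_subspace[OF fg'] by auto
  have cz: "[:int (nat \<bar>c\<bar>):] *s z \<in> M"
  proof -
    have "[:c:] *s z \<in> M" using gc(3) by (simp add: I_def z_def)
    moreover have "[:int (nat \<bar>c\<bar>):] *s z = [:sgn c:] *s ([:c:] *s z)"
    proof -
      have "int (nat \<bar>c\<bar>) = sgn c * c" by (simp add: sgn_if)
      then show ?thesis by (simp del: int_nat_eq add: mult.commute)
    qed
    ultimately show ?thesis using sM(1) by (simp only: subspace_scale)
  qed
  have 1: "gap \<delta> K M M'" unfolding M'_def
    by (rule gap_torsion[OF K \<delta>(1) M _ cz f(1) fz]) (use gc(2) in simp)
  have dvd: "g dvd q" if "q *s y \<in> M'" for q
  proof -
    have "span M = M" using sM(1) by simp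
    then have "q *s y \<in> {x. \<exists>k. x - k *s z \<in> M}" using that unfolding M'_def span_insert by (simp only:)
    then obtain s where "q *s y - s *s z \<in> M" by blast
    then have "q - s * g \<in> I" by (simp add: I_def z_def scale_left_diff_distrib)
    then have "g dvd q - s * g" by (rule gc(4))
    then show ?thesis by (metis diff_add_cancel dvd_add dvd_triv_right)
  qed
  have 2: "gap \<delta> K M' (span (insert y M'))"
  proof (cases "mahler g > 1")
    case True
    then show ?thesis by (intro gap_gain[OF K sM' g0 dvd] \<delta>(2) gc(1))
  next
    case False
    \<comment> \<open>Measure 1 forces leading coefficient \<open>1\<close> or \<open>- 1\<close>
      and all roots into the closed unit disc, as \<open>entropy_unit_disc\<close> demands.\<close>
    then have m1: "mahler g = 1" using mahler_ge_1[OF g0] by simp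
    have P: "1 \<le> (\<Prod>\<alpha>\<in>#proots (cpoly g). max 1 (norm \<alpha>))" by (rule prod_mset_max_ge_1)
    have L: "\<bar>lead_coeff g\<bar> \<ge> 1" using g0 by (simp add: int_one_le_iff_zero_less)
    have lc: "\<bar>lead_coeff g\<bar> = 1"
    proof (rule ccontr)
      assume "\<bar>lead_coeff g\<bar> \<noteq> 1"
      then have "2 \<le> \<bar>real_of_int (lead_coeff g)\<bar>" using L by linarith
      then have "2 * 1 \<le> mahler g" unfolding mahler_def using P by (intro mult_mono) auto
      then show False using m1 by simp
    qed
    have roots: "norm \<alpha> \<le> 1" if "poly (cpoly g) \<alpha> = 0" for \<alpha>
    proof -
      have "\<alpha> \<in># proots (cpoly g)" using that g0 by simp
      then obtain A where A: "proots (cpoly g) = add_mset \<alpha> A" by (metis insert_DiffM)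
      have "\<bar>real_of_int (lead_coeff g)\<bar> = 1" using lc by linarith
      then have "max 1 (norm \<alpha>) * (\<Prod>\<alpha>\<in>#A. max 1 (norm \<alpha>)) = 1" using m1 unfolding mahler_def A by simp
      moreover have "max 1 (norm \<alpha>) * 1 \<le> max 1 (norm \<alpha>) * (\<Prod>\<alpha>\<in>#A. max 1 (norm \<alpha>))"
        by (intro mult_left_mono prod_mset_max_ge_1) auto
      ultimately show ?thesis by simp
    qed
    obtain B C where BC: "finite B" "M' = span (B \<union> K)" "robust K B C" "has_entropy K M' (entropy K (span_box B 1 C))"
      using fg_torsionE[OF K fg'] by metis
    have gy: "g *s y \<in> span (B \<union> K)" unfolding BC(2)[symmetric] M'_def z_def by (intro span_base) simp
    show ?thesis
    proof (rule gap_no_gain[OF BC(4)])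
      fix E assume "finite E" "E \<noteq> {}" "E \<subseteq> span (insert y M')"
      then show "entropy K E \<le> entropy K (span_box B 1 C)"
        using entropy_unit_disc[OF K BC(1,3) lc roots gy] unfolding BC(2) span_insert_span by blast
    qed
  qed
  have "span (insert y M') = span (insert y M)" unfolding M'_def z_def by (rule span_insert_multiple)
  moreover obtain h where "has_entropy K M' h" using fg_torsionE[OF K fg'] by metis
  moreover have "M \<subseteq> M'" unfolding M'_def using span_superset by blast
  moreover have "M' \<subseteq> span (insert y M')" using span_superset by blast
  ultimately show ?thesis using gap_trans[OF 1 2] by simp
qed

end

section \<open>Transfer to abelian groups\<close>

lemma card_image_eq_kernel:
  assumes "\<And>x y. x \<in> S \<Longrightarrow> y \<in> S \<Longrightarrow> f x = f y \<longleftrightarrow> g x = g y"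
  shows "card (f ` S) = card (g ` S)"
proof -
  obtain S' where S': "S' \<subseteq> S" "inj_on f S'" "f ` S = f ` S'" by (meson subset_image_inj order_refl)
  have inj: "inj_on g S'" using S' assms unfolding inj_on_def by blast
  have "g ` S \<subseteq> g ` S'"
  proof
    fix y assume "y \<in> g ` S"
    then obtain x where x: "x \<in> S" "y = g x" by auto
    then have "f x \<in> f ` S'" using S'(3) by blast
    then obtain x' where "x' \<in> S'" "f x = f x'" by auto
    then show "y \<in> g ` S'" using assms[of x x'] x S'(1) by auto
  qed
  then have "g ` S = g ` S'" using S'(1) by blast
  then show ?thesis using S' inj by (simp add: card_image)
qed

text \<open>A surjection \<open>E\<close> that turns multiplication by \<open>t\<close> into
  \<open>\<phi>\<close>: the group with its endomorphism is the quotient by \<open>ker\<close>, and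
  its entropies can be computed in the module.\<close>

locale presented_group = int_poly_module scale + G: comm_group G
  for scale :: "int poly \<Rightarrow> 'v::ab_group_add \<Rightarrow> 'v" (infixr "*s" 75)
  and G (structure) +
  fixes \<phi> :: "'a \<Rightarrow> 'a" and E :: "'v \<Rightarrow> 'a"
  assumes E_add: "E (u + v) = E u \<otimes> E v"
    and E_step: "E (monom 1 1 *s v) = \<phi> (E v)"
    and E_surj: "range E = carrier G"
begin

definition ker :: "'v set" where
  "ker = {v. E v = \<one>}"

lemma E_closed [simp]: "E v \<in> carrier G"
  using E_surj by blast

lemma E_zero: "E 0 = \<one>"
proof -
  have "E 0 \<otimes> E 0 = E 0" using E_add[of 0 0] by simp
  then show ?thesis by (subst (asm) G.r_cancel_one) simp_all
qed

lemma E_eq_iff: "E u = E v \<longleftrightarrow> u - v \<in> ker"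
proof -
  have "E u = E (u - v) \<otimes> E v" using E_add[of "u - v" v] by simp
  then have "E u = E v \<longleftrightarrow> E (u - v) \<otimes> E v = E v" by (simp only:)
  also have "\<dots> \<longleftrightarrow> E (u - v) = \<one>" by (rule G.r_cancel_one) simp_all
  finally show ?thesis by (simp add: ker_def)
qed

text \<open>\<open>E\<close> is only known to respect sums and multiplication by \<open>t\<close>.
  Negatives come from \<open>E_eq_iff\<close>, integer multiples by induction, and polynomials by
  Horner's scheme.\<close>

lemma subspace_ker: "subspace ker"
proof (rule subspaceI)
  show "0 \<in> ker" by (simp add: ker_def E_zero)
  show add: "u + v \<in> ker" if "u \<in> ker" "v \<in> ker" for u v using that by (simp add: ker_def E_add)
  have minus: "- v \<in> ker" if "v \<in> ker" for v
    using that E_eq_iff[of 0 v] by (simp add: ker_def E_zero)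
  have const: "[:a:] *s v \<in> ker" if v: "v \<in> ker" for a v
  proof (induction a rule: int_induct[of _ 0])
    case base
    then show ?case using \<open>0 \<in> ker\<close> by simp
  next
    case (step1 i)
    have "[:i + 1:] = [:i:] + 1" by (simp add: one_pCons)
    then have "[:i + 1:] *s v = [:i:] *s v + v" by (simp only: scale_left_distrib scale_one)
    then show ?case using add step1 v by simp
  next
    case (step2 i)
    have "[:i - 1:] = [:i:] - 1" by (simp add: one_pCons)
    then have "[:i - 1:] *s v = [:i:] *s v + - v" by (simp only: scale_left_diff_distrib scale_one) simp
    then show ?case using add[OF step2(2) minus[OF v]] by simp
  qed
  fix p v assume v: "v \<in> ker"
  show "p *s v \<in> ker"
  proof (induction p)
    case 0
    then show ?case using \<open>0 \<in> ker\<close> by simp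
  next
    case (pCons a p)
    have "pCons a p = [:a:] + monom 1 1 * p" by (simp add: monom_altdef)
    then have "pCons a p *s v = [:a:] *s v + monom 1 1 *s (p *s v)" by (simp only: scale_left_distrib scale_scale)
    moreover have "monom 1 1 *s (p *s v) \<in> ker"
      using pCons(2) E_step[of "p *s v"] E_step[of 0] by (simp add: ker_def E_zero)
    ultimately show ?case using add const v by simp
  qed
qed

lemma E_funpow: "(\<phi> ^^ n) (E v) = E (monom 1 n *s v)"
proof (induction n)
  case (Suc n)
  have "monom 1 (Suc n) = monom 1 1 * (monom 1 n :: int poly)" by (simp add: mult_monom)
  then have "E (monom 1 (Suc n) *s v) = E (monom 1 1 *s (monom 1 n *s v))" by (simp only: scale_scale)
  then show ?case using Suc by (simp only: E_step funpow.simps o_apply)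
qed simp

lemma trajectory_eq: "trajectory G \<phi> (E ` F) n = E ` traj F n"
proof (induction n)
  case 0
  then show ?case by (simp add: E_zero)
next
  case (Suc n)
  have "trajectory G \<phi> (E ` F) (Suc n) = (E ` traj F n) <#> (\<phi> ^^ n) ` (E ` F)" using Suc by simp
  also have "(\<phi> ^^ n) ` (E ` F) = (\<lambda>v. E (monom 1 n *s v)) ` F" by (simp add: image_image E_funpow)
  also have "(E ` traj F n) <#> (\<lambda>v. E (monom 1 n *s v)) ` F = E ` traj F (Suc n)"
    by (auto simp: set_mult_def image_iff E_add) (use E_add in fastforce)+
  finally show ?case .
qed

lemma entropy_on_eq: "entropy_on G \<phi> (E ` F) = entropy ker F"
proof -
  have "card (E ` S) = residue_count ker S" for S
    unfolding residue_count_def using residue_class_eq_iff[OF subspace_add_subgroup[OF subspace_ker]] E_eq_iff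
    by (intro card_image_eq_kernel) simp
  then show ?thesis unfolding entropy_on_def entropy_def trajectory_eq by simp
qed

lemma finite_subsets_eq: "nonempty_finite_subsets G = (`) E ` {F. finite F \<and> F \<noteq> {}}"
proof
  show "nonempty_finite_subsets G \<subseteq> (`) E ` {F. finite F \<and> F \<noteq> {}}"
  proof
    fix X assume "X \<in> nonempty_finite_subsets G"
    then have X: "X \<subseteq> range E" "finite X" "X \<noteq> {}" unfolding nonempty_finite_subsets_def E_surj by auto
    then obtain F where "finite F" "X = E ` F" using finite_subset_image[OF X(2,1)] by blast
    then show "X \<in> (`) E ` {F. finite F \<and> F \<noteq> {}}" using X(3) by auto
  qed
  show "(`) E ` {F. finite F \<and> F \<noteq> {}} \<subseteq> nonempty_finite_subsets G"
    unfolding nonempty_finite_subsets_def by auto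
qed

lemma algebraic_entropy_eq:
  "algebraic_entropy G \<phi> = (SUP F\<in>{F. finite F \<and> F \<noteq> {}}. ereal (entropy ker F))"
  unfolding algebraic_entropy_def finite_subsets_eq image_image entropy_on_eq ..

lemma entropy_realizes_iff:
  "entropy_realizes G \<phi> \<longleftrightarrow>
    (\<exists>F. finite F \<and> F \<noteq> {} \<and> (\<forall>F'. finite F' \<longrightarrow> F' \<noteq> {} \<longrightarrow> entropy ker F' \<le> entropy ker F))"
proof
  assume "entropy_realizes G \<phi>"
  then obtain F where F: "finite F" "F \<noteq> {}" "algebraic_entropy G \<phi> = ereal (entropy ker F)"
    unfolding entropy_realizes_def finite_subsets_eq by (auto simp: entropy_on_eq)
  have "entropy ker F' \<le> entropy ker F" if "finite F'" "F' \<noteq> {}" for F'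
  proof -
    have "ereal (entropy ker F') \<le> algebraic_entropy G \<phi>"
      unfolding algebraic_entropy_eq by (rule SUP_upper) (use that in simp)
    then show ?thesis unfolding F(3) by simp
  qed
  then show "\<exists>F. finite F \<and> F \<noteq> {} \<and> (\<forall>F'. finite F' \<longrightarrow> F' \<noteq> {} \<longrightarrow> entropy ker F' \<le> entropy ker F)"
    using F by blast
next
  assume "\<exists>F. finite F \<and> F \<noteq> {} \<and> (\<forall>F'. finite F' \<longrightarrow> F' \<noteq> {} \<longrightarrow> entropy ker F' \<le> entropy ker F)"
  then obtain F where F: "finite F" "F \<noteq> {}" "\<And>F'. finite F' \<Longrightarrow> F' \<noteq> {} \<Longrightarrow> entropy ker F' \<le> entropy ker F" by blast
  have "algebraic_entropy G \<phi> = ereal (entropy ker F)"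
    unfolding algebraic_entropy_eq
    by (rule antisym, rule SUP_least) (use F in \<open>auto intro!: SUP_upper\<close>)
  then show "entropy_realizes G \<phi>"
    unfolding entropy_realizes_def finite_subsets_eq using F(1,2) by (auto simp: entropy_on_eq)
qed

end

section \<open>Finite entropy is attained below a Mahler gap\<close>

context int_poly_module
begin

lemma fg_torsion_span:
  assumes K: "subspace K" and B: "finite B" and tor: "\<And>v. \<exists>f. f \<noteq> 0 \<and> f *s v \<in> K"
  shows "fg_torsion K (span (B \<union> K))"
  using B
proof (induction B)
  case empty
  then show ?case unfolding fg_torsion_def by (intro exI[of _ "{}"] exI[of _ 1]) auto
next
  case (insert b B)
  obtain f where "f \<noteq> 0" "f *s b \<in> K" using tor by blast
  then have "fg_torsion K (span (insert b (span (B \<union> K))))" by (rule fg_torsion_insert[OF K insert.IH])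
  then show ?case unfolding span_insert_span by simp
qed

lemma gap_span:
  assumes K: "subspace K" and B: "finite B" and M: "fg_torsion K M"
    and tor: "\<And>v. \<exists>f. f \<noteq> 0 \<and> f *s v \<in> K"
    and \<delta>: "\<delta> \<le> ln 2" "\<And>g. content g = 1 \<Longrightarrow> mahler g > 1 \<Longrightarrow> \<delta> \<le> ln (mahler g)"
  shows "gap \<delta> K M (span (B \<union> M)) \<and> fg_torsion K (span (B \<union> M))"
  using B
proof (induction B)
  case empty
  have "span ({} \<union> M) = M" using fg_torsion_subspace[OF M] by simp
  moreover have "gap \<delta> K M M" unfolding gap_def using has_entropy_mono[OF _ _ order_refl] by blast
  ultimately show ?case using M by (simp only:)
next
  case (insert b B)
  define N where "N = span (B \<union> M)"
  have N: "gap \<delta> K M N" "fg_torsion K N" using insert.IH unfolding N_def by auto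
  obtain f where f: "f \<noteq> 0" "f *s b \<in> K" using tor by blast
  have eq: "span (insert b N) = span (insert b B \<union> M)" unfolding N_def span_insert_span by simp
  obtain h where "has_entropy K N h" using fg_torsionE[OF K N(2)] by metis
  moreover have "M \<subseteq> N" unfolding N_def using span_superset[of "B \<union> M"] by blast
  moreover have "N \<subseteq> span (insert b N)" using span_superset by blast
  ultimately have "gap \<delta> K M (span (insert b N))"
    using gap_trans[OF N(1) gap_insert[OF K N(2) f \<delta>]] by blast
  moreover have "fg_torsion K (span (insert b N))" by (rule fg_torsion_insert[OF K N(2) f])
  ultimately show ?case unfolding eq by blast
qed

text \<open>A non-torsion element generates a free module, whose entropy is infinite.\<close>

lemma bounded_entropy_torsion:
  assumes K: "subspace K" and bdd: "\<And>F. finite F \<Longrightarrow> F \<noteq> {} \<Longrightarrow> entropy K F \<le> H"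
  shows "\<exists>f. f \<noteq> 0 \<and> f *s v \<in> K"
proof (rule ccontr)
  assume no: "\<not> ?thesis"
  \<comment> \<open>The only polynomial taking \<open>v\<close> into \<open>K\<close> is 0, a
    multiple of every constant; \<open>c\<close> is chosen so that the gain \<open>ln c\<close>
    exceeds the room left below \<open>H\<close>.\<close>
  define c where "c = nat \<lceil>exp (H - entropy K {0})\<rceil> + 1"
  have c: "exp (H - entropy K {0}) < real c" unfolding c_def by linarith
  have "ln (real c) \<le> H - entropy K {0}"
  proof -
    have "c > 0" by (simp add: c_def)
    then have "[:int c:] \<noteq> 0" by simp
    moreover have "[:int c:] dvd q" if "q *s v \<in> K" for q
    proof -
      have "q = 0" using no that by blast
      then show ?thesis by simp
    qed
    ultimately obtain E where "finite E" "E \<noteq> {}" "entropy K {0} + ln (mahler [:int c:]) \<le> entropy K E"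
      using entropy_gain[OF K K order_refl, of "{0}" "[:int c:]" v] subspace_0[OF K] by auto
    then show ?thesis using bdd[of E] by (simp add: mahler_const)
  qed
  moreover have "H - entropy K {0} < ln (real c)"
  proof -
    have "0 < real c" using c exp_gt_zero[of "H - entropy K {0}"] by linarith
    then show ?thesis using c ln_less_cancel_iff[of "exp (H - entropy K {0})" "real c"] by simp
  qed
  ultimately show False by simp
qed

text \<open>A finite set with entropy within \<open>\<delta>\<close> of the supremum generates a
  module that has no room for a gain of \<open>\<delta>\<close>; by the dichotomy its finitely
  generated extensions gain nothing.\<close>

lemma bounded_entropy_attained:
  assumes K: "subspace K" and bdd: "\<And>F. finite F \<Longrightarrow> F \<noteq> {} \<Longrightarrow> entropy K F \<le> H"
    and \<delta>: "\<delta> > 0" "\<delta> \<le> ln 2" "\<And>g. content g = 1 \<Longrightarrow> mahler g > 1 \<Longrightarrow> \<delta> \<le> ln (mahler g)"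
  shows "\<exists>F. finite F \<and> F \<noteq> {} \<and> (\<forall>F'. finite F' \<longrightarrow> F' \<noteq> {} \<longrightarrow> entropy K F' \<le> entropy K F)"
proof -
  define S where "S = entropy K ` {F. finite F \<and> F \<noteq> {}}"
  define s where "s = Sup S"
  have ne: "S \<noteq> {}" unfolding S_def by auto
  have bS: "bdd_above S" unfolding S_def by (rule bdd_aboveI2[of _ _ H]) (use bdd in auto)
  have le_s: "entropy K F \<le> s" if "finite F" "F \<noteq> {}" for F
    unfolding s_def by (rule cSup_upper[OF _ bS]) (use that in \<open>auto simp: S_def\<close>)
  have "\<exists>x\<in>S. s - \<delta> < x" using \<delta>(1) less_cSup_iff[OF ne bS, of "s - \<delta>"] unfolding s_def by simp
  then obtain F0 where F0: "finite F0" "F0 \<noteq> {}" "s - \<delta> < entropy K F0" unfolding S_def by auto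
  note tor = bounded_entropy_torsion[OF K bdd]
  define M where "M = span (F0 \<union> K)"
  have M: "fg_torsion K M" unfolding M_def by (rule fg_torsion_span[OF K F0(1) tor])
  obtain h where h: "has_entropy K M h" using fg_torsionE[OF K M] by metis
  then obtain F where F: "finite F" "F \<noteq> {}" "entropy K F = h" unfolding has_entropy_def by blast
  have "F0 \<subseteq> M" unfolding M_def using span_superset by blast
  then have h0: "s - \<delta> < h" using h F0 unfolding has_entropy_def by fastforce
  have "entropy K F' \<le> h" if F': "finite F'" "F' \<noteq> {}" for F'
  proof -
    define N where "N = span (F' \<union> M)"
    have N: "gap \<delta> K M N" "fg_torsion K N" using gap_span[OF K F'(1) M tor \<delta>(2,3)] unfolding N_def by auto
    obtain h' where h': "has_entropy K N h'" using fg_torsionE[OF K N(2)] by metis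
    then obtain E where "finite E" "E \<noteq> {}" "entropy K E = h'" unfolding has_entropy_def by blast
    then have "h' \<le> s" using le_s by blast
    then have "h' \<le> h" using N(1) h h' h0 unfolding gap_def by fastforce
    moreover have "F' \<subseteq> N" unfolding N_def using span_superset[of "F' \<union> M"] by blast
    then have "entropy K F' \<le> h'" using h' F' unfolding has_entropy_def by blast
    ultimately show ?thesis by simp
  qed
  then show ?thesis using F by blast
qed

end

lemma log_mahler_measure_eq:
  assumes "g \<noteq> 0"
  shows "log_mahler_measure g = ln (mahler g)"
proof -
  have sum: "(\<Sum>\<alpha>\<in>#filter_mset (\<lambda>\<alpha>. norm \<alpha> > 1) A. ln (norm \<alpha>)) = ln (\<Prod>\<alpha>\<in>#A. max 1 (norm \<alpha>))"
    for A :: "complex multiset"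
  proof (induction A)
    case (add \<alpha> A)
    have "(\<Prod>\<alpha>\<in>#A. max 1 (norm \<alpha>)) > 0" using prod_mset_max_ge_1[of A] by linarith
    then show ?case using add by (cases "norm \<alpha> > 1") (auto simp: ln_mult max_def)
  qed simp
  have "\<bar>real_of_int (lead_coeff g)\<bar> > 0" using assms by simp
  moreover have "(\<Prod>\<alpha>\<in>#proots (cpoly g). max 1 (norm \<alpha>)) > 0"
    using prod_mset_max_ge_1[of "proots (cpoly g)"] by linarith
  ultimately show ?thesis unfolding log_mahler_measure_def mahler_def sum
    by (subst ln_mult_pos) auto
qed

section \<open>Every endomorphism of an abelian group comes from a free module\<close>

text \<open>Finitely supported functions form the free module with one basis element for each member
  of \<open>'k\<close>.\<close>

definition pm_scale :: "int poly \<Rightarrow> ('k \<Rightarrow>\<^sub>0 int poly) \<Rightarrow> 'k \<Rightarrow>\<^sub>0 int poly" where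
  "pm_scale p v = Poly_Mapping.map ((*) p) v"

lemma lookup_pm_scale [simp]: "Poly_Mapping.lookup (pm_scale p v) k = p * Poly_Mapping.lookup v k"
  unfolding pm_scale_def by transfer (auto simp: when_def)

lemma int_poly_module_pm: "int_poly_module pm_scale"
  by unfold_locales (auto intro!: poly_mapping_eqI simp: lookup_add distrib_left distrib_right mult.assoc)

locale group_endo = comm_group G for G (structure) +
  fixes \<phi> :: "'a \<Rightarrow> 'a"
  assumes hom: "\<phi> \<in> hom G G"
begin

lemma phi_closed [simp]: "x \<in> carrier G \<Longrightarrow> \<phi> x \<in> carrier G"
  using hom by (rule hom_in_carrier)

lemma phi_mult: "x \<in> carrier G \<Longrightarrow> y \<in> carrier G \<Longrightarrow> \<phi> (x \<otimes> y) = \<phi> x \<otimes> \<phi> y"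
  using hom by (rule hom_mult)

lemma phi_one [simp]: "\<phi> \<one> = \<one>"
  using hom by (rule hom_one) (rule group_axioms)+

text \<open>Horner evaluation of \<open>p\<close> at the endomorphism \<open>\<phi>\<close>, applied
  to \<open>x\<close>, in multiplicative notation.\<close>

definition act :: "int poly \<Rightarrow> 'a \<Rightarrow> 'a" where
  "act p x = foldr (\<lambda>a y. x [^] a \<otimes> \<phi> y) (coeffs p) \<one>"

lemma act_0 [simp]: "act 0 x = \<one>"
  by (simp add: act_def)

lemma act_pCons: "act (pCons a p) x = x [^] a \<otimes> \<phi> (act p x)"
  by (cases "a = 0 \<and> p = 0") (auto simp: act_def coeffs_pCons_eq_cCons cCons_def)

lemma act_closed [simp]: "x \<in> carrier G \<Longrightarrow> act p x \<in> carrier G"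
  by (induction p) (simp_all add: act_pCons)

lemma act_add: "x \<in> carrier G \<Longrightarrow> act (p + q) x = act p x \<otimes> act q x"
  by (induction p q rule: poly_induct2) (simp_all add: act_pCons phi_mult int_pow_mult m_ac)

lemma act_monom: "x \<in> carrier G \<Longrightarrow> act (monom 1 1 * p) x = \<phi> (act p x)"
  by (simp add: monom_altdef act_pCons)

lemma act_one: "x \<in> carrier G \<Longrightarrow> act 1 x = x"
  by (simp add: one_pCons act_pCons)

text \<open>With the default \<open>\<one>\<close>, basis elements outside the carrier go to the
  identity, so the free module on the whole type maps onto the group.\<close>

definition coord :: "('a \<Rightarrow>\<^sub>0 int poly) \<Rightarrow> 'a \<Rightarrow> 'a" where
  "coord v x = (if x \<in> carrier G then act (Poly_Mapping.lookup v x) x else \<one>)"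

definition eval_map :: "('a \<Rightarrow>\<^sub>0 int poly) \<Rightarrow> 'a" where
  "eval_map v = finprod G (coord v) (Poly_Mapping.keys v)"

lemma coord_closed [simp]: "coord v x \<in> carrier G"
  by (simp add: coord_def)

text \<open>Lets products over different supports be compared on a common finite set.\<close>

lemma eval_map_superset:
  assumes "finite X" "Poly_Mapping.keys v \<subseteq> X"
  shows "eval_map v = finprod G (coord v) X"
  unfolding eval_map_def
  by (rule finprod_mono_neutral_cong_left) (use assms in \<open>auto simp: coord_def in_keys_iff\<close>)

lemma phi_finprod: "finite X \<Longrightarrow> \<phi> (finprod G (coord v) X) = finprod G (\<lambda>x. \<phi> (coord v x)) X"
  by (induction X rule: finite_induct) (simp_all add: phi_mult Pi_def)

lemma presented: "presented_group pm_scale G \<phi> eval_map"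
proof -
  have closed: "eval_map v \<in> carrier G" for v unfolding eval_map_def by (intro finprod_closed) auto
  show ?thesis
  proof (intro presented_group.intro presented_group_axioms.intro int_poly_module_pm comm_group_axioms)
    fix u v :: "'a \<Rightarrow>\<^sub>0 int poly"
    define X where "X = Poly_Mapping.keys u \<union> Poly_Mapping.keys v"
    have X: "finite X" "Poly_Mapping.keys u \<subseteq> X" "Poly_Mapping.keys v \<subseteq> X" "Poly_Mapping.keys (u + v) \<subseteq> X"
      unfolding X_def using keys_add[of u v] by auto
    have "eval_map (u + v) = finprod G (\<lambda>x. coord u x \<otimes> coord v x) X"
      unfolding eval_map_superset[OF X(1,4)]
      by (rule finprod_cong') (auto simp: coord_def lookup_add act_add)
    then show "eval_map (u + v) = eval_map u \<otimes> eval_map v"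
      unfolding eval_map_superset[OF X(1,2)] eval_map_superset[OF X(1,3)] by simp
  next
    fix v :: "'a \<Rightarrow>\<^sub>0 int poly"
    have sub: "Poly_Mapping.keys (pm_scale (monom 1 1) v) \<subseteq> Poly_Mapping.keys v" by (auto simp: in_keys_iff)
    have "eval_map (pm_scale (monom 1 1) v) = finprod G (\<lambda>x. \<phi> (coord v x)) (Poly_Mapping.keys v)"
      unfolding eval_map_superset[OF finite_keys sub]
      by (rule finprod_cong') (auto simp: coord_def act_monom[unfolded One_nat_def])
    then show "eval_map (pm_scale (monom 1 1) v) = \<phi> (eval_map v)"
      unfolding eval_map_def by (simp add: phi_finprod)
  next
    show "range eval_map = carrier G"
    proof
      show "range eval_map \<subseteq> carrier G" using closed by auto
      show "carrier G \<subseteq> range eval_map"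
      proof
        fix x assume x: "x \<in> carrier G"
        have "eval_map (Poly_Mapping.single x 1) = x"
          using x by (simp add: eval_map_def coord_def act_one)
        then show "x \<in> range eval_map" by (metis rangeI)
      qed
    qed
  qed
qed

end

section \<open>From a positive infimum to the realization of finite entropy\<close>

lemma bdd_below_log_mahler:
  "bdd_below {log_mahler_measure f | f. primitive_poly f \<and> log_mahler_measure f > 0}"
  by (rule bdd_belowI[of _ 0]) auto

lemma realizes_of_lehmer_gap:
  assumes L: "lehmer_infimum > 0" and G: "comm_group G" "\<phi> \<in> hom G G" "algebraic_entropy G \<phi> < \<infinity>"
  shows "entropy_realizes G \<phi>"
proof -
  interpret group_endo G \<phi> using G by (simp add: group_endo_def group_endo_axioms_def)
  interpret presented_group pm_scale G \<phi> eval_map by (rule presented)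
  \<comment> \<open>Prime constants have measure at least \<open>ln 2\<close> but are not primitive,
    so \<open>lehmer_infimum\<close> says nothing about them.\<close>
  define \<delta> where "\<delta> = min (ln 2) lehmer_infimum"
  have "\<exists>H. algebraic_entropy G \<phi> \<le> ereal H" using G(3) by (cases "algebraic_entropy G \<phi>") auto
  then obtain H where H: "algebraic_entropy G \<phi> \<le> ereal H" by blast
  have bdd: "entropy ker F \<le> H" if "finite F" "F \<noteq> {}" for F
  proof -
    have "ereal (entropy ker F) \<le> algebraic_entropy G \<phi>"
      unfolding algebraic_entropy_eq by (rule SUP_upper) (use that in simp)
    also note H
    finally show ?thesis by simp
  qed
  have "\<delta> \<le> ln (mahler g)" if g: "content g = 1" "mahler g > 1" for g
  proof -
    have "log_mahler_measure g = ln (mahler g)" using g(1) by (intro log_mahler_measure_eq) auto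
    moreover have "ln (mahler g) > 0" using g(2) by simp
    ultimately have "lehmer_infimum \<le> ln (mahler g)" unfolding lehmer_infimum_def
      using g(1) by (intro cInf_lower[OF _ bdd_below_log_mahler]) (auto simp: primitive_poly_def intro!: exI[of _ g])
    then show ?thesis by (simp add: \<delta>_def)
  qed
  moreover have "\<delta> > 0" "\<delta> \<le> ln 2" using L by (auto simp: \<delta>_def)
  ultimately show ?thesis
    unfolding entropy_realizes_iff using bounded_entropy_attained[OF subspace_ker bdd] by blast
qed

section \<open>Polynomials of small Mahler measure\<close>

lemma mahler_mult:
  assumes "f \<noteq> 0" "g \<noteq> 0"
  shows "mahler (f * g) = mahler f * mahler g"
  unfolding mahler_def cpoly_mult using assms
  by (simp add: proots_mult lead_coeff_mult abs_mult)

lemma small_mahler_exists: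
  assumes L: "\<not> lehmer_infimum > 0" and \<epsilon>: "\<epsilon> > 0"
  shows "\<exists>f. content f = 1 \<and> 0 < ln (mahler f) \<and> ln (mahler f) < \<epsilon>"
proof -
  define S where "S = {log_mahler_measure f | f. primitive_poly f \<and> log_mahler_measure f > 0}"
  \<comment> \<open>This polynomial has measure \<open>ln 2\<close> and makes the set nonempty, so
    that a member near its infimum exists.\<close>
  have "cpoly [:- 2, 1:] = [:- 2, 1:]" by (rule poly_eqI) (simp add: coeff_pCons split: nat.splits)
  then have "mahler [:- 2, 1:] = 2" by (simp add: mahler_def)
  moreover have "content [:- 2, 1 :: int:] = 1" by (simp add: content_def)
  ultimately have "log_mahler_measure [:- 2, 1:] \<in> S"
    unfolding S_def using log_mahler_measure_eq[of "[:- 2, 1:]"]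
    by (auto simp: primitive_poly_def intro!: exI[of _ "[:- 2, 1:]"])
  then have ne: "S \<noteq> {}" by blast
  have "Inf S < \<epsilon>" using L \<epsilon> unfolding lehmer_infimum_def S_def by simp
  then obtain x where "x \<in> S" "x < \<epsilon>"
    using cInf_less_iff[OF ne] bdd_below_log_mahler unfolding S_def by blast
  then obtain f where f: "primitive_poly f" "log_mahler_measure f > 0" "log_mahler_measure f < \<epsilon>"
    unfolding S_def by blast
  then have "f \<noteq> 0" by (auto simp: primitive_poly_def)
  then show ?thesis using f log_mahler_measure_eq[of f] by (auto simp: primitive_poly_def)
qed

text \<open>At minimal degree a polynomial of small positive measure is squarefree and, up to sign, monic.\<close>

lemma small_mahler_squarefree:
  assumes L: "\<not> lehmer_infimum > 0" and \<epsilon>: "\<epsilon> > 0"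
  shows "\<exists>f. content f = 1 \<and> \<bar>lead_coeff f\<bar> = 1 \<and> rsquarefree (cpoly f) \<and> 0 < ln (mahler f) \<and> ln (mahler f) < \<epsilon>"
proof -
  \<comment> \<open>Measure below \<open>ln 2\<close> rules out leading coefficients other than
    \<open>1\<close> and \<open>- 1\<close>.\<close>
  define \<epsilon>' where "\<epsilon>' = min \<epsilon> (ln 2)"
  have \<epsilon>': "\<epsilon>' > 0" using \<epsilon> by (simp add: \<epsilon>'_def)
  define good where "good f \<longleftrightarrow> content f = 1 \<and> 0 < ln (mahler f) \<and> ln (mahler f) < \<epsilon>'" for f
  define d where "d = (LEAST d. \<exists>f. good f \<and> degree f = d)"
  have "\<exists>d f. good f \<and> degree f = d" using small_mahler_exists[OF L \<epsilon>'] unfolding good_def by blast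
  then have "\<exists>f. good f \<and> degree f = d" unfolding d_def by (rule LeastI_ex)
  then obtain f where f: "good f" "degree f = d" by blast
  have min: "d \<le> degree g" if "good g" for g unfolding d_def by (rule Least_le) (use that in blast)
  have f0: "f \<noteq> 0" using f(1) by (auto simp: good_def)
  have m2: "mahler f < 2"
  proof -
    have "ln (mahler f) < ln 2" using f(1) by (simp add: good_def \<epsilon>'_def)
    then show ?thesis using mahler_ge_1[OF f0] by simp
  qed
  have lc: "\<bar>lead_coeff f\<bar> = 1"
  proof (rule ccontr)
    assume "\<bar>lead_coeff f\<bar> \<noteq> 1"
    moreover have "lead_coeff f \<noteq> 0" using f0 by simp
    ultimately have "2 \<le> \<bar>real_of_int (lead_coeff f)\<bar>" by linarith
    then have "2 * 1 \<le> mahler f" unfolding mahler_def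
      by (intro mult_mono prod_mset_max_ge_1) auto
    then show False using m2 by simp
  qed
  have pd: "pderiv (cpoly p) = cpoly (pderiv p)" for p :: "int poly"
    by (rule poly_eqI) (simp add: coeff_pderiv)
  have "rsquarefree (cpoly f)" unfolding rsquarefree_roots
  proof (intro allI notI)
    fix \<alpha> assume \<alpha>: "poly (cpoly f) \<alpha> = 0 \<and> poly (pderiv (cpoly f)) \<alpha> = 0"
    \<comment> \<open>At a double root the minimal primitive polynomial \<open>g\<close> of
      \<open>\<alpha>\<close> divides \<open>f\<close> and its derivative, so both factors of
      \<open>f = g * h\<close> have smaller degree. By minimality each has measure 1, hence so does
      \<open>f\<close>.\<close>
    define I where "I = {p. poly (cpoly p) \<alpha> = 0}"
    have diff: "p - q \<in> I" if "p \<in> I" "q \<in> I" for p q using that by (simp add: I_def cpoly_diff)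
    have mult: "q * p \<in> I" if "p \<in> I" for p q using that by (simp add: I_def cpoly_mult)
    have "f \<in> I" using \<alpha> by (simp add: I_def)
    obtain g c where g: "content g = 1" "c \<noteq> 0" "[:c:] * g \<in> I" "\<And>p. p \<in> I \<Longrightarrow> g dvd p"
      using ideal_generator[of I f, OF diff mult \<open>f \<in> I\<close> f0] by blast
    obtain h where h: "f = g * h" using g(4)[OF \<open>f \<in> I\<close>] by (elim dvdE)
    have gh0: "g \<noteq> 0" "h \<noteq> 0" using f0 h by auto
    have ch: "content h = 1" using f(1) g(1) unfolding good_def h by (simp add: content_mult)
    have mah: "mahler f = mahler g * mahler h" unfolding h using gh0 by (rule mahler_mult)
    have ge: "mahler g \<ge> 1" "mahler h \<ge> 1" using mahler_ge_1 gh0 by auto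
    have degf: "degree f > 0"
    proof (rule ccontr)
      assume "\<not> degree f > 0"
      then obtain a where "f = [:a:]" by (auto elim: degree_eq_zeroE)
      moreover have "cpoly [:a:] = [:of_int a:]" by (rule poly_eqI) (simp add: coeff_pCons split: nat.splits)
      ultimately show False using \<alpha> f0 by simp
    qed
    have "pderiv f \<in> I" using \<alpha> by (simp add: I_def pd)
    then have "g dvd pderiv f" by (rule g(4))
    moreover have "pderiv f \<noteq> 0" using degf by (simp add: pderiv_eq_0_iff)
    ultimately have "degree g \<le> degree (pderiv f)" by (intro dvd_imp_degree_le)
    then have degg: "degree g < d" using degf f(2) by (simp add: degree_pderiv)
    have "degree g > 0"
    proof (rule ccontr)
      assume "\<not> degree g > 0"
      then obtain a where a: "g = [:a:]" by (auto elim: degree_eq_zeroE)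
      have "cpoly ([:c:] * [:a:]) = [:of_int c * of_int a:]" by (rule poly_eqI) (simp add: coeff_pCons split: nat.splits)
      then show False using g(2,3) gh0(1) unfolding a I_def by simp
    qed
    then have degh: "degree h < d" using h gh0 f(2) by (simp add: degree_mult_eq)
    have small: "mahler k = 1" if "content k = 1" "k \<noteq> 0" "degree k < d" "mahler k \<le> mahler f" for k
    proof (rule ccontr)
      assume "mahler k \<noteq> 1"
      then have "mahler k > 1" using mahler_ge_1[OF that(2)] by simp
      moreover from this have "ln (mahler k) \<le> ln (mahler f)" using that(4) by simp
      ultimately have "good k" using that(1) f(1) unfolding good_def by simp
      then show False using min that(3) by fastforce
    qed
    have le: "mahler g \<le> mahler f" "mahler h \<le> mahler f"
      unfolding mah using ge mult_left_mono[of 1 "mahler h" "mahler g"] mult_right_mono[of 1 "mahler g" "mahler h"] by auto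
    have "mahler g = 1" by (rule small[OF g(1) gh0(1) degg le(1)])
    moreover have "mahler h = 1" by (rule small[OF ch gh0(2) degh le(2)])
    ultimately have "mahler f = 1" using mah by simp
    then show False using f(1) by (simp add: good_def)
  qed
  then show ?thesis using f(1) lc unfolding good_def \<epsilon>'_def by auto
qed

section \<open>An upper bound for the number of residue classes\<close>

text \<open>Lagrange interpolation: the values at the roots determine the coefficients of a remainder.\<close>

lemma small_values_imp_zero:
  fixes Z :: "complex set"
  assumes Z: "finite Z"
  shows "\<exists>\<epsilon>>0. \<forall>s :: int poly. (\<forall>i\<ge>card Z. coeff s i = 0) \<longrightarrow> (\<forall>\<alpha>\<in>Z. norm (poly (cpoly s) \<alpha>) < \<epsilon>) \<longrightarrow> s = 0"
proof -
  define l where "l \<alpha> = Polynomial.smult (1 / (\<Prod>\<beta>\<in>Z - {\<alpha>}. \<alpha> - \<beta>)) (\<Prod>\<beta>\<in>Z - {\<alpha>}. [:- \<beta>, 1:])" for \<alpha>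
  have l1: "poly (l \<alpha>) \<alpha> = 1" if "\<alpha> \<in> Z" for \<alpha>
    using Z by (simp add: l_def poly_prod prod_zero_iff)
  have l0: "poly (l \<alpha>) \<beta> = 0" if "\<alpha> \<in> Z" "\<beta> \<in> Z" "\<alpha> \<noteq> \<beta>" for \<alpha> \<beta>
    using Z that by (simp add: l_def poly_prod)
  have ldeg: "degree (l \<alpha>) < card Z" if "\<alpha> \<in> Z" for \<alpha>
  proof -
    have "degree (l \<alpha>) \<le> degree (\<Prod>\<beta>\<in>Z - {\<alpha>}. [:- \<beta>, 1:])" unfolding l_def by (rule degree_smult_le)
    also have "\<dots> \<le> (\<Sum>\<beta>\<in>Z - {\<alpha>}. degree [:- \<beta>, 1:])" 
      using degree_prod_sum_le[of "Z - {\<alpha>}" "\<lambda>\<beta>. [:- \<beta>, 1:]"] Z by (simp add: o_def)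
    also have "\<dots> = card Z - 1" using Z that by simp
    also have "\<dots> < card Z" using Z that by (auto simp: card_gt_0_iff intro!: diff_less)
    finally show ?thesis .
  qed
  \<comment> \<open>Values below \<open>1 / (C + 1)\<close> interpolate to coefficients below 1 in
    absolute value, and these are integers.\<close>
  define C where "C = (\<Sum>\<alpha>\<in>Z. \<Sum>i<card Z. norm (coeff (l \<alpha>) i))"
  have C0: "C \<ge> 0" unfolding C_def by (intro sum_nonneg) auto
  have "s = 0" if s0: "\<And>i. i \<ge> card Z \<Longrightarrow> coeff s i = 0"
    and small: "\<And>\<alpha>. \<alpha> \<in> Z \<Longrightarrow> norm (poly (cpoly s) \<alpha>) < 1 / (C + 1)" for s :: "int poly"
  proof (rule ccontr)
    assume ne: "s \<noteq> 0"
    have deg_s: "degree (cpoly s) < card Z"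
      using s0[of "degree s"] ne by (metis degree_map_poly leading_coeff_0_iff linorder_not_less of_int_eq_0_iff)
    define r where "r = (\<Sum>\<alpha>\<in>Z. Polynomial.smult (poly (cpoly s) \<alpha>) (l \<alpha>))"
    have "cpoly s = r"
    proof (rule poly_eqI_degree[where A = Z])
      fix x assume x: "x \<in> Z"
      have "poly r x = (\<Sum>\<alpha>\<in>Z. if \<alpha> = x then poly (cpoly s) x else 0)"
        unfolding r_def poly_sum using x l0 l1 by (intro sum.cong) auto
      also have "\<dots> = poly (cpoly s) x" using Z x by simp
      finally show "poly (cpoly s) x = poly r x" by simp
    next
      show "degree (cpoly s) < card Z" by (rule deg_s)
      have "degree r \<le> card Z - 1" unfolding r_def
        by (intro degree_sum_le[OF Z]) (use ldeg in \<open>fastforce intro: order_trans[OF degree_smult_le]\<close>)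
      then show "degree r < card Z" using deg_s by linarith
    qed
    define j where "j = degree s"
    have j: "j < card Z" using deg_s by (simp add: j_def degree_map_poly)
    have "of_int (coeff s j) = (\<Sum>\<alpha>\<in>Z. poly (cpoly s) \<alpha> * coeff (l \<alpha>) j)"
    proof -
      have "of_int (coeff s j) = coeff r j" unfolding \<open>cpoly s = r\<close>[symmetric] by simp
      then show ?thesis by (simp add: r_def coeff_sum)
    qed
    then have "norm (of_int (coeff s j) :: complex) \<le> (\<Sum>\<alpha>\<in>Z. norm (poly (cpoly s) \<alpha>) * norm (coeff (l \<alpha>) j))"
      by (metis (mono_tags, lifting) norm_mult norm_sum sum.cong)
    also have "\<dots> \<le> (\<Sum>\<alpha>\<in>Z. 1 / (C + 1) * (\<Sum>i<card Z. norm (coeff (l \<alpha>) i)))"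
    proof (intro sum_mono mult_mono)
      fix \<alpha> assume "\<alpha> \<in> Z"
      then show "norm (poly (cpoly s) \<alpha>) \<le> 1 / (C + 1)" using small by fastforce
      show "norm (coeff (l \<alpha>) j) \<le> (\<Sum>i<card Z. norm (coeff (l \<alpha>) i))"
        using j by (intro member_le_sum) auto
    qed (use C0 in auto)
    also have "\<dots> = C / (C + 1)" by (simp add: C_def sum_divide_distrib)
    also have "\<dots> < 1" using C0 by simp
    finally have "\<bar>real_of_int (coeff s j)\<bar> < 1" by simp
    then have "coeff s j = 0" by linarith
    then show False using ne by (simp add: j_def)
  qed
  moreover have "1 / (C + 1) > 0" using C0 by simp
  ultimately show ?thesis by blast
qed

text \<open>Sharper than \<open>int_cells\<close>: equal labels give congruence modulo
  \<open>f\<close> with no remainder, at the price of an exponential number of cells. The rate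
  \<open>mahler f ^ 2\<close> comes from recording real and imaginary parts separately.\<close>

definition residue_cells :: "int poly \<Rightarrow> real \<Rightarrow> nat \<Rightarrow> bool" where
  "residue_cells f A d \<longleftrightarrow> A \<ge> 0 \<and> (\<forall>n c. n \<ge> 1 \<longrightarrow> c \<ge> 1 \<longrightarrow> (\<exists>\<kappa> :: int poly \<Rightarrow> complex \<Rightarrow> int \<times> int.
    finite (\<kappa> ` int_box n c) \<and> real (card (\<kappa> ` int_box n c)) \<le> (A * real c * real n) ^ d * (mahler f ^ 2) ^ n \<and>
    (\<forall>p\<in>int_box n c. \<forall>p'\<in>int_box n c. \<kappa> p = \<kappa> p' \<longrightarrow> f dvd p - p')))"

text \<open>A polynomial is recorded by its values at the roots of \<open>f\<close>, up to
  \<open>\<eta>\<close>. If two records agree, the remainder of the difference is tiny at all roots,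
  hence 0. Simple roots provide as many values as the remainder has coefficients.\<close>

lemma residue_cells_exist:
  fixes f :: "int poly"
  assumes lc: "\<bar>lead_coeff f\<bar> = 1" and sqf: "rsquarefree (cpoly f)"
  shows "\<exists>A d. residue_cells f A d"
proof -
  have f0: "f \<noteq> 0" using lc by auto
  then have f': "cpoly f \<noteq> 0" by simp
  define Z where "Z = {\<alpha>. poly (cpoly f) \<alpha> = 0}"
  have Z: "finite Z" unfolding Z_def by (rule poly_roots_finite[OF f'])
  have proots: "proots (cpoly f) = mset_set Z"
  proof (rule multiset_eqI)
    fix \<alpha> show "count (proots (cpoly f)) \<alpha> = count (mset_set Z) \<alpha>"
      using rsquarefree_root_order[OF sqf, of \<alpha>] f' Z
      by (cases "\<alpha> \<in> Z") (auto simp: Z_def order_root order_0I)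
  qed
  have "degree (cpoly f) = card Z" using size_proots_complex[of "cpoly f"] proots by simp
  then have card: "card Z = degree f" by (simp add: degree_map_poly)
  have "real_of_int \<bar>lead_coeff f\<bar> = 1" using lc by simp
  then have mah: "mahler f = (\<Prod>\<alpha>\<in>Z. max 1 (norm \<alpha>))"
    unfolding mahler_def proots by (simp add: prod_unfold_prod_mset)
  obtain \<epsilon> where \<epsilon>: "\<epsilon> > 0" "\<And>s :: int poly. (\<And>i. i \<ge> degree f \<Longrightarrow> coeff s i = 0) \<Longrightarrow>
    (\<And>\<alpha>. \<alpha> \<in> Z \<Longrightarrow> norm (poly (cpoly s) \<alpha>) < \<epsilon>) \<Longrightarrow> s = 0"
    using small_values_imp_zero[OF Z] unfolding card by blast
  \<comment> \<open>Real and imaginary part each err by at most \<open>\<eta>\<close>, so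
    \<open>2 * \<eta>\<close> must stay below \<open>\<epsilon>\<close>.\<close>
  define \<eta> where "\<eta> = min 1 (\<epsilon> / 3)"
  have \<eta>: "\<eta> > 0" "\<eta> \<le> 1" "2 * \<eta> < \<epsilon>" using \<epsilon>(1) by (auto simp: \<eta>_def)
  define \<kappa> where "\<kappa> p = restrict (\<lambda>\<alpha>. (\<lfloor>Re (poly (cpoly p) \<alpha>) / \<eta>\<rfloor>, \<lfloor>Im (poly (cpoly p) \<alpha>) / \<eta>\<rfloor>)) Z" for p
  have dvd: "f dvd p - p'" if eq: "\<kappa> p = \<kappa> p'" for p p'
  proof -
    obtain q s where qs: "pseudo_divmod (p - p') f = (q, s)" by fastforce
    define u where "u = lead_coeff f ^ (Suc (degree (p - p')) - degree f)"
    have "\<bar>u\<bar> = 1" unfolding u_def using lc by (simp add: power_abs)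
    have div: "Polynomial.smult u (p - p') = f * q + s" "s = 0 \<or> degree s < degree f"
      using pseudo_divmod[OF f0 qs] by (auto simp: u_def)
    have "s = 0"
    proof (rule \<epsilon>(2))
      show "coeff s i = 0" if "i \<ge> degree f" for i using that div(2) by (auto intro: coeff_eq_0)
      fix \<alpha> assume \<alpha>: "\<alpha> \<in> Z"
      define w where "w = poly (cpoly p) \<alpha> - poly (cpoly p') \<alpha>"
      have "s = Polynomial.smult u (p - p') - f * q" using div(1) by simp
      moreover have "cpoly (Polynomial.smult u (p - p')) = Polynomial.smult (of_int u) (cpoly p - cpoly p')"
        by (rule poly_eqI) simp
      ultimately have "cpoly s = Polynomial.smult (of_int u) (cpoly p - cpoly p') - cpoly f * cpoly q"
        by (simp only: cpoly_diff cpoly_mult)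
      then have "poly (cpoly s) \<alpha> = of_int u * w" using \<alpha> by (simp add: Z_def w_def)
      then have "norm (poly (cpoly s) \<alpha>) = norm w"
        using \<open>\<bar>u\<bar> = 1\<close> by (simp add: norm_mult) (metis of_int_1 of_int_abs)
      also have "norm w \<le> \<bar>Re w\<bar> + \<bar>Im w\<bar>" by (rule cmod_le)
      also have "\<dots> < \<epsilon>"
      proof -
        have "\<kappa> p \<alpha> = \<kappa> p' \<alpha>" using eq by simp
        then have fl: "\<lfloor>Re (poly (cpoly p) \<alpha>) / \<eta>\<rfloor> = \<lfloor>Re (poly (cpoly p') \<alpha>) / \<eta>\<rfloor>"
          "\<lfloor>Im (poly (cpoly p) \<alpha>) / \<eta>\<rfloor> = \<lfloor>Im (poly (cpoly p') \<alpha>) / \<eta>\<rfloor>" using \<alpha> by (auto simp: \<kappa>_def)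
        have close: "\<bar>x - y\<bar> \<le> \<eta>" if "\<lfloor>x / \<eta>\<rfloor> = \<lfloor>y / \<eta>\<rfloor>" for x y
        proof -
          have "\<bar>x / \<eta> - y / \<eta>\<bar> \<le> 1" using that by linarith
          then have "\<bar>(x - y) / \<eta>\<bar> \<le> 1" by (simp add: diff_divide_distrib)
          then show ?thesis using \<eta>(1) by (simp add: abs_divide)
        qed
        have "\<bar>Re w\<bar> \<le> \<eta>" "\<bar>Im w\<bar> \<le> \<eta>" unfolding w_def using close fl by auto
        then show ?thesis using \<eta>(3) by linarith
      qed
      finally show "norm (poly (cpoly s) \<alpha>) < \<epsilon>" .
    qed
    then have "Polynomial.smult u (p - p') = f * q" using div(1) by simp
    then have "p - p' = f * Polynomial.smult u q"
      using \<open>\<bar>u\<bar> = 1\<close> by (metis abs_mult_self_eq mult_1 mult_smult_right smult_1_left smult_smult)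
    then show ?thesis by (rule dvdI)
  qed
  \<comment> \<open>Each part has at most \<open>2 * N \<alpha> + 1\<close> possible values, and
    this is at most \<open>5 * (R \<alpha> / \<eta>)\<close> because
    \<open>R \<alpha> / \<eta> \<ge> 1\<close>.\<close>
  define A where "A = 5 / \<eta>"
  have count: "finite (\<kappa> ` int_box n c) \<and> real (card (\<kappa> ` int_box n c)) \<le> (A * real c * real n) ^ (2 * card Z) * (mahler f ^ 2) ^ n"
    if n: "n \<ge> 1" and c: "c \<ge> 1" for n c
  proof -
    define R where "R \<alpha> = c * n * max 1 (norm \<alpha>) ^ n" for \<alpha> :: complex
    define N where "N \<alpha> = \<lceil>R \<alpha> / \<eta>\<rceil>" for \<alpha> :: complex
    define P where "P = PiE Z (\<lambda>\<alpha>. {- N \<alpha>..N \<alpha>} \<times> {- N \<alpha>..N \<alpha>})"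
    have finP: "finite P" unfolding P_def using Z by (intro finite_PiE) auto
    have "c * n \<ge> 1" using n c by simp
    then have cn: "real (c * n) \<ge> 1" by linarith
    have R1: "R \<alpha> \<ge> 1" for \<alpha>
    proof -
      have "1 * 1 \<le> real (c * n) * max 1 (norm \<alpha>) ^ n" using cn by (intro mult_mono one_le_power) auto
      then show ?thesis by (simp add: R_def)
    qed
    have sub: "\<kappa> ` int_box n c \<subseteq> P"
    proof
      fix y assume "y \<in> \<kappa> ` int_box n c"
      then obtain p where p: "p \<in> int_box n c" "y = \<kappa> p" by auto
      have val: "norm (poly (cpoly p) \<alpha>) \<le> R \<alpha>" for \<alpha>
      proof -
        have "norm (poly (cpoly p) \<alpha>) \<le> c * (\<Sum>i<n. norm \<alpha> ^ i)"
          by (rule complex_box_norm_poly_le[OF cpoly_in_complex_box[OF p(1)]])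
        also have "\<dots> \<le> c * (\<Sum>i<n. max 1 (norm \<alpha>) ^ n)"
        proof (intro mult_left_mono sum_mono)
          fix i assume "i \<in> {..<n}"
          have "norm \<alpha> ^ i \<le> max 1 (norm \<alpha>) ^ i" by (intro power_mono) auto
          also have "\<dots> \<le> max 1 (norm \<alpha>) ^ n" using \<open>i \<in> {..<n}\<close> by (intro power_increasing) auto
          finally show "norm \<alpha> ^ i \<le> max 1 (norm \<alpha>) ^ n" .
        qed auto
        finally show ?thesis by (simp add: R_def)
      qed
      have fl: "\<lfloor>x / \<eta>\<rfloor> \<in> {- N \<alpha>..N \<alpha>}" if "\<bar>x\<bar> \<le> R \<alpha>" for x \<alpha>
      proof -
        have "\<bar>x / \<eta>\<bar> \<le> R \<alpha> / \<eta>" using that \<eta>(1) by (simp add: abs_divide divide_right_mono)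
        then have "x / \<eta> \<le> R \<alpha> / \<eta>" "- (R \<alpha> / \<eta>) \<le> x / \<eta>" by linarith+
        then show ?thesis unfolding N_def by (auto; linarith)
      qed
      show "y \<in> P" unfolding p(2) P_def \<kappa>_def
        using fl order_trans[OF abs_Re_le_cmod val] order_trans[OF abs_Im_le_cmod val] by auto
    qed
    have "card P = (\<Prod>\<alpha>\<in>Z. nat (2 * N \<alpha> + 1) * nat (2 * N \<alpha> + 1))"
      unfolding P_def using Z by (simp add: card_PiE card_cartesian_product)
    then have "real (card P) = (\<Prod>\<alpha>\<in>Z. real (nat (2 * N \<alpha> + 1)) * real (nat (2 * N \<alpha> + 1)))" by simp
    also have "\<dots> \<le> (\<Prod>\<alpha>\<in>Z. (A * R \<alpha>) * (A * R \<alpha>))"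
    proof (intro prod_mono conjI mult_mono)
      fix \<alpha>
      have "R \<alpha> / \<eta> \<ge> 1" using R1[of \<alpha>] \<eta> by (simp add: le_divide_eq)
      moreover have "real_of_int (N \<alpha>) \<le> R \<alpha> / \<eta> + 1" unfolding N_def by linarith
      moreover have "A * R \<alpha> = 5 * (R \<alpha> / \<eta>)" by (simp add: A_def)
      ultimately show "real (nat (2 * N \<alpha> + 1)) \<le> A * R \<alpha>" "real (nat (2 * N \<alpha> + 1)) \<le> A * R \<alpha>" "0 \<le> A * R \<alpha>" by linarith+
    qed auto
    also have "\<dots> = (\<Prod>\<alpha>\<in>Z. (A * real c * real n) ^ 2 * ((max 1 (norm \<alpha>)) ^ 2) ^ n)"
      by (intro prod.cong) (simp_all add: R_def power2_eq_square power_mult_distrib mult_ac)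
    also have "\<dots> = ((A * real c * real n) ^ 2) ^ card Z * (\<Prod>\<alpha>\<in>Z. ((max 1 (norm \<alpha>)) ^ 2) ^ n)"
      by (simp add: prod.distrib)
    also have "(\<Prod>\<alpha>\<in>Z. ((max 1 (norm \<alpha>)) ^ 2) ^ n) = (mahler f ^ 2) ^ n"
      unfolding mah by (simp only: prod_power_distrib)
    also have "((A * real c * real n) ^ 2) ^ card Z = (A * real c * real n) ^ (2 * card Z)" by (simp only: power_mult)
    finally have "real (card P) \<le> (A * real c * real n) ^ (2 * card Z) * (mahler f ^ 2) ^ n" .
    moreover have "card (\<kappa> ` int_box n c) \<le> card P" by (rule card_mono[OF finP sub])
    ultimately show ?thesis using finite_subset[OF sub finP] by linarith
  qed
  have "A \<ge> 0" using \<eta>(1) by (simp add: A_def)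
  then have "residue_cells f A (2 * card Z)" unfolding residue_cells_def using count dvd by blast
  then show ?thesis by blast
qed

section \<open>A direct sum whose entropy is not attained\<close>

text \<open>Serves as the free module of countable rank, the coefficient of degree \<open>i\<close>
  being coordinate \<open>i\<close>. The type is countable, so its quotients can be coded in any
  infinite type.\<close>

interpretation bipoly: int_poly_module "Polynomial.smult :: int poly \<Rightarrow> int poly poly \<Rightarrow> int poly poly"
  by unfold_locales (auto simp: smult_add_left smult_add_right)

lemma residue_count_le_card_labels:
  assumes K: "add_subgroup K" and S: "finite S" and L: "\<And>x y. x \<in> S \<Longrightarrow> y \<in> S \<Longrightarrow> L x = L y \<Longrightarrow> x - y \<in> K"
  shows "residue_count K S \<le> card (L ` S)"
proof -
  obtain S' where S': "S' \<subseteq> S" "inj_on (residue_class K) S'" "residue_class K ` S = residue_class K ` S'" by (meson subset_image_inj order_refl)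
  have "inj_on L S'"
  proof (rule inj_onI)
    fix x y assume xy: "x \<in> S'" "y \<in> S'" "L x = L y"
    then have "x - y \<in> K" using S'(1) by (intro L) auto
    then have "residue_class K x = residue_class K y" by (simp only: residue_class_eq_iff[OF K])
    then show "x = y" by (rule inj_onD[OF S'(2) _ xy(1,2)])
  qed
  then have "card (L ` S') = card (residue_class K ` S')" using S'(2) by (simp add: card_image)
  moreover have "card (L ` S') \<le> card (L ` S)" using S S'(1) by (intro card_mono image_mono) auto
  ultimately show ?thesis unfolding residue_count_def S'(3) by simp
qed

lemma int_box_finite_exists: "finite P \<Longrightarrow> \<exists>m c. c \<ge> 1 \<and> P \<subseteq> int_box m c"
proof (induction P rule: finite_induct)
  case (insert p P)
  then obtain m c where mc: "c \<ge> 1" "P \<subseteq> int_box m c" by blast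
  obtain m' c' where mc': "p \<in> int_box m' c'" using int_box_exists by blast
  have "P \<subseteq> int_box (m + m') (c + c')" using mc(2) int_box_mono[of m "m + m'" c "c + c'"] by auto
  moreover have "p \<in> int_box (m + m') (c + c')" using mc' int_box_mono[of m' "m + m'" c' "c + c'"] by auto
  ultimately show ?case using mc(1) by (intro exI[of _ "m + m'"] exI[of _ "c + c'"]) auto
qed auto

text \<open>The quotient by this submodule is the direct sum of the modules
  Z[t]/(\<open>f i\<close>).\<close>

definition coeff_ideal :: "(nat \<Rightarrow> int poly) \<Rightarrow> int poly poly set" where
  "coeff_ideal f = {v. \<forall>i. f i dvd coeff v i}"

lemma subspace_coeff_ideal: "bipoly.subspace (coeff_ideal f)"
  by (rule bipoly.subspaceI) (auto simp: coeff_ideal_def)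

text \<open>Only the first \<open>r\<close> summands are involved. The labels of their coordinates
  are chosen independently, so the bounds from \<open>residue_cells\<close> multiply.\<close>

lemma entropy_direct_sum_le:
  assumes f: "\<And>i. \<bar>lead_coeff (f i)\<bar> = 1" "\<And>i. rsquarefree (cpoly (f i))"
    and F: "finite F" "F \<noteq> {}" and r: "\<And>v i. v \<in> F \<Longrightarrow> i \<ge> r \<Longrightarrow> coeff v i = 0"
  shows "bipoly.entropy (coeff_ideal f) F \<le> ln (\<Prod>i<r. mahler (f i) ^ 2)"
proof -
  define K where "K = coeff_ideal f"
  have K: "bipoly.subspace K" unfolding K_def by (rule subspace_coeff_ideal)
  have f0: "f i \<noteq> 0" for i using f(1)[of i] by auto
  have "\<forall>i. \<exists>Ad. residue_cells (f i) (fst Ad) (snd Ad)" using residue_cells_exist[OF f] by simp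
  then obtain Ad where Ad: "\<And>i. residue_cells (f i) (fst (Ad i)) (snd (Ad i))" by metis
  define A where "A i = fst (Ad i)" for i
  define d where "d i = snd (Ad i)" for i
  have cells: "residue_cells (f i) (A i) (d i)" for i unfolding A_def d_def by (rule Ad)
  have A0: "A i \<ge> 0" for i using cells unfolding residue_cells_def by blast
  define P where "P = (\<lambda>(v, i). coeff v i) ` (F \<times> {..r})"
  have "finite P" unfolding P_def using F by simp
  then obtain m c where mc: "c \<ge> 1" "P \<subseteq> int_box m c" using int_box_finite_exists by blast
  have Fm: "coeff v i \<in> int_box m c" if "v \<in> F" for v i
  proof (cases "i \<le> r")
    case True
    then show ?thesis using that mc(2) unfolding P_def by auto
  next
    case False
    then show ?thesis using r that by simp
  qed
  have traj_box: "(\<forall>i\<ge>r. coeff v i = 0) \<and> (\<forall>i. coeff v i \<in> int_box (n + m) (n * c))" if "v \<in> bipoly.traj F n" for v n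
    using that
  proof (induction n arbitrary: v)
    case (Suc n)
    then obtain u w where uw: "u \<in> bipoly.traj F n" "w \<in> F" "v = u + Polynomial.smult (monom 1 n) w" by auto
    have "coeff v i \<in> int_box (Suc n + m) (Suc n * c)" for i
    proof -
      have "coeff u i \<in> int_box (Suc n + m) (n * c)" using Suc.IH[OF uw(1)] int_box_mono[of "n + m" "Suc n + m" "n * c" "n * c"] by auto
      moreover have "monom 1 n * coeff w i \<in> int_box (Suc n + m) c"
        using int_box_monom_mult[OF Fm[OF uw(2), of i], of n] int_box_mono[of "m + n" "Suc n + m" c c] by auto
      ultimately have "coeff u i + monom 1 n * coeff w i \<in> int_box (Suc n + m) (n * c + c)" by (rule int_box_add)
      then show ?thesis by (simp add: uw(3) add.commute)
    qed
    moreover have "coeff v i = 0" if "i \<ge> r" for i using that Suc.IH[OF uw(1)] r[OF uw(2)] by (simp add: uw(3))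
    ultimately show ?case by blast
  qed simp
  define C where "C = (\<Prod>i<r. (A i * real c * real (1 + m)) ^ d i * (mahler (f i) ^ 2) ^ m)"
  define M where "M = (\<Prod>i<r. mahler (f i) ^ 2)"
  have mah: "mahler (f i) \<ge> 1" for i by (rule mahler_ge_1[OF f0])
  have "real (residue_count K (bipoly.traj F n)) \<le> C * real n ^ (\<Sum>i<r. 2 * d i) * M ^ n" if n: "n \<ge> 1" for n
  proof -
    have nm: "n + m \<ge> 1" and nc: "n * c \<ge> 1" using n mc(1) by auto
    have "\<exists>\<kappa> :: int poly \<Rightarrow> complex \<Rightarrow> int \<times> int. finite (\<kappa> ` int_box (n + m) (n * c)) \<and>
      real (card (\<kappa> ` int_box (n + m) (n * c))) \<le> (A i * real (n * c) * real (n + m)) ^ d i * (mahler (f i) ^ 2) ^ (n + m) \<and>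
      (\<forall>p\<in>int_box (n + m) (n * c). \<forall>p'\<in>int_box (n + m) (n * c). \<kappa> p = \<kappa> p' \<longrightarrow> f i dvd p - p')" for i
      using cells[of i] nm nc unfolding residue_cells_def by blast
    then have "\<exists>\<kappa>. \<forall>i. finite (\<kappa> i ` int_box (n + m) (n * c)) \<and>
      real (card (\<kappa> i ` int_box (n + m) (n * c))) \<le> (A i * real (n * c) * real (n + m)) ^ d i * (mahler (f i) ^ 2) ^ (n + m) \<and>
      (\<forall>p\<in>int_box (n + m) (n * c). \<forall>p'\<in>int_box (n + m) (n * c). (\<kappa> i p :: complex \<Rightarrow> int \<times> int) = \<kappa> i p' \<longrightarrow> f i dvd p - p')"
      by (intro choice allI)
    then obtain \<kappa> :: "nat \<Rightarrow> int poly \<Rightarrow> complex \<Rightarrow> int \<times> int" where \<kappa>: "\<And>i. finite (\<kappa> i ` int_box (n + m) (n * c))"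
      "\<And>i. real (card (\<kappa> i ` int_box (n + m) (n * c))) \<le> (A i * real (n * c) * real (n + m)) ^ d i * (mahler (f i) ^ 2) ^ (n + m)"
      "\<And>i p p'. p \<in> int_box (n + m) (n * c) \<Longrightarrow> p' \<in> int_box (n + m) (n * c) \<Longrightarrow> \<kappa> i p = \<kappa> i p' \<Longrightarrow> f i dvd p - p'" by blast
    define L where "L v = restrict (\<lambda>i. \<kappa> i (coeff v i)) {..<r}" for v
    define Q where "Q = PiE {..<r} (\<lambda>i. \<kappa> i ` int_box (n + m) (n * c))"
    have finT: "finite (bipoly.traj F n)" by (rule bipoly.finite_traj[OF F(1)])
    have "residue_count K (bipoly.traj F n) \<le> card (L ` bipoly.traj F n)"
    proof (rule residue_count_le_card_labels[OF bipoly.subspace_add_subgroup[OF K] finT])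
      fix v w assume vw: "v \<in> bipoly.traj F n" "w \<in> bipoly.traj F n" "L v = L w"
      have "f i dvd coeff (v - w) i" for i
      proof (cases "i < r")
        case True
        have "L v i = L w i" using vw(3) by simp
        then have "\<kappa> i (coeff v i) = \<kappa> i (coeff w i)" using True by (simp add: L_def)
        then show ?thesis using \<kappa>(3) traj_box vw(1,2) by simp
      next
        case False
        then show ?thesis using traj_box[OF vw(1)] traj_box[OF vw(2)] by simp
      qed
      then show "v - w \<in> K" by (simp add: K_def coeff_ideal_def)
    qed
    also have "\<dots> \<le> card Q"
    proof (rule card_mono)
      show "finite Q" unfolding Q_def using \<kappa>(1) by (intro finite_PiE) auto
      show "L ` bipoly.traj F n \<subseteq> Q" unfolding Q_def L_def using traj_box by auto
    qed
    also have "card Q = (\<Prod>i<r. card (\<kappa> i ` int_box (n + m) (n * c)))" unfolding Q_def by (simp add: card_PiE)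
    finally have "real (residue_count K (bipoly.traj F n)) \<le> (\<Prod>i<r. real (card (\<kappa> i ` int_box (n + m) (n * c))))"
      by (metis of_nat_mono of_nat_prod)
    also have "\<dots> \<le> (\<Prod>i<r. ((A i * real c * real (1 + m)) ^ d i * (mahler (f i) ^ 2) ^ m) * real n ^ (2 * d i) * (mahler (f i) ^ 2) ^ n)"
    proof (intro prod_mono conjI)
      fix i
      have "m * 1 \<le> m * n" using n by (intro mult_left_mono) auto
      then have le: "n + m \<le> (1 + m) * n" unfolding distrib_right by linarith
      have "A i * real (n * c) * real (n + m) \<le> A i * real (n * c) * real ((1 + m) * n)"
        using A0[of i] le by (intro mult_left_mono of_nat_mono) auto
      also have "\<dots> = (A i * real c * real (1 + m)) * real n ^ 2" by (simp add: power2_eq_square algebra_simps)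
      finally have "(A i * real (n * c) * real (n + m)) ^ d i \<le> ((A i * real c * real (1 + m)) * real n ^ 2) ^ d i"
        using A0[of i] by (intro power_mono) auto
      then have "(A i * real (n * c) * real (n + m)) ^ d i * (mahler (f i) ^ 2) ^ (n + m) \<le>
        ((A i * real c * real (1 + m)) * real n ^ 2) ^ d i * (mahler (f i) ^ 2) ^ (n + m)"
        by (intro mult_right_mono) auto
      also have "\<dots> = ((A i * real c * real (1 + m)) ^ d i * (mahler (f i) ^ 2) ^ m) * real n ^ (2 * d i) * (mahler (f i) ^ 2) ^ n"
        unfolding power_mult[of _ 2 "d i"] by (simp only: power_mult_distrib power_add mult_ac)
      finally show "real (card (\<kappa> i ` int_box (n + m) (n * c))) \<le>
        ((A i * real c * real (1 + m)) ^ d i * (mahler (f i) ^ 2) ^ m) * real n ^ (2 * d i) * (mahler (f i) ^ 2) ^ n"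
        using \<kappa>(2)[of i] by linarith
    qed simp
    also have "\<dots> = C * real n ^ (\<Sum>i<r. 2 * d i) * M ^ n"
      unfolding C_def M_def by (simp only: prod.distrib power_sum prod_power_distrib)
    finally show ?thesis .
  qed
  moreover have "M > 0" unfolding M_def 
    by (intro prod_pos zero_less_power) (use mah in \<open>auto intro: less_le_trans[OF _ mah]\<close>)
  ultimately show ?thesis unfolding K_def M_def by (intro bipoly.entropy_growth_const[OF subspace_coeff_ideal F])
qed

text \<open>\<open>M\<close> consists of the elements whose coordinate \<open>r\<close> vanishes in
  the quotient, so it contains \<open>F\<close>. The generator \<open>monom 1 r\<close> of that
  summand is new, and only multiples of \<open>f r\<close> take it into \<open>M\<close>.\<close>

lemma entropy_direct_sum_increases:
  assumes f: "f r \<noteq> 0" "ln (mahler (f r)) > 0"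
    and F: "finite F" "F \<noteq> {}" "\<And>v. v \<in> F \<Longrightarrow> coeff v r = 0"
  shows "\<exists>E. finite E \<and> E \<noteq> {} \<and> bipoly.entropy (coeff_ideal f) F < bipoly.entropy (coeff_ideal f) E"
proof -
  define M where "M = {v :: int poly poly. f r dvd coeff v r}"
  have "bipoly.subspace M" by (rule bipoly.subspaceI) (auto simp: M_def)
  moreover have "coeff_ideal f \<subseteq> M" by (auto simp: M_def coeff_ideal_def)
  moreover have "F \<subseteq> M" using F(3) by (auto simp: M_def)
  moreover have "f r dvd q" if "Polynomial.smult q (monom 1 r) \<in> M" for q using that by (simp add: M_def)
  ultimately obtain E where "finite E" "E \<noteq> {}"
    "bipoly.entropy (coeff_ideal f) F + ln (mahler (f r)) \<le> bipoly.entropy (coeff_ideal f) E"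
    using bipoly.entropy_gain[OF subspace_coeff_ideal, of M f F "f r" "monom 1 r"] F f(1) by auto
  then show ?thesis using f(2) by (intro exI[of _ E]) auto
qed

text \<open>The quotient by \<open>K\<close> is countable, so it can be carried by a subset of any infinite type.\<close>

lemma quotient_presentation:
  assumes inf: "infinite (UNIV :: 'a set)" and K: "bipoly.subspace K"
  shows "\<exists>(G :: 'a monoid) \<phi> E. comm_group G \<and> \<phi> \<in> hom G G \<and>
    presented_group Polynomial.smult G \<phi> E \<and> {v. E v = \<one>\<^bsub>G\<^esub>} = K"
proof -
  note subgrp = bipoly.subspace_add_subgroup[OF K]
  obtain \<iota> :: "nat \<Rightarrow> 'a" where \<iota>: "inj \<iota>" using infinite_countable_subset[OF inf] by blast
  define J where "J v = \<iota> (to_nat (map coeffs (coeffs v)))" for v :: "int poly poly"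
  have "inj (map coeffs :: int poly list \<Rightarrow> int list list)"
    by (rule inj_mapI) (simp add: inj_def coeffs_eq_iff)
  then have J: "J u = J v \<longleftrightarrow> u = v" for u v
    unfolding J_def using \<iota> by (auto simp: inj_eq coeffs_eq_iff dest!: injD)
  \<comment> \<open>Each coset is coded by one chosen representative; \<open>D\<close> below
    recovers a representative from the code.\<close>
  define E where "E v = J (SOME w. w \<in> residue_class K v)" for v
  have E_iff: "E u = E v \<longleftrightarrow> u - v \<in> K" for u v
  proof
    have mem: "(SOME w. w \<in> residue_class K v) \<in> residue_class K v" for v
      by (rule someI[of _ v]) (simp add: residue_class_def bipoly.subspace_0[OF K])
    assume "E u = E v"
    then have eq: "(SOME w. w \<in> residue_class K u) = (SOME w. w \<in> residue_class K v)" unfolding E_def J .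
    define w where "w = (SOME w. w \<in> residue_class K u)"
    have "w - u \<in> K" "w - v \<in> K" using mem[of u] mem[of v] unfolding eq[symmetric] w_def[symmetric] by (auto simp: residue_class_def)
    then have "(w - v) - (w - u) \<in> K" by (rule add_subgroupD(2)[OF subgrp, rotated])
    then show "u - v \<in> K" by simp
  next
    assume "u - v \<in> K"
    then show "E u = E v" unfolding E_def using residue_class_eq_iff[OF subgrp] by metis
  qed
  define D where "D a = (SOME v. E v = a)" for a
  have ED: "E (D (E v)) = E v" for v unfolding D_def by (rule someI_ex) blast
  have DK: "D (E v) - v \<in> K" for v using ED E_iff by blast
  define G :: "'a monoid" where "G = \<lparr>carrier = range E, monoid.mult = (\<lambda>a b. E (D a + D b)), one = E 0\<rparr>"
  define \<phi> where "\<phi> a = E (Polynomial.smult (monom 1 1) (D a))" for a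
  have Gc: "carrier G = range E" and G1: "\<one>\<^bsub>G\<^esub> = E 0" by (auto simp: G_def)
  have add: "E u \<otimes>\<^bsub>G\<^esub> E v = E (u + v)" for u v
  proof -
    have "(D (E u) - u) + (D (E v) - v) \<in> K" by (rule bipoly.subspace_add[OF K DK DK])
    then have "E (D (E u) + D (E v)) = E (u + v)" unfolding E_iff by (simp add: algebra_simps)
    then show ?thesis by (simp add: G_def)
  qed
  have step: "\<phi> (E v) = E (Polynomial.smult (monom 1 1) v)" for v
  proof -
    have "Polynomial.smult (monom 1 1) (D (E v) - v) \<in> K" by (rule bipoly.subspace_scale[OF K DK])
    then show ?thesis unfolding \<phi>_def E_iff by (simp add: smult_diff_right)
  qed
  have grp: "comm_group G"
  proof (rule comm_groupI)
    fix x assume "x \<in> carrier G"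
    then obtain v where v: "x = E v" unfolding Gc by auto
    then have "E (- v) \<in> carrier G \<and> E (- v) \<otimes>\<^bsub>G\<^esub> x = \<one>\<^bsub>G\<^esub>" by (simp add: add G1 Gc)
    then show "\<exists>y\<in>carrier G. y \<otimes>\<^bsub>G\<^esub> x = \<one>\<^bsub>G\<^esub>" by blast
  qed (auto simp: Gc G1 add add_ac)
  have "\<phi> \<in> hom G G"
    by (rule homI) (auto simp: Gc add step smult_add_right)
  moreover have "presented_group Polynomial.smult G \<phi> E"
    by (intro presented_group.intro presented_group_axioms.intro bipoly.int_poly_module_axioms grp)
      (auto simp: add step Gc)
  moreover have "{v. E v = \<one>\<^bsub>G\<^esub>} = K" by (auto simp: G1 E_iff)
  ultimately show ?thesis using grp by blast
qed

lemma not_realizes_of_no_lehmer_gap: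
  assumes inf: "infinite (UNIV :: 'a set)" and L: "\<not> lehmer_infimum > 0"
  shows "\<exists>(G :: 'a monoid) \<phi>. comm_group G \<and> \<phi> \<in> hom G G \<and> algebraic_entropy G \<phi> < \<infinity> \<and> \<not> entropy_realizes G \<phi>"
proof -
  have "\<forall>i. \<exists>f. content f = 1 \<and> \<bar>lead_coeff f\<bar> = 1 \<and> rsquarefree (cpoly f) \<and>
    0 < ln (mahler f) \<and> ln (mahler f) < (1 / 2) ^ i" for i :: nat
    using small_mahler_squarefree[OF L] by simp
  then obtain f where f: "\<And>i. \<bar>lead_coeff (f i)\<bar> = 1" "\<And>i. rsquarefree (cpoly (f i))"
    "\<And>i. 0 < ln (mahler (f i))" "\<And>i. ln (mahler (f i)) < (1 / 2) ^ i" by metis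
  have f0: "f i \<noteq> 0" for i using f(1)[of i] by auto
  define K where "K = coeff_ideal f"
  obtain G :: "'a monoid" and \<phi> E where G: "comm_group G" "\<phi> \<in> hom G G" "presented_group Polynomial.smult G \<phi> E"
    "{v. E v = \<one>\<^bsub>G\<^esub>} = K" using quotient_presentation[OF inf subspace_coeff_ideal[of f]] unfolding K_def by blast
  interpret P: presented_group Polynomial.smult G \<phi> E by (rule G(3))
  have ker: "P.ker = coeff_ideal f" using G(4) unfolding P.ker_def K_def .
  \<comment> \<open>The squared measures contribute twice the geometric series with ratio 1/2, hence
    4.\<close>
  have bound: "bipoly.entropy (coeff_ideal f) F \<le> 4" if F: "finite F" "F \<noteq> {}" for F
  proof -
    define r where "r = Suc (Max (degree ` F))"
    have "coeff v i = 0" if "v \<in> F" "i \<ge> r" for v i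
    proof -
      have "degree v \<le> Max (degree ` F)" using F that by simp
      then show ?thesis using that(2) unfolding r_def by (intro coeff_eq_0) simp
    qed
    then have "bipoly.entropy (coeff_ideal f) F \<le> ln (\<Prod>i<r. mahler (f i) ^ 2)"
      by (intro entropy_direct_sum_le f F)
    also have "\<dots> = (\<Sum>i<r. ln (mahler (f i) ^ 2))"
    proof -
      have "mahler (f i) ^ 2 \<noteq> 0" for i using mahler_ge_1[OF f0[of i]] by auto
      then show ?thesis by (intro ln_prod) auto
    qed
    also have "\<dots> \<le> (\<Sum>i<r. 2 * (1 / 2) ^ i)"
    proof (rule sum_mono)
      fix i
      have "mahler (f i) > 0" using mahler_ge_1[OF f0, of i] by simp
      then show "ln (mahler (f i) ^ 2) \<le> 2 * (1 / 2) ^ i" using f(4)[of i] by (simp add: ln_realpow)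
    qed
    also have "\<dots> = 2 * (\<Sum>i<r. (1 / 2) ^ i)" by (simp add: sum_distrib_left)
    also have "(\<Sum>i<r. (1 / 2 :: real) ^ i) \<le> 2" by (simp add: sum_gp_strict)
    finally show ?thesis by simp
  qed
  have "algebraic_entropy G \<phi> \<le> ereal 4"
    unfolding P.algebraic_entropy_eq ker by (rule SUP_least) (use bound in simp)
  then have fin: "algebraic_entropy G \<phi> < \<infinity>" by (rule le_less_trans) simp
  have "\<not> entropy_realizes G \<phi>"
  proof
    assume "entropy_realizes G \<phi>"
    then obtain F where F: "finite F" "F \<noteq> {}"
      "\<And>F'. finite F' \<Longrightarrow> F' \<noteq> {} \<Longrightarrow> bipoly.entropy (coeff_ideal f) F' \<le> bipoly.entropy (coeff_ideal f) F"
      unfolding P.entropy_realizes_iff ker by blast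
    \<comment> \<open>A coordinate beyond the support of every element of \<open>F\<close>, whose
      summand is still free to be adjoined.\<close>
    define r where "r = Suc (Max (degree ` F))"
    have "coeff v r = 0" if "v \<in> F" for v
    proof -
      have "degree v \<le> Max (degree ` F)" using F that by simp
      then show ?thesis unfolding r_def by (intro coeff_eq_0) simp
    qed
    from entropy_direct_sum_increases[of f r, OF f0 f(3) F(1,2) this] obtain E where
      "finite E" "E \<noteq> {}" "bipoly.entropy (coeff_ideal f) F < bipoly.entropy (coeff_ideal f) E" by auto
    then show False using F(3)[of E] by simp
  qed
  then show ?thesis using G(1,2) fin by blast
qed

theorem theorem1p7:
  assumes "infinite (UNIV :: 'a set)"
  shows "lehmer_infimum > 0 \<longleftrightarrow>
    (\<forall>(G :: 'a monoid) \<phi>. comm_group G \<longrightarrow> \<phi> \<in> hom G G \<longrightarrow>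
       algebraic_entropy G \<phi> < \<infinity> \<longrightarrow> entropy_realizes G \<phi>)"
proof
  assume "lehmer_infimum > 0"
  then show "\<forall>(G :: 'a monoid) \<phi>. comm_group G \<longrightarrow> \<phi> \<in> hom G G \<longrightarrow>
    algebraic_entropy G \<phi> < \<infinity> \<longrightarrow> entropy_realizes G \<phi>"
    using realizes_of_lehmer_gap by blast
next
  assume "\<forall>(G :: 'a monoid) \<phi>. comm_group G \<longrightarrow> \<phi> \<in> hom G G \<longrightarrow>
    algebraic_entropy G \<phi> < \<infinity> \<longrightarrow> entropy_realizes G \<phi>"
  then show "lehmer_infimum > 0"
    using not_realizes_of_no_lehmer_gap[OF assms] by blast
qed

end
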